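(* Let $M$ be a closed (compact, connected, without boundary) orientable smooth $3$-manifold, let $K\subset M$ be a tame knot or link, and let $\Sigma$ be a filling Dehn surface of $M$ that splits $K$. If $\hat{M}$ is a closed orientable $3$-manifold and $p:\hat{M}\to M$ is a branched covering with downstairs branching set $K$, then $\hat{\Sigma}=p^{-1}(\Sigma)$ is a filling Dehn surface of $\hat{M}$.
   Context: Everything is smooth. Surfaces are orientable, compact and without boundary, but possibly non-connected. A Dehn surface in a $3$-manifold $M$ is a subset $\Sigma=f(S)\subset M$, where $S$ is a surface (the domain of $\Sigma$) and $f:S\to M$ is an immersion in general position (its only singularities are double curves and triple points). Let $T(\Sigma)$ be the set of triple points of $\Sigma$ and $S(\Sigma)$ the set of double and triple points. An edge of $\Sigma$ is a connected component of $S(\Sigma)-T(\Sigma)$, a face is a connected component of $\Sigma-S(\Sigma)$, and a region is a connected component of $M-\Sigma$. The Dehn surface $\Sigma$ fills $M$ (is a filling Dehn surface of $M$) if it defines a cell decomposition of $M$ with $0$-skeleton $T(\Sigma)$, $1$-skeleton $S(\Sigma)$ and $2$-skeleton $\Sigma$; equivalently, all its edges, faces and regions are open disks of dimension $1$, $2$, $3$ respectively. A filling Dehn surface $\Sigma$ of $M$ splits a tame knot or link $K\subset M$ if: (1) $K$ intersects $\Sigma$ transversely in a finite set of non-singular points of $\Sigma$ (points not in $S(\Sigma)$); (2) $K-\Sigma$ is a disjoint union of open arcs; (3) for each region $R$ of $\Sigma$, if $R\cap K$ is non-empty then it is exactly one arc, unknotted in $R$ (in the usual sense: the pair $(R,R\cap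 K)$ is homeomorphic to $\mathbb{R}^3$ with a straight line); (4) for each face $F$ of $\Sigma$, $F\cap K$ contains at most one point. Branched coverings are finite-sheeted: $p$ restricts to an $n$-sheeted covering over $M-K$ and near each point of $p^{-1}(K)$ it is modelled on $(z,t)\mapsto(z^k,t)$, $(z,t)\in\mathbb{C}\times\mathbb{R}$, for some $k\ge 1$, with $K$ corresponding to $\{0\}\times\mathbb{R}$. The downstairs branching set is the branching set in the base $M$. *)

theory Defs
  imports "HOL-Analysis.Analysis"
begin

section \<open>Smooth manifolds\<close>

fun Ck_on :: "nat \<Rightarrow> ('e::real_normed_vector \<Rightarrow> 'f::real_normed_vector) \<Rightarrow> 'e set \<Rightarrow> bool" where
  "Ck_on 0 g W \<longleftrightarrow> continuous_on W g"
| "Ck_on (Suc k) g W \<longleftrightarrow> (\<forall>x\<in>W. g differentiable (at x)) \<and>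
     (\<forall>v. Ck_on k (\<lambda>x. frechet_derivative g (at x) v) W)"

text \<open>Only meaningful for open \<open>W\<close>, the only case in which it is used.\<close>

definition smooth_on :: "('e::real_normed_vector \<Rightarrow> 'f::real_normed_vector) \<Rightarrow> 'e set \<Rightarrow> bool" where
  "smooth_on g W \<longleftrightarrow> (\<forall>k. Ck_on k g W)"

text \<open>A chart is a pair of its domain and its coordinate map. The dimension of a manifold is
  that of its model space \<open>'e\<close>; the atlas need not be maximal.\<close>

record ('a, 'e) mfd =
  mtop :: "'a topology"
  atlas :: "('a set \<times> ('a \<Rightarrow> 'e)) set"

abbreviation points :: "('a, 'e) mfd \<Rightarrow> 'a set" where
  "points M \<equiv> topspace (mtop M)"

definition topological_chart ::
    "'a topology \<Rightarrow> 'a set \<Rightarrow> ('a \<Rightarrow> 'e::euclidean_space) \<Rightarrow> bool" where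
  "topological_chart X U \<phi> \<longleftrightarrow> openin X U \<and> open (\<phi> ` U) \<and>
     homeomorphic_map (subtopology X U) (top_of_set (\<phi> ` U)) \<phi>"

definition smooth_manifold :: "('a, 'e::euclidean_space) mfd \<Rightarrow> bool" where
  "smooth_manifold M \<longleftrightarrow> Hausdorff_space (mtop M) \<and> second_countable (mtop M) \<and>
     (\<forall>(U, \<phi>)\<in>atlas M. topological_chart (mtop M) U \<phi>) \<and>
     (\<Union>(U, \<phi>)\<in>atlas M. U) = points M \<and>
     (\<forall>(U, \<phi>)\<in>atlas M. \<forall>(V, \<psi>)\<in>atlas M. smooth_on (\<psi> \<circ> inv_into U \<phi>) (\<phi> ` (U \<inter> V)))"

text \<open>Members of the maximal atlas. The coordinates may take values in a Euclidean space other
  than the model space, such as \<open>complex \<times> real\<close> for a manifold modelled on \<open>real ^ 3\<close>;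
  compatibility forces the dimensions to agree.\<close>

definition smooth_chart ::
    "('a, 'e::euclidean_space) mfd \<Rightarrow> 'a set \<Rightarrow> ('a \<Rightarrow> 'f::euclidean_space) \<Rightarrow> bool" where
  "smooth_chart M U \<phi> \<longleftrightarrow> topological_chart (mtop M) U \<phi> \<and>
     (\<forall>(V, \<psi>)\<in>atlas M. smooth_on (\<psi> \<circ> inv_into U \<phi>) (\<phi> ` (U \<inter> V)) \<and>
                         smooth_on (\<phi> \<circ> inv_into V \<psi>) (\<psi> ` (U \<inter> V)))"

definition orientable :: "('a, real ^ 'n) mfd \<Rightarrow> bool" where
  "orientable M \<longleftrightarrow> (\<exists>B :: ('a set \<times> ('a \<Rightarrow> real ^ 'n)) set.
     (\<forall>(U, \<phi>)\<in>B. smooth_chart M U \<phi>) \<and> (\<Union>(U, \<phi>)\<in>B. U) = points M \<and>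
     (\<forall>(U, \<phi>)\<in>B. \<forall>(V, \<psi>)\<in>B. \<forall>x\<in>U \<inter> V.
        det (matrix (frechet_derivative (\<psi> \<circ> inv_into U \<phi>) (at (\<phi> x)))) > 0))"

definition closed_orientable_3manifold :: "('a, real ^ 3) mfd \<Rightarrow> bool" where
  "closed_orientable_3manifold M \<longleftrightarrow> smooth_manifold M \<and> orientable M \<and>
     compact_space (mtop M) \<and> connected_space (mtop M)"

text \<open>Surfaces may be disconnected.\<close>

definition closed_orientable_surface :: "('a, real ^ 2) mfd \<Rightarrow> bool" where
  "closed_orientable_surface S \<longleftrightarrow> smooth_manifold S \<and> orientable S \<and> compact_space (mtop S)"

definition smooth_map_on ::
    "('a, 'e::euclidean_space) mfd \<Rightarrow> 'a set \<Rightarrow> ('b, 'f::euclidean_space) mfd \<Rightarrow> ('a \<Rightarrow> 'b) \<Rightarrow> bool" where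
  "smooth_map_on M W N f \<longleftrightarrow> openin (mtop M) W \<and>
     continuous_map (subtopology (mtop M) W) (mtop N) f \<and>
     (\<forall>(U, \<phi>)\<in>atlas M. \<forall>(V, \<psi>)\<in>atlas N.
        smooth_on (\<psi> \<circ> f \<circ> inv_into U \<phi>) (\<phi> ` {x \<in> U \<inter> W. f x \<in> V}))"

definition diffeomorphism_on ::
    "('a, 'e::euclidean_space) mfd \<Rightarrow> 'a set \<Rightarrow> ('b, 'f::euclidean_space) mfd \<Rightarrow> 'b set \<Rightarrow>
     ('a \<Rightarrow> 'b) \<Rightarrow> bool" where
  "diffeomorphism_on M W N W' f \<longleftrightarrow> bij_betw f W W' \<and>
     smooth_map_on M W N f \<and> smooth_map_on N W' M (inv_into W f)"

text \<open>The image of the differential of \<open>f\<close> at \<open>s\<close>, read in the coordinates \<open>\<psi>\<close> around \<open>f s\<close>.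
  It is independent of the chart \<open>(U, \<phi>)\<close> around \<open>s\<close>.\<close>

definition tangent_image ::
    "('a, 'e::euclidean_space) mfd \<Rightarrow> ('a \<Rightarrow> 'b) \<Rightarrow> ('b \<Rightarrow> 'f::euclidean_space) \<Rightarrow> 'a \<Rightarrow> 'f set" where
  "tangent_image S f \<psi> s =
     (\<Union>(U, \<phi>)\<in>{(U, \<phi>)\<in>atlas S. s \<in> U}.
        range (frechet_derivative (\<psi> \<circ> f \<circ> inv_into U \<phi>) (at (\<phi> s))))"

definition immersion ::
    "('a, 'e::euclidean_space) mfd \<Rightarrow> ('b, 'f::euclidean_space) mfd \<Rightarrow> ('a \<Rightarrow> 'b) \<Rightarrow> bool" where
  "immersion S M f \<longleftrightarrow> smooth_map_on S (points S) M f \<and>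
     (\<forall>(U, \<phi>)\<in>atlas S. \<forall>(V, \<psi>)\<in>atlas M. \<forall>s\<in>U. f s \<in> V \<longrightarrow>
        inj (frechet_derivative (\<psi> \<circ> f \<circ> inv_into U \<phi>) (at (\<phi> s))))"

section \<open>Dehn surfaces\<close>

text \<open>General position: the sheets through any point intersect transversely, that is, the tangent
  planes of any \<open>m\<close> of them meet in codimension \<open>m\<close>. In particular at most three
  sheets pass through a point, so the only singularities are double curves and triple points.\<close>

definition general_position ::
    "('s, real ^ 2) mfd \<Rightarrow> ('a, real ^ 3) mfd \<Rightarrow> ('s \<Rightarrow> 'a) \<Rightarrow> bool" where
  "general_position S M f \<longleftrightarrow>
     (\<forall>(V, \<psi>)\<in>atlas M. \<forall>y\<in>V. \<forall>F. finite F \<and> F \<subseteq> {s \<in> points S. f s = y} \<longrightarrow>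
        dim (\<Inter>s\<in>F. tangent_image S f \<psi> s) + card F = 3)"

definition Dehn_immersion ::
    "('s, real ^ 2) mfd \<Rightarrow> ('a, real ^ 3) mfd \<Rightarrow> ('s \<Rightarrow> 'a) \<Rightarrow> bool" where
  "Dehn_immersion S M f \<longleftrightarrow>
     closed_orientable_surface S \<and> immersion S M f \<and> general_position S M f"

definition triple_points :: "('s, real ^ 2) mfd \<Rightarrow> ('s \<Rightarrow> 'a) \<Rightarrow> 'a set" where
  "triple_points S f = {y. card {s \<in> points S. f s = y} = 3}"

definition singular_points :: "('s, real ^ 2) mfd \<Rightarrow> ('s \<Rightarrow> 'a) \<Rightarrow> 'a set" where
  "singular_points S f = {y. card {s \<in> points S. f s = y} \<in> {2, 3}}"

definition components_of_set :: "('a, 'e) mfd \<Rightarrow> 'a set \<Rightarrow> 'a set set" where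
  "components_of_set M A = connected_components_of (subtopology (mtop M) A)"

definition edges :: "('s, real ^ 2) mfd \<Rightarrow> ('a, real ^ 3) mfd \<Rightarrow> ('s \<Rightarrow> 'a) \<Rightarrow> 'a set set" where
  "edges S M f = components_of_set M (singular_points S f - triple_points S f)"

definition faces :: "('s, real ^ 2) mfd \<Rightarrow> ('a, real ^ 3) mfd \<Rightarrow> ('s \<Rightarrow> 'a) \<Rightarrow> 'a set set" where
  "faces S M f = components_of_set M (f ` points S - singular_points S f)"

definition regions :: "('s, real ^ 2) mfd \<Rightarrow> ('a, real ^ 3) mfd \<Rightarrow> ('s \<Rightarrow> 'a) \<Rightarrow> 'a set set" where
  "regions S M f = components_of_set M (points M - f ` points S)"

definition open_disk :: "nat \<Rightarrow> ('a, 'e) mfd \<Rightarrow> 'a set \<Rightarrow> bool" where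
  "open_disk k M A \<longleftrightarrow> subtopology (mtop M) A homeomorphic_space Euclidean_space k"

definition fills :: "('s, real ^ 2) mfd \<Rightarrow> ('a, real ^ 3) mfd \<Rightarrow> ('s \<Rightarrow> 'a) \<Rightarrow> bool" where
  "fills S M f \<longleftrightarrow> Dehn_immersion S M f \<and>
     (\<forall>e\<in>edges S M f. open_disk 1 M e) \<and>
     (\<forall>F\<in>faces S M f. open_disk 2 M F) \<and>
     (\<forall>R\<in>regions S M f. open_disk 3 M R)"

text \<open>The domain of a Dehn surface is an abstract surface. Taking its points in the type \<open>real\<close>,
  with an arbitrary topology unrelated to the usual one, is no restriction: a second countable
  Hausdorff space has at most continuum many points, so every surface is diffeomorphic to one of
  this kind. The triple and singular points do not depend on the choice of \<open>S\<close> and \<open>f\<close>.\<close>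

definition filling_Dehn_surface :: "('a, real ^ 3) mfd \<Rightarrow> 'a set \<Rightarrow> bool" where
  "filling_Dehn_surface M \<Sigma> \<longleftrightarrow>
     (\<exists>(S :: (real, real ^ 2) mfd) f. fills S M f \<and> f ` points S = \<Sigma>)"

section \<open>Links and splitting\<close>

text \<open>The line is the third coordinate axis of \<open>complex \<times> real\<close>. In the smooth category a tame link
  is a closed one-dimensional submanifold; slice charts straighten it.\<close>

definition axis :: "(complex \<times> real) set" where
  "axis = {0} \<times> UNIV"

definition slice_chart ::
    "('a, real ^ 3) mfd \<Rightarrow> 'a set \<Rightarrow> 'a set \<Rightarrow> ('a \<Rightarrow> complex \<times> real) \<Rightarrow> bool" where
  "slice_chart M K U \<phi> \<longleftrightarrow> smooth_chart M U \<phi> \<and> \<phi> ` (U \<inter> K) = \<phi> ` U \<inter> axis"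

definition tame_link :: "('a, real ^ 3) mfd \<Rightarrow> 'a set \<Rightarrow> bool" where
  "tame_link M K \<longleftrightarrow> K \<noteq> {} \<and> compactin (mtop M) K \<and>
     (\<forall>y\<in>K. \<exists>U \<phi>. y \<in> U \<and> slice_chart M K U \<phi>)"

definition transverse ::
    "('s, real ^ 2) mfd \<Rightarrow> ('a, real ^ 3) mfd \<Rightarrow> ('s \<Rightarrow> 'a) \<Rightarrow> 'a set \<Rightarrow> bool" where
  "transverse S M f K \<longleftrightarrow> (\<forall>s\<in>points S. f s \<in> K \<longrightarrow>
     (\<exists>V \<psi>. f s \<in> V \<and> slice_chart M K V \<psi> \<and>
        {a + b |a b. a \<in> tangent_image S f \<psi> s \<and> b \<in> axis} = UNIV))"

definition unknotted_in :: "('a, real ^ 3) mfd \<Rightarrow> 'a set \<Rightarrow> 'a set \<Rightarrow> bool" where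
  "unknotted_in M R A \<longleftrightarrow> (\<exists>h :: 'a \<Rightarrow> complex \<times> real.
     homeomorphic_map (subtopology (mtop M) R) euclidean h \<and> h ` A = axis)"

definition splits :: "('a, real ^ 3) mfd \<Rightarrow> 'a set \<Rightarrow> 'a set \<Rightarrow> bool" where
  "splits M \<Sigma> K \<longleftrightarrow> (\<exists>(S :: (real, real ^ 2) mfd) f. fills S M f \<and> f ` points S = \<Sigma> \<and>
     finite (K \<inter> \<Sigma>) \<and> K \<inter> singular_points S f = {} \<and> transverse S M f K \<and>
     (\<forall>A\<in>components_of_set M (K - \<Sigma>). open_disk 1 M A) \<and>
     (\<forall>R\<in>regions S M f. R \<inter> K \<noteq> {} \<longrightarrow>
        R \<inter> K \<in> components_of_set M (K - \<Sigma>) \<and> unknotted_in M R (R \<inter> K)) \<and>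
     (\<forall>F\<in>faces S M f. \<forall>x\<in>F \<inter> K. \<forall>y\<in>F \<inter> K. x = y))"

section \<open>Branched coverings\<close>

definition evenly_covered ::
    "('b, real ^ 3) mfd \<Rightarrow> ('a, real ^ 3) mfd \<Rightarrow> ('b \<Rightarrow> 'a) \<Rightarrow> nat \<Rightarrow> 'a set \<Rightarrow> bool" where
  "evenly_covered N M p n W \<longleftrightarrow> (\<exists>\<V>. finite \<V> \<and> card \<V> = n \<and> pairwise disjnt \<V> \<and>
     \<Union>\<V> = {x \<in> points N. p x \<in> W} \<and> (\<forall>V\<in>\<V>. diffeomorphism_on N V M W p))"

text \<open>The coordinates \<open>\<psi>\<close> form a slice chart for \<open>K\<close>; the local degree \<open>k\<close> may be \<open>1\<close>. The number
  of sheets is positive, which excludes an empty total space.\<close>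

definition branched_covering ::
    "('b, real ^ 3) mfd \<Rightarrow> ('a, real ^ 3) mfd \<Rightarrow> 'a set \<Rightarrow> ('b \<Rightarrow> 'a) \<Rightarrow> bool" where
  "branched_covering N M K p \<longleftrightarrow> smooth_map_on N (points N) M p \<and>
     (\<exists>n\<ge>1. \<forall>y\<in>points M - K. \<exists>W. openin (mtop M) W \<and> y \<in> W \<and> W \<inter> K = {} \<and>
        evenly_covered N M p n W) \<and>
     (\<forall>x\<in>points N. p x \<in> K \<longrightarrow>
        (\<exists>k\<ge>1. \<exists>U V (\<phi> :: 'b \<Rightarrow> complex \<times> real) \<psi>. x \<in> U \<and> smooth_chart N U \<phi> \<and>
           slice_chart M K V \<psi> \<and> p ` U \<subseteq> V \<and>
           (\<forall>u\<in>U. \<psi> (p u) = (fst (\<phi> u) ^ k, snd (\<phi> u)))))"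

end

theory Submission
  imports Defs
begin

text \<open>The domain of the preimage of \<open>\<Sigma> = f(S)\<close> is the fibre product of \<open>f\<close> and \<open>p\<close>. Away from \<open>K\<close> the
  map \<open>p\<close> is a local diffeomorphism, so the fibre product inherits oriented charts from \<open>S\<close> and
  general position is preserved. At a point of \<open>K \<inter> \<Sigma>\<close> the surface is, by transversality, a graph
  \<open>t = \<tau>(z)\<close> in a slice chart, and its preimage under \<open>(z, t) \<mapsto> (z\<^sup>k, t)\<close> is the graph \<open>t = \<tau>(z\<^sup>k)\<close>.

  An edge, and a face or region that misses \<open>K\<close>, is a cell over which \<open>p\<close> is a covering, so every
  component of its preimage is a copy of it. A face or region that meets \<open>K\<close> is homeomorphic to
  \<open>\<complex> \<times> T\<close> with \<open>K\<close> corresponding to \<open>0 \<times> T\<close>, where \<open>T\<close> is a point or a line. Lifting the exponential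
  covering of \<open>(\<complex> - 0) \<times> T\<close> shows that a component of the unbranched part is again \<open>(\<complex> - 0) \<times> T\<close>,
  covering by \<open>(z, t) \<mapsto> (z\<^sup>m, t)\<close>; properness and the local model extend this over \<open>0 \<times> T\<close>.\<close>

section \<open>Lifting in finite coverings\<close>

text \<open>Covering theory enters only through lifts. A component of a covering is recovered as the
  image of the lift of an open map \<open>e\<close> out of a closed convex set: the image is open
  because \<open>e\<close> is, and closed because two lifts whose images meet differ by a deck map
  of \<open>e\<close>. No fundamental group and no classification of coverings is involved; a cell
  and a punctured plane differ only in the choice of \<open>e\<close>. The obstacle is the branching
  set, which the covering away from \<open>K\<close> cannot see. What helps there is that small
  neighbourhoods upstairs stay connected and dense when the points over \<open>K\<close> are
  removed. For a region this is read off from the branched chart of \<open>p\<close>; a face is not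
  open in \<open>M\<close>, and there it is read off from a chart of the fibre product.
  Orientability of the new domain comes from \<open>S\<close>: the coordinate map to
  \<open>S\<close> is locally a diffeomorphism or a power map, and both preserve a suitable
  orientation. Since the domain of a Dehn surface must have its points in \<open>real\<close>, the
  fibre product is studied as an arbitrary homeomorphic copy and moved into the reals at the
  end.\<close>

definition finite_covering :: "'a topology \<Rightarrow> 'b topology \<Rightarrow> ('a \<Rightarrow> 'b) \<Rightarrow> bool" where
  "finite_covering X Y q \<longleftrightarrow> continuous_map X Y q \<and>
     (\<forall>y\<in>topspace Y. \<exists>W \<V>. openin Y W \<and> y \<in> W \<and> finite \<V> \<and> pairwise disjnt \<V> \<and>
        \<Union>\<V> = {x \<in> topspace X. q x \<in> W} \<and>
        (\<forall>V\<in>\<V>. openin X V \<and> homeomorphic_map (subtopology X V) (subtopology Y W) q))"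

text \<open>The rest of the preimage of \<open>W\<close> is required to be open too: this is what
  makes the set where two lifts differ open.\<close>

definition sheet :: "'a topology \<Rightarrow> 'b topology \<Rightarrow> ('a \<Rightarrow> 'b) \<Rightarrow> 'b set \<Rightarrow> 'a set \<Rightarrow> ('b \<Rightarrow> 'a) \<Rightarrow> bool" where
  "sheet X Y q W V s \<longleftrightarrow> openin X V \<and> openin X ({x \<in> topspace X. q x \<in> W} - V) \<and>
     continuous_map (subtopology Y W) X s \<and> (\<forall>w\<in>W. s w \<in> V \<and> q (s w) = w) \<and>
     (\<forall>v\<in>V. q v \<in> W \<and> s (q v) = v)"

lemma finite_covering_sheets:
  assumes "finite_covering X Y q" "y \<in> topspace Y"
  obtains W where "openin Y W" "y \<in> W" "W \<subseteq> topspace Y"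
    "\<And>x. x \<in> topspace X \<Longrightarrow> q x \<in> W \<Longrightarrow> \<exists>V s. x \<in> V \<and> sheet X Y q W V s"
proof -
  obtain W \<V> where W: "openin Y W" "y \<in> W" and dis: "pairwise disjnt \<V>"
    and Un: "\<Union>\<V> = {x \<in> topspace X. q x \<in> W}"
    and V: "\<And>V. V \<in> \<V> \<Longrightarrow> openin X V \<and> homeomorphic_map (subtopology X V) (subtopology Y W) q"
    using assms unfolding finite_covering_def by metis
  have WY: "W \<subseteq> topspace Y" using W openin_subset by blast
  show thesis
  proof (rule that[OF W WY])
    fix x assume x: "x \<in> topspace X" "q x \<in> W"
    then obtain V where VV: "V \<in> \<V>" "x \<in> V" using Un by blast
    have oV: "openin X V" "V \<subseteq> topspace X" using V VV openin_subset by blast+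
    obtain s where s: "homeomorphic_maps (subtopology X V) (subtopology Y W) q s"
      using V VV homeomorphic_map_maps by blast
    have "{x \<in> topspace X. q x \<in> W} - V = \<Union>(\<V> - {V})"
    proof -
      have "V' \<inter> V = {}" if "V' \<in> \<V> - {V}" for V'
        using that VV dis pairwiseD[of disjnt \<V> V' V] by (auto simp: disjnt_def)
      then show ?thesis unfolding Un[symmetric] using VV by blast
    qed
    then have cl: "openin X ({x \<in> topspace X. q x \<in> W} - V)" using V by auto
    have cs: "continuous_map (subtopology Y W) X s"
      using s unfolding homeomorphic_maps_def continuous_map_in_subtopology by auto
    have sV: "\<forall>w\<in>W. s w \<in> V \<and> q (s w) = w"
      using s WY unfolding homeomorphic_maps_def continuous_map_in_subtopology by (auto simp: Pi_iff)
    have "\<forall>v\<in>V. q v \<in> W \<and> s (q v) = v"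
      using s oV unfolding homeomorphic_maps_def continuous_map_in_subtopology by (auto simp: Pi_iff)
    then show "\<exists>V s. x \<in> V \<and> sheet X Y q W V s"
      unfolding sheet_def
      using VV oV cl cs sV by blast
  qed
qed

lemma finite_covering_continuous: "finite_covering X Y q \<Longrightarrow> continuous_map X Y q"
  by (simp add: finite_covering_def)

text \<open>Distinct points of a fibre lie in distinct sheets, so the fibre injects into the finite
  family of sheets. The lifted exponential owes its period to this.\<close>

lemma finite_covering_finite_fibre:
  assumes "finite_covering X Y q" "y \<in> topspace Y"
  shows "finite {x \<in> topspace X. q x = y}"
proof -
  obtain W \<V> where W: "openin Y W" "y \<in> W" and fin: "finite \<V>"
    and Un: "\<Union>\<V> = {x \<in> topspace X. q x \<in> W}"
    and V: "\<And>V. V \<in> \<V> \<Longrightarrow> openin X V \<and> homeomorphic_map (subtopology X V) (subtopology Y W) q"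
    using assms unfolding finite_covering_def by metis
  have inj: "inj_on q V" if "V \<in> \<V>" for V
    using V[OF that] homeomorphic_imp_injective_map openin_subset[of X V]
    by (metis inf.absorb_iff2 topspace_subtopology)
  have "\<forall>x\<in>{x \<in> topspace X. q x = y}. \<exists>V\<in>\<V>. x \<in> V" using Un W by blast
  then obtain v where v: "\<And>x. x \<in> {x \<in> topspace X. q x = y} \<Longrightarrow> v x \<in> \<V> \<and> x \<in> v x" by metis
  have "inj_on v {x \<in> topspace X. q x = y}"
    by (rule inj_onI) (metis (mono_tags, lifting) inj inj_onD mem_Collect_eq v)
  moreover have "v ` {x \<in> topspace X. q x = y} \<subseteq> \<V>" using v by blast
  ultimately show ?thesis using fin finite_imageD finite_subset by blast
qed

text \<open>The set \<open>D\<close> of agreement is clopen: near a point of agreement both lifts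
  run in one sheet, near a point of disagreement one runs in a sheet and the other in its open
  complement.\<close>

lemma finite_covering_lift_unique:
  assumes cov: "finite_covering X Y q" and Z: "connected_space Z"
    and \<sigma>: "continuous_map Z X \<sigma>" and \<tau>: "continuous_map Z X \<tau>"
    and eq: "\<And>z. z \<in> topspace Z \<Longrightarrow> q (\<sigma> z) = q (\<tau> z)"
    and z0: "z0 \<in> topspace Z" "\<sigma> z0 = \<tau> z0" and z: "z \<in> topspace Z"
  shows "\<sigma> z = \<tau> z"
proof -
  define D where "D = {z \<in> topspace Z. \<sigma> z = \<tau> z}"
  have qX: "q x \<in> topspace Y" if "x \<in> topspace X" for x
    using finite_covering_continuous[OF cov] that by (auto simp: continuous_map_def Pi_iff)
  have im: "\<sigma> z \<in> topspace X" "\<tau> z \<in> topspace X" if "z \<in> topspace Z" for z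
    using \<sigma> \<tau> that by (auto simp: continuous_map_def Pi_iff)
  have "openin Z D"
  proof (subst openin_subopen, clarify)
    fix z assume "z \<in> D"
    then have z: "z \<in> topspace Z" "\<sigma> z = \<tau> z" by (auto simp: D_def)
    obtain W where W: "q (\<sigma> z) \<in> W" and
      sh: "\<And>x. x \<in> topspace X \<Longrightarrow> q x \<in> W \<Longrightarrow> \<exists>V s. x \<in> V \<and> sheet X Y q W V s"
      by (rule finite_covering_sheets[OF cov qX[OF im(1)[OF z(1)]]]) blast
    obtain V s where V: "\<sigma> z \<in> V" "openin X V" "\<forall>v\<in>V. s (q v) = v"
       "openin X ({x \<in> topspace X. q x \<in> W} - V)"
      using sh[OF im(1)[OF z(1)] W] unfolding sheet_def by blast
    let ?G = "{z \<in> topspace Z. \<sigma> z \<in> V} \<inter> {z \<in> topspace Z. \<tau> z \<in> V}"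
    have "openin Z ?G"
      by (intro openin_Int openin_continuous_map_preimage[OF \<sigma>] openin_continuous_map_preimage[OF \<tau>] V)
    moreover have "z \<in> ?G" using z V by auto
    moreover have "?G \<subseteq> D" 
    proof
      fix y assume "y \<in> ?G"
      then have y: "y \<in> topspace Z" "\<sigma> y \<in> V" "\<tau> y \<in> V" by auto
      then have "s (q (\<sigma> y)) = \<sigma> y" "s (q (\<tau> y)) = \<tau> y" using V by auto
      then have "\<sigma> y = \<tau> y" using eq[OF y(1)] by metis
      then show "y \<in> D" unfolding D_def using y by blast
    qed
    ultimately show "\<exists>T. openin Z T \<and> z \<in> T \<and> T \<subseteq> D" by blast
  qed
  moreover have "openin Z (topspace Z - D)"
  proof (subst openin_subopen, clarify)
    fix z assume z: "z \<in> topspace Z" "z \<notin> D"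
    obtain W where W: "q (\<sigma> z) \<in> W" and
      sh: "\<And>x. x \<in> topspace X \<Longrightarrow> q x \<in> W \<Longrightarrow> \<exists>V s. x \<in> V \<and> sheet X Y q W V s"
      by (rule finite_covering_sheets[OF cov qX[OF im(1)[OF z(1)]]]) blast
    obtain V s where V: "\<sigma> z \<in> V" "openin X V" "\<forall>v\<in>V. s (q v) = v"
       "openin X ({x \<in> topspace X. q x \<in> W} - V)"
      using sh[OF im(1)[OF z(1)] W] unfolding sheet_def by blast
    have "\<tau> z \<notin> V" 
    proof
      assume "\<tau> z \<in> V"
      then have "s (q (\<sigma> z)) = \<sigma> z" "s (q (\<tau> z)) = \<tau> z" using V by auto
      then have "\<sigma> z = \<tau> z" using eq[OF z(1)] by metis
      then show False using z unfolding D_def by blast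
    qed
    let ?G = "{z \<in> topspace Z. \<sigma> z \<in> V} \<inter> {z \<in> topspace Z. \<tau> z \<in> {x \<in> topspace X. q x \<in> W} - V}"
    have "openin Z ?G"
      by (intro openin_Int openin_continuous_map_preimage[OF \<sigma>] openin_continuous_map_preimage[OF \<tau>] V)
    moreover have "z \<in> ?G" using z V W im eq \<open>\<tau> z \<notin> V\<close> by auto
    moreover have "?G \<subseteq> topspace Z - D" unfolding D_def by auto
    ultimately show "\<exists>T. openin Z T \<and> z \<in> T \<and> T \<subseteq> topspace Z - D" by blast
  qed
  ultimately have "D = {} \<or> D = topspace Z"
    using Z unfolding connected_space_clopen_in closedin_def D_def by blast
  then show ?thesis using z0 z unfolding D_def by blast
qed

section \<open>Existence of lifts over closed convex sets\<close>

lemma exists_closer_point: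
  fixes w0 :: "'e::euclidean_space"
  assumes "convex E" "w0 \<in> E" "c \<in> E" "dist w0 c = r" "r > 0" "open G" "c \<in> G"
  obtains a where "a \<in> E" "a \<in> G" "a \<in> ball w0 r"
proof -
  obtain \<epsilon> where e: "\<epsilon> > 0" "ball c \<epsilon> \<subseteq> G" using assms open_contains_ball by blast
  \<comment> \<open>The point \<open>a\<close> lies on the segment from \<open>c\<close> to
    \<open>w0\<close>, at distance \<open>u * r\<close> from \<open>c\<close>. The bound by
    \<open>\<epsilon> / (2*r)\<close> keeps it near \<open>c\<close>, and \<open>u > 0\<close>
    brings it inside the ball.\<close>
  define u where "u = min (1/2) (\<epsilon> / (2*r))"
  have u: "0 < u" "u < 1" "u * r < \<epsilon>"
    unfolding u_def using e assms by (auto simp: min_def field_simps)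
  define a where "a = c + u *\<^sub>R (w0 - c)"
  have "a \<in> E" unfolding a_def using assms u convexD_alt[of E c w0 u]
    by (simp add: algebra_simps)
  have "dist c a = u * r" unfolding a_def dist_norm using u assms by (simp add: dist_norm)
  have "w0 - a = (1-u) *\<^sub>R (w0 - c)" unfolding a_def by (simp add: algebra_simps)
  then have "dist w0 a = (1-u) * r" unfolding dist_norm using u assms by (simp add: dist_norm)
  moreover have "u * r > 0" using u assms by simp
  ultimately have "a \<in> ball w0 r" by (simp add: algebra_simps)
  moreover have "a \<in> G" using e u \<open>dist c a = u * r\<close> by auto
  ultimately show thesis using that \<open>a \<in> E\<close> by blast
qed

text \<open>The points of \<open>E\<close> that escape from \<open>G\<close> within radius
  \<open>r + 1\<close> form a compact set; if it is non-empty, its distance from \<open>w0\<close>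
  is attained, exceeds \<open>r\<close>, and serves as the new radius.\<close>

lemma compact_ball_enlarge:
  fixes w0 :: "'e::euclidean_space"
  assumes "closed E" "open G" "E \<inter> cball w0 r \<subseteq> G"
  obtains r' where "r' > r" "E \<inter> ball w0 r' \<subseteq> G"
proof (cases "E \<inter> cball w0 (r+1) \<subseteq> G")
  case True
  have "E \<inter> ball w0 (r+1) \<subseteq> E \<inter> cball w0 (r+1)" by auto
  then show thesis using that[of "r+1"] True by force
next
  case False
  let ?K = "E \<inter> cball w0 (r+1) - G"
  have "compact ?K" using assms
    by (metis (no_types, lifting) compact_Int_closed compact_cball compact_diff inf_commute)
  then obtain m where m: "m \<in> ?K" "\<forall>x\<in>?K. dist w0 m \<le> dist w0 x"
    by (rule distance_attains_inf[of ?K w0, OF compact_imp_closed]) (use False in blast)+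
  have "m \<notin> cball w0 r" using m assms(3) by blast
  then have "dist w0 m > r" by simp
  moreover have "E \<inter> ball w0 (dist w0 m) \<subseteq> G"
  proof
    fix x assume x: "x \<in> E \<inter> ball w0 (dist w0 m)"
    then have "x \<in> E" "x \<in> cball w0 (r+1)" "\<not> dist w0 m \<le> dist w0 x" using m(1) by auto
    then show "x \<in> G" using m(2) by blast
  qed
  ultimately show thesis using that by blast
qed

context
  fixes X :: "'a topology" and Y :: "'b topology" and q :: "'a \<Rightarrow> 'b"
    and E :: "'e::euclidean_space set" and e :: "'e \<Rightarrow> 'b" and w0 :: 'e and x0 :: 'a
  assumes cov: "finite_covering X Y q" and cvx: "convex E" and clo: "closed E"
    and e: "continuous_map (top_of_set E) Y e"
    and w0: "w0 \<in> E" and x0: "x0 \<in> topspace X" and qx0: "q x0 = e w0"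
begin

private definition lift_on :: "'e set \<Rightarrow> ('e \<Rightarrow> 'a) \<Rightarrow> bool" where
  "lift_on D \<sigma> \<longleftrightarrow> continuous_map (top_of_set D) X \<sigma> \<and> (\<forall>w\<in>D. q (\<sigma> w) = e w)"

private lemma lift_on_subset: "lift_on D \<sigma> \<Longrightarrow> D' \<subseteq> D \<Longrightarrow> lift_on D' \<sigma>"
  unfolding lift_on_def
  by (metis continuous_map_from_subtopology_mono subset_eq)

private lemma lift_on_unique:
  assumes "lift_on D \<sigma>" "lift_on D' \<tau>" "convex (D \<inter> D')" "a \<in> D" "a \<in> D'" "\<sigma> a = \<tau> a"
    "z \<in> D" "z \<in> D'"
  shows "\<sigma> z = \<tau> z"
proof (rule finite_covering_lift_unique[OF cov, of "top_of_set (D \<inter> D')"])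
  show "connected_space (top_of_set (D \<inter> D'))"
    using convex_connected[OF assms(3)] connectedin_def connectedin_iff_connected by blast
  show "continuous_map (top_of_set (D \<inter> D')) X \<sigma>" "continuous_map (top_of_set (D \<inter> D')) X \<tau>"
    using assms lift_on_subset[of D \<sigma> "D \<inter> D'"] lift_on_subset[of D' \<tau> "D \<inter> D'"]
    unfolding lift_on_def by auto
  show "\<And>z. z \<in> topspace (top_of_set (D \<inter> D')) \<Longrightarrow> q (\<sigma> z) = q (\<tau> z)"
    using assms unfolding lift_on_def by auto
qed (use assms in auto)

text \<open>The radius depends on \<open>c\<close> only: the whole piece is mapped into one evenly
  covered set, and the section of the sheet through \<open>x\<close>, composed with
  \<open>e\<close>, is the lift. So the base point \<open>w\<close> can be chosen
  afterwards.\<close>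

private lemma lift_on_local:
  assumes c: "c \<in> E"
  obtains d where "d > 0" "\<And>w x. w \<in> E \<inter> ball c d \<Longrightarrow> x \<in> topspace X \<Longrightarrow> q x = e w \<Longrightarrow>
      \<exists>\<tau>. lift_on (E \<inter> ball c d) \<tau> \<and> \<tau> w = x"
proof -
  have "e c \<in> topspace Y" using e c by (auto simp: continuous_map_def Pi_iff)
  then obtain W where W: "openin Y W" "e c \<in> W" "W \<subseteq> topspace Y" and
    sh: "\<And>x. x \<in> topspace X \<Longrightarrow> q x \<in> W \<Longrightarrow> \<exists>V s. x \<in> V \<and> sheet X Y q W V s"
    using finite_covering_sheets[OF cov] by blast
  have "openin (top_of_set E) {w \<in> E. e w \<in> W}"
    using openin_continuous_map_preimage[OF e W(1)] by simp
  then obtain d where d: "d > 0" "E \<inter> ball c d \<subseteq> {w \<in> E. e w \<in> W}"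
    using c W(2) unfolding openin_contains_ball by (metis (no_types, lifting) inf_commute mem_Collect_eq)
  show thesis
  proof (rule that[OF d(1)])
    fix w x assume w: "w \<in> E \<inter> ball c d" and x: "x \<in> topspace X" "q x = e w"
    have "q x \<in> W" using x w d by auto
    from sh[OF x(1) this] obtain V s where V: "x \<in> V" "continuous_map (subtopology Y W) X s"
      "\<forall>w\<in>W. s w \<in> V \<and> q (s w) = w" "\<forall>v\<in>V. s (q v) = v"
      unfolding sheet_def by blast
    have "continuous_map (top_of_set (E \<inter> ball c d)) (subtopology Y W) e"
      unfolding continuous_map_in_subtopology
      using d continuous_map_from_subtopology_mono[OF e, of "E \<inter> ball c d"] by auto
    then have "continuous_map (top_of_set (E \<inter> ball c d)) X (s \<circ> e)"
      using V(2) continuous_map_compose by blast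
    moreover have "\<forall>w\<in>E \<inter> ball c d. q ((s \<circ> e) w) = e w" using V(3) d by auto
    moreover have "(s \<circ> e) w = x" using V x by (metis comp_apply)
    ultimately show "\<exists>\<tau>. lift_on (E \<inter> ball c d) \<tau> \<and> \<tau> w = x" unfolding lift_on_def by blast
  qed
qed

text \<open>Local lifts along the sphere of radius \<open>r\<close> in \<open>E\<close> are matched
  with \<open>\<sigma>\<close> inside the ball; compactness then yields one larger radius.\<close>

private lemma lift_on_extend:
  assumes r: "r > 0" and \<sigma>: "lift_on (E \<inter> ball w0 r) \<sigma>" "\<sigma> w0 = x0"
  shows "\<exists>r'>r. \<exists>\<tau>. lift_on (E \<inter> ball w0 r') \<tau> \<and> \<tau> w0 = x0"
proof -
  define B where "B = E \<inter> ball w0 r"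
  have \<sigma>X: "\<sigma> a \<in> topspace X" "q (\<sigma> a) = e a" if "a \<in> B" for a
    using \<sigma> that unfolding lift_on_def B_def by (auto simp: continuous_map_def Pi_iff)
  have "\<exists>d \<tau>. d > 0 \<and> lift_on (E \<inter> ball c d) \<tau> \<and> (\<forall>z \<in> B \<inter> (E \<inter> ball c d). \<sigma> z = \<tau> z)"
    if c: "c \<in> E" "dist w0 c = r" for c
  proof -
    obtain d where d: "d > 0" and ex: "\<And>w x. w \<in> E \<inter> ball c d \<Longrightarrow> x \<in> topspace X \<Longrightarrow> q x = e w \<Longrightarrow>
      \<exists>\<tau>. lift_on (E \<inter> ball c d) \<tau> \<and> \<tau> w = x" using lift_on_local[OF c(1)] by metis
    \<comment> \<open>The lift \<open>\<sigma>\<close> has no value at \<open>c\<close> itself, so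
      the local lift is normalised at a nearby point of the open ball.\<close>
    obtain a where a: "a \<in> E" "a \<in> ball c d" "a \<in> ball w0 r"
      using exists_closer_point[OF cvx w0 c r, of "ball c d"] d by auto
    then have aB: "a \<in> B" "a \<in> E \<inter> ball c d" by (auto simp: B_def)
    obtain \<tau> where \<tau>: "lift_on (E \<inter> ball c d) \<tau>" "\<tau> a = \<sigma> a"
      using ex[OF aB(2) \<sigma>X[OF aB(1)]] by blast
    have "convex (B \<inter> (E \<inter> ball c d))" unfolding B_def using cvx by (intro convex_Int) auto
    then have "\<forall>z \<in> B \<inter> (E \<inter> ball c d). \<sigma> z = \<tau> z"
      using lift_on_unique[of B \<sigma> "E \<inter> ball c d" \<tau> a] \<sigma>(1) \<tau> aB unfolding B_def[symmetric] by auto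
    then show ?thesis using \<tau> d by blast
  qed
  then obtain d \<tau> where d\<tau>: "\<And>c. c \<in> E \<Longrightarrow> dist w0 c = r \<Longrightarrow> d c > 0 \<and> lift_on (E \<inter> ball c (d c)) (\<tau> c) \<and>
     (\<forall>z \<in> B \<inter> (E \<inter> ball c (d c)). \<sigma> z = \<tau> c z)" by metis
  define S where "S = {c \<in> E. dist w0 c = r}"
  \<comment> \<open>Radii are halved so that when two of the small balls meet, the full ball with
    the larger radius contains the centre of the other. The full balls then share a point inside the
    ball of radius \<open>r\<close>, where both local lifts equal \<open>\<sigma>\<close>.\<close>
  define G where "G = ball w0 r \<union> (\<Union>c\<in>S. ball c (d c / 2))"
  have "E \<inter> cball w0 r \<subseteq> G"
  proof
    fix x assume "x \<in> E \<inter> cball w0 r"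
    then show "x \<in> G" unfolding G_def S_def using d\<tau>[of x] by (cases "dist w0 x = r") auto
  qed
  moreover have "open G" unfolding G_def by auto
  ultimately obtain r' where r': "r' > r" "E \<inter> ball w0 r' \<subseteq> G"
    using compact_ball_enlarge[OF clo] by blast
  \<comment> \<open>\<open>None\<close> indexes the given lift on the ball of radius
    \<open>r\<close>, \<open>Some c\<close> the local lift at the point \<open>c\<close> of the
    sphere.\<close>
  define T where "T = (\<lambda>c. E \<inter> ball w0 r' \<inter> (if c = None then ball w0 r else ball (the c) (d (the c) / 2)))"
  define f where "f = (\<lambda>c. if c = None then \<sigma> else \<tau> (the c))"
  have half: "E \<inter> ball c (d c / 2) \<subseteq> E \<inter> ball c (d c)" if "c \<in> S" for c
    using d\<tau>[of c] that unfolding S_def by auto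
  have lf: "lift_on (T c) (f c)" if "c \<in> insert None (Some ` S)" for c
  proof (cases c)
    case None then show ?thesis
      unfolding T_def f_def by (auto intro!: lift_on_subset[OF \<sigma>(1)])
  next
    case (Some c') then have c': "c' \<in> S" using that by auto
    have "E \<inter> ball w0 r' \<inter> ball c' (d c' / 2) \<subseteq> E \<inter> ball c' (d c')" using half[OF c'] by blast
    then show ?thesis
      unfolding T_def f_def using lift_on_subset d\<tau>[of c'] c' Some unfolding S_def by auto
  qed
  have agree0: "\<tau> c z = \<tau> c' z" if c: "c \<in> S" "c' \<in> S" "d c' \<le> d c"
      "z \<in> E" "z \<in> ball c (d c / 2)" "z \<in> ball c' (d c' / 2)" for c c' z
  proof -
    have cc: "c \<in> E" "dist w0 c = r" "c' \<in> E" "dist w0 c' = r" using c by (auto simp: S_def)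
    have "dist c c' \<le> dist c z + dist z c'" by (rule dist_triangle)
    also have "\<dots> < d c" using c by (simp add: dist_commute)
    finally have "c' \<in> ball c (d c) \<inter> ball c' (d c')" using d\<tau>[OF cc(3,4)] by auto
    then obtain a where a: "a \<in> E" "a \<in> ball c (d c) \<inter> ball c' (d c')" "a \<in> ball w0 r"
      using exists_closer_point[OF cvx w0 cc(3,4) r, of "ball c (d c) \<inter> ball c' (d c')"] by blast
    have aa: "a \<in> B \<inter> (E \<inter> ball c (d c))" "a \<in> B \<inter> (E \<inter> ball c' (d c'))"
      using a by (auto simp: B_def)
    have "\<tau> c a = \<tau> c' a" using d\<tau>[OF cc(1,2)] d\<tau>[OF cc(3,4)] aa by metis
    moreover have "convex ((E \<inter> ball c (d c)) \<inter> (E \<inter> ball c' (d c')))" using cvx by (intro convex_Int) auto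
    moreover have "z \<in> E \<inter> ball c (d c)" "z \<in> E \<inter> ball c' (d c')" using c half by blast+
    ultimately show ?thesis
      using lift_on_unique[of "E \<inter> ball c (d c)" "\<tau> c" "E \<inter> ball c' (d c')" "\<tau> c'" a z]
        d\<tau>[OF cc(1,2)] d\<tau>[OF cc(3,4)] aa by blast
  qed
  have agree1: "\<tau> c z = \<tau> c' z" if c: "c \<in> S" "c' \<in> S" 
      "z \<in> E" "z \<in> ball c (d c / 2)" "z \<in> ball c' (d c' / 2)" for c c' z
    using agree0[of c c' z] agree0[of c' c z] c by (cases "d c' \<le> d c") auto
  have agree2: "\<sigma> z = \<tau> c z" if c: "c \<in> S" "z \<in> E" "z \<in> ball c (d c / 2)" "z \<in> ball w0 r" for c z
  proof -
    have "z \<in> B \<inter> (E \<inter> ball c (d c))" using c half unfolding B_def by blast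
    then show ?thesis using d\<tau>[of c] c unfolding S_def by blast
  qed
  have agree: "f c z = f c' z" if "c \<in> insert None (Some ` S)" "c' \<in> insert None (Some ` S)" "z \<in> T c" "z \<in> T c'" for c c' z
    using that unfolding f_def T_def by (auto intro: agree1 agree2 agree2[symmetric])
  let ?D = "E \<inter> ball w0 r'"
  have TD: "T c \<subseteq> ?D" for c by (auto simp: T_def)
  have cover: "?D \<subseteq> (\<Union>i\<in>insert None (Some ` S). T i)"
    proof
      fix x assume x: "x \<in> ?D"
      then consider "x \<in> ball w0 r" | c where "c \<in> S" "x \<in> ball c (d c / 2)"
        using r'(2) unfolding G_def by blast
      then show "x \<in> (\<Union>i\<in>insert None (Some ` S). T i)"
      proof cases
        case 1 then have "x \<in> T None" using x unfolding T_def by simp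
        then show ?thesis by blast
      next
        case 2 then have "x \<in> T (Some c)" using x unfolding T_def by simp
        then show ?thesis using 2 by blast
      qed
    qed
  obtain g where g: "continuous_map (top_of_set ?D) X g"
    "\<And>x i. i \<in> insert None (Some ` S) \<Longrightarrow> x \<in> topspace (top_of_set ?D) \<inter> T i \<Longrightarrow> g x = f i x"
  proof (rule pasting_lemma_exists[where X = "top_of_set ?D" and I = "insert None (Some ` S)" and T = T and f = f and Y = X])
    show "topspace (top_of_set ?D) \<subseteq> (\<Union>i\<in>insert None (Some ` S). T i)" using cover by simp
    show "openin (top_of_set ?D) (T i)" for i
      unfolding T_def by (auto intro: openin_open_Int)
    show "continuous_map (subtopology (top_of_set ?D) (T i)) X (f i)" if "i \<in> insert None (Some ` S)" for i
      using lf[OF that] TD[of i] unfolding lift_on_def by (simp add: subtopology_subtopology Int_absorb1)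
    show "f i x = f j x" if "i \<in> insert None (Some ` S)" "j \<in> insert None (Some ` S)"
      "x \<in> topspace (top_of_set ?D) \<inter> T i \<inter> T j" for i j x
      using agree[OF that(1,2)] that(3) by blast
  qed (rule that, assumption, blast)
  have gf: "q (g w) = e w" if w: "w \<in> ?D" for w
  proof -
    obtain c where c: "c \<in> insert None (Some ` S)" "w \<in> T c" using cover w by blast
    then have "g w = f c w" using g w by auto
    then show ?thesis using lf[OF c(1)] c unfolding lift_on_def by auto
  qed
  have "g w0 = f None w0" using g(2)[of None w0] w0 r r' unfolding T_def by auto
  then have "g w0 = x0" unfolding f_def using \<sigma> by simp
  then show ?thesis using g gf r' unfolding lift_on_def by blast
qed

text \<open>The radii of balls that carry a lift through \<open>x0\<close> are unbounded: lifts
  below the supremum glue to a lift at the supremum, which extends further. Growing along balls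
  keeps every overlap convex, hence connected, so lifts glue by uniqueness.\<close>

lemma finite_covering_lift_exists:
  obtains \<sigma> where "continuous_map (top_of_set E) X \<sigma>" "\<And>w. w \<in> E \<Longrightarrow> q (\<sigma> w) = e w" "\<sigma> w0 = x0"
proof -
  define R where "R = {r. r > 0 \<and> (\<exists>\<sigma>. lift_on (E \<inter> ball w0 r) \<sigma> \<and> \<sigma> w0 = x0)}"
  then have "\<forall>r\<in>R. \<exists>\<sigma>. lift_on (E \<inter> ball w0 r) \<sigma> \<and> \<sigma> w0 = x0" by blast
  then obtain f where f: "\<And>r. r \<in> R \<Longrightarrow> lift_on (E \<inter> ball w0 r) (f r) \<and> f r w0 = x0" by metis
  have glue: "\<exists>\<sigma>. lift_on D \<sigma> \<and> \<sigma> w0 = x0"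
    if D: "D \<subseteq> E" "\<And>z. z \<in> D \<Longrightarrow> \<exists>r\<in>R. dist w0 z < r" "w0 \<in> D" for D
  proof -
    have agree: "f i x = f j x" if "i \<in> R" "j \<in> R" "x \<in> E \<inter> ball w0 i" "x \<in> E \<inter> ball w0 j" for i j x
    proof (rule lift_on_unique[of "E \<inter> ball w0 i" "f i" "E \<inter> ball w0 j" "f j" w0 x])
      show "convex (E \<inter> ball w0 i \<inter> (E \<inter> ball w0 j))" using cvx by (intro convex_Int) auto
    qed (use f that w0 R_def in auto)
    obtain g where g: "continuous_map (top_of_set D) X g"
      "\<And>x r. r \<in> R \<Longrightarrow> x \<in> topspace (top_of_set D) \<inter> (D \<inter> ball w0 r) \<Longrightarrow> g x = f r x"
    proof (rule pasting_lemma_exists[where X = "top_of_set D" and I = R and T = "\<lambda>r. D \<inter> ball w0 r" and f = f and Y = X])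
      show "topspace (top_of_set D) \<subseteq> (\<Union>i\<in>R. D \<inter> ball w0 i)" using D by fastforce
      show "continuous_map (subtopology (top_of_set D) (D \<inter> ball w0 i)) X (f i)" if "i \<in> R" for i
      proof -
        have "lift_on (D \<inter> ball w0 i) (f i)" using f[OF that] lift_on_subset D(1) by blast
        then show ?thesis unfolding lift_on_def subtopology_subtopology by (simp add: Int_absorb1)
      qed
      show "f i x = f j x" if "i \<in> R" "j \<in> R" "x \<in> topspace (top_of_set D) \<inter> (D \<inter> ball w0 i) \<inter> (D \<inter> ball w0 j)" for i j x
        using agree that D by auto
    qed auto
    have "q (g z) = e z" if z: "z \<in> D" for z
    proof -
      obtain r where r: "r \<in> R" "dist w0 z < r" using D z by blast
      then have "g z = f r z" using g z by auto
      then show ?thesis using f[OF r(1)] r z D unfolding lift_on_def by auto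
    qed
    moreover have "g w0 = x0"
    proof -
      obtain r where r: "r \<in> R" "dist w0 w0 < r" using D by blast
      then have "g w0 = f r w0" using g D by auto
      then show ?thesis using f[OF r(1)] by auto
    qed
    ultimately show ?thesis using g unfolding lift_on_def by blast
  qed
  obtain d where d: "d > 0" "\<exists>\<tau>. lift_on (E \<inter> ball w0 d) \<tau> \<and> \<tau> w0 = x0"
  proof -
    obtain d where "d > 0" and ex: "\<And>w x. w \<in> E \<inter> ball w0 d \<Longrightarrow> x \<in> topspace X \<Longrightarrow> q x = e w \<Longrightarrow>
      \<exists>\<tau>. lift_on (E \<inter> ball w0 d) \<tau> \<and> \<tau> w = x" using lift_on_local[OF w0] by metis
    then show thesis using that ex[of w0 x0] w0 x0 qx0 by auto
  qed
  then have dR: "d \<in> R" unfolding R_def by blast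
  have unb: "\<not> bdd_above R"
  proof
    assume bdd: "bdd_above R"
    define s where "s = Sup R"
    have sd: "d \<le> s" unfolding s_def using cSup_upper[OF dR bdd] .
    have "\<exists>\<sigma>. lift_on (E \<inter> ball w0 s) \<sigma> \<and> \<sigma> w0 = x0"
    proof (rule glue)
      show "\<exists>r\<in>R. dist w0 z < r" if "z \<in> E \<inter> ball w0 s" for z
        using that less_cSup_iff[of R "dist w0 z"] dR bdd unfolding s_def by auto
    qed (use w0 d sd in auto)
    then obtain r' where "r' > s" "r' \<in> R"
      using lift_on_extend[of s] sd d(1) unfolding R_def by force
    then show False using cSup_upper[OF _ bdd, of r'] unfolding s_def by simp
  qed
  have "\<exists>\<sigma>. lift_on E \<sigma> \<and> \<sigma> w0 = x0"
  proof (rule glue)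
    show "\<exists>r\<in>R. dist w0 z < r" if "z \<in> E" for z
      using unb unfolding bdd_above_def by (meson not_le)
  qed (use w0 in auto)
  then show thesis using that unfolding lift_on_def by blast
qed

end

text \<open>The map \<open>e\<close> plays the part of a universal covering of \<open>Y\<close>.
  Through a sheet, openness of \<open>e\<close> passes to its lifts. A point outside the image of
  \<open>\<sigma>\<close> lies on a lift of its own, whose image is open and misses that of
  \<open>\<sigma>\<close>; so the image is clopen.\<close>

lemma lift_image_component:
  assumes cov: "finite_covering X Y q" and Z: "connected_space Z"
    and e: "continuous_map Z Y e" "open_map Z Y e" "e ` topspace Z = topspace Y"
    and lift: "\<And>z x. z \<in> topspace Z \<Longrightarrow> x \<in> topspace X \<Longrightarrow> q x = e z \<Longrightarrow>
       \<exists>\<tau>. continuous_map Z X \<tau> \<and> (\<forall>z\<in>topspace Z. q (\<tau> z) = e z) \<and> \<tau> z = x"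
    and deck: "\<And>y z. y \<in> topspace Z \<Longrightarrow> z \<in> topspace Z \<Longrightarrow> e y = e z \<Longrightarrow>
       \<exists>d. continuous_map Z Z d \<and> (\<forall>u\<in>topspace Z. e (d u) = e u) \<and> d z = y"
    and \<sigma>: "continuous_map Z X \<sigma>" "\<And>z. z \<in> topspace Z \<Longrightarrow> q (\<sigma> z) = e z"
    and ne: "topspace Z \<noteq> {}"
  shows "open_map Z X \<sigma>" "\<sigma> ` topspace Z \<in> connected_components_of X"
proof -
  have qX: "q x \<in> topspace Y" if "x \<in> topspace X" for x
    using finite_covering_continuous[OF cov] that by (auto simp: continuous_map_def Pi_iff)
  \<comment> \<open>Stated for every lift, as it is also applied to the competing lift through a
    point outside the image.\<close>
  have op: "open_map Z X \<tau>" if \<tau>: "continuous_map Z X \<tau>" "\<And>z. z \<in> topspace Z \<Longrightarrow> q (\<tau> z) = e z" for \<tau>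
    unfolding open_map_def
  proof (intro allI impI, subst openin_subopen, clarify)
    fix U z assume U: "openin Z U" and z: "z \<in> U"
    have zZ: "z \<in> topspace Z" using U z openin_subset by blast
    have \<tau>z: "\<tau> z \<in> topspace X" using \<tau> zZ by (auto simp: continuous_map_def Pi_iff)
    obtain W where W: "q (\<tau> z) \<in> W" and
      sh: "\<And>x. x \<in> topspace X \<Longrightarrow> q x \<in> W \<Longrightarrow> \<exists>V s. x \<in> V \<and> sheet X Y q W V s"
      by (rule finite_covering_sheets[OF cov qX[OF \<tau>z]]) blast
    obtain V s where V: "\<tau> z \<in> V" "openin X V" "\<forall>v\<in>V. s (q v) = v"
      using sh[OF \<tau>z W] unfolding sheet_def by blast
    define G where "G = U \<inter> {u \<in> topspace Z. \<tau> u \<in> V}"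
    have G: "openin Z G" unfolding G_def
      by (intro openin_Int U openin_continuous_map_preimage[OF \<tau>(1)] V)
    have "openin Y (e ` G)" using e(2) G unfolding open_map_def by blast
    then have "openin X (V \<inter> {x \<in> topspace X. q x \<in> e ` G})"
      by (intro openin_Int V openin_continuous_map_preimage[OF finite_covering_continuous[OF cov]])
    moreover have "\<tau> z \<in> V \<inter> {x \<in> topspace X. q x \<in> e ` G}"
      using V \<tau>z \<tau>(2)[OF zZ] z zZ unfolding G_def by auto
    moreover have "V \<inter> {x \<in> topspace X. q x \<in> e ` G} \<subseteq> \<tau> ` U"
    proof
      fix x assume x: "x \<in> V \<inter> {x \<in> topspace X. q x \<in> e ` G}"
      then obtain u where u: "u \<in> U" "u \<in> topspace Z" "\<tau> u \<in> V" "q x = e u" unfolding G_def by blast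
      then have "q (\<tau> u) = q x" using \<tau> by auto
      then have "\<tau> u = x" using V(3) u x by (metis IntD1)
      then show "x \<in> \<tau> ` U" using u by blast
    qed
    ultimately show "\<exists>T. openin X T \<and> \<tau> z \<in> T \<and> T \<subseteq> \<tau> ` U" by blast
  qed
  show o: "open_map Z X \<sigma>" using op \<sigma> by blast
  let ?I = "\<sigma> ` topspace Z"
  have oI: "openin X ?I" using o unfolding open_map_def by blast
  have IX: "?I \<subseteq> topspace X" using oI openin_subset by blast
  have "openin X (topspace X - ?I)"
  proof (subst openin_subopen, clarify)
    fix x assume x: "x \<in> topspace X" "x \<notin> ?I"
    then obtain w where w: "w \<in> topspace Z" "q x = e w" using qX e(3) by (metis imageE)
    then obtain \<tau> where \<tau>: "continuous_map Z X \<tau>" "\<forall>z\<in>topspace Z. q (\<tau> z) = e z" "\<tau> w = x"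
      using lift x by blast
    have o\<tau>: "openin X (\<tau> ` topspace Z)" using op \<tau> unfolding open_map_def by blast
    have "\<tau> z2 \<noteq> \<sigma> z1" if z: "z1 \<in> topspace Z" "z2 \<in> topspace Z" for z1 z2
    proof
      assume eq: "\<tau> z2 = \<sigma> z1"
      then have "e z1 = e z2" using \<tau> \<sigma> z by metis
      then obtain d where d: "continuous_map Z Z d" "\<forall>u\<in>topspace Z. e (d u) = e u" "d z2 = z1"
        using deck z by blast
      have dZ: "d u \<in> topspace Z" if "u \<in> topspace Z" for u using d that by (auto simp: continuous_map_def Pi_iff)
      \<comment> \<open>The lifts \<open>\<tau>\<close> and \<open>\<sigma> \<circ> d\<close> agree
        at \<open>z2\<close>, hence everywhere; at \<open>w\<close> this would put \<open>x\<close>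
        into the image of \<open>\<sigma>\<close>.\<close>
      have "\<tau> w = (\<sigma> \<circ> d) w"
      proof (rule finite_covering_lift_unique[OF cov Z \<tau>(1) _ _ z(2) _ w(1)])
        show "continuous_map Z X (\<sigma> \<circ> d)" using d \<sigma> continuous_map_compose by blast
        show "q (\<tau> z) = q ((\<sigma> \<circ> d) z)" if "z \<in> topspace Z" for z
          using that \<tau> \<sigma> d dZ by auto
        show "\<tau> z2 = (\<sigma> \<circ> d) z2" using eq d by auto
      qed
      then show False using x \<tau>(3) dZ[OF w(1)] by auto
    qed
    moreover have "\<tau> ` topspace Z \<subseteq> topspace X" using o\<tau> openin_subset by blast
    ultimately have "\<tau> ` topspace Z \<subseteq> topspace X - ?I" 
    proof (intro subsetI DiffI notI)
      fix a assume a: "a \<in> \<tau> ` topspace Z" "\<tau> ` topspace Z \<subseteq> topspace X" "a \<in> ?I"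
      then obtain z1 z2 where "z1 \<in> topspace Z" "z2 \<in> topspace Z" "a = \<tau> z2" "a = \<sigma> z1" by blast
      then show False using \<open>\<And>z1 z2. z1 \<in> topspace Z \<Longrightarrow> z2 \<in> topspace Z \<Longrightarrow> \<tau> z2 \<noteq> \<sigma> z1\<close> by metis
    qed auto
    then show "\<exists>T. openin X T \<and> x \<in> T \<and> T \<subseteq> topspace X - ?I" using o\<tau> \<tau>(3) w by blast
  qed
  then have cI: "closedin X ?I" unfolding closedin_def using IX by blast
  have conI: "connectedin X ?I"
    using connectedin_continuous_map_image[OF \<sigma>(1)] Z by (metis connectedin_topspace)
  obtain z where z: "z \<in> topspace Z" using ne by blast
  let ?C = "connected_component_of_set X (\<sigma> z)"
  have "?I \<subseteq> ?C" using connected_component_of_maximal[OF conI] z by blast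
  moreover have "?C \<subseteq> ?I"
  proof -
    have "connectedin X ?C" by (simp add: connectedin_connected_component_of)
    moreover have "\<sigma> z \<in> ?C" using z IX by (simp add: connected_component_of_refl image_subset_iff)
    ultimately show ?thesis using connectedin_clopen_cases[of X ?C ?I] cI oI z by (auto simp: disjnt_iff)
  qed
  ultimately show "?I \<in> connected_components_of X"
    unfolding connected_components_of_def using z IX by (auto intro!: image_eqI[of _ _ "\<sigma> z"])
qed

lemma connected_components_of_eq_if_mem:
  "C \<in> connected_components_of X \<Longrightarrow> D \<in> connected_components_of X \<Longrightarrow> x \<in> C \<Longrightarrow> x \<in> D \<Longrightarrow> C = D"
  using pairwise_disjoint_connected_components_of[of X] unfolding pairwise_def disjnt_def by blast

text \<open>Here the inverse \<open>e\<close> of the homeomorphism is lifted. It is injective, so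
  the identity is the only deck map needed and the lift is an embedding onto the component.\<close>

lemma finite_covering_euclidean_component:
  fixes h :: "'b \<Rightarrow> 'e::euclidean_space"
  assumes cov: "finite_covering X Y q" and h: "homeomorphic_map Y euclidean h"
    and C: "C \<in> connected_components_of X"
  shows "subtopology X C homeomorphic_space Y"
proof -
  obtain e where e: "homeomorphic_maps Y euclidean h e" using h homeomorphic_map_maps by blast
  then have e': "homeomorphic_map euclidean Y e"
    using homeomorphic_maps_map homeomorphic_maps_sym by blast
  have ce: "continuous_map (top_of_set (UNIV::'e set)) Y e" and oe: "open_map (top_of_set (UNIV::'e set)) Y e"
    and se: "e ` UNIV = topspace Y" and ie: "inj e"
    using e' homeomorphic_eq_everything_map[of euclidean Y e] by (auto simp: inj_on_def)
  obtain x where x: "x \<in> C" using C nonempty_connected_components_of by blast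
  have xX: "x \<in> topspace X" using x C connected_components_of_subset by blast
  have "q x \<in> topspace Y" using finite_covering_continuous[OF cov] xX by (auto simp: continuous_map_def Pi_iff)
  then obtain w where w: "q x = e w" using se by (metis imageE)
  have lift: "\<exists>\<tau>. continuous_map (top_of_set (UNIV::'e set)) X \<tau> \<and> (\<forall>z\<in>topspace (top_of_set (UNIV::'e set)). q (\<tau> z) = e z) \<and> \<tau> z = y"
    if y: "y \<in> topspace X" "q y = e z" for z y
  proof -
    obtain \<sigma> where "continuous_map (top_of_set UNIV) X \<sigma>" "\<And>w. w \<in> UNIV \<Longrightarrow> q (\<sigma> w) = e w" "\<sigma> z = y"
      by (rule finite_covering_lift_exists[OF cov convex_UNIV closed_UNIV ce UNIV_I y]) blast
    then show ?thesis by auto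
  qed
  obtain \<sigma> where \<sigma>: "continuous_map (top_of_set UNIV) X \<sigma>" "\<And>z. q (\<sigma> z) = e z" "\<sigma> w = x"
    using lift[OF xX w] by auto
  have con: "connected_space (top_of_set (UNIV::'e set))"
    using connected_UNIV connectedin_def connectedin_iff_connected by blast
  have deck: "\<exists>d. continuous_map (top_of_set UNIV) (top_of_set UNIV) d \<and> (\<forall>u\<in>topspace (top_of_set UNIV). e (d u) = e u) \<and> d z = y"
    if "e y = e z" for y z
    using that ie by (intro exI[of _ id]) (auto simp: inj_def)
  note L = lift_image_component[OF cov con ce oe _ _ _ \<sigma>(1,2)]
  have "open_map (top_of_set UNIV) X \<sigma>" "\<sigma> ` topspace (top_of_set UNIV) \<in> connected_components_of X"
    by (rule L; use se lift deck in auto)+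
  moreover have "inj \<sigma>" using \<sigma>(2) ie by (metis injD injI)
  ultimately have "embedding_map (top_of_set UNIV) X \<sigma>"
    using \<sigma>(1) injective_open_imp_embedding_map by (metis inj_on_subset subset_UNIV)
  then have "top_of_set (UNIV::'e set) homeomorphic_space subtopology X (range \<sigma>)"
    using embedding_map_imp_homeomorphic_space by fastforce
  moreover have "range \<sigma> = C"
    using connected_components_of_eq_if_mem[OF _ C, of "range \<sigma>" x] \<sigma>(3) x
      \<open>\<sigma> ` topspace (top_of_set UNIV) \<in> connected_components_of X\<close> by auto
  moreover have "Y homeomorphic_space (euclidean :: 'e topology)"
    using h homeomorphic_space by blast
  ultimately show ?thesis
    by (metis homeomorphic_space_sym homeomorphic_space_trans subtopology_UNIV)
qed

section \<open>The exponential covering of the punctured plane\<close>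

lemma open_map_exp_scaled:
  fixes T :: "real set"
  assumes "m > 0"
  shows "open_map (top_of_set (UNIV \<times> T)) (top_of_set ((-{0}) \<times> T))
    (\<lambda>p. (exp (fst p / of_nat m) :: complex, snd p))"
  unfolding open_map_def
proof (intro allI impI)
  fix U :: "(complex \<times> real) set" assume U: "openin (top_of_set (UNIV \<times> T)) U"
  let ?f = "\<lambda>p. (exp (fst p / of_nat m) :: complex, snd p)"
  show "openin (top_of_set ((-{0}) \<times> T)) (?f ` U)"
  proof (subst openin_subopen, clarify)
    fix w t assume wt: "(w, t) \<in> U"
    obtain G where G: "open G" "U = (UNIV \<times> T) \<inter> G" using U by (auto simp: openin_open)
    obtain A B where AB: "open A" "open B" "w \<in> A" "t \<in> B" "A \<times> B \<subseteq> G"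
      using G wt by (metis IntE open_prod_elim mem_Sigma_iff)
    \<comment> \<open>Division by \<open>m\<close> preserves open sets, so only openness of the
      unscaled exponential is at stake.\<close>
    have "open ((\<lambda>x. (1 / real m) *\<^sub>R x) ` A)"
      using AB assms by (intro open_scaling) auto
    moreover have "(\<lambda>x. (1 / real m) *\<^sub>R x) = (\<lambda>x::complex. x / of_nat m)"
      by (auto simp: scaleR_conv_of_real)
    ultimately have "openin (top_of_set UNIV) ((\<lambda>x. x / of_nat m) ` A)" by simp
    then have "openin (top_of_set (-{0::complex})) (exp ` (\<lambda>x. x / of_nat m) ` A)"
      by (rule covering_space_open_map[OF covering_space_exp_punctured_plane])
    then have "open (exp ` (\<lambda>x. x / of_nat m) ` A)"
      using openin_open_trans by blast
    then have "openin (top_of_set ((-{0}) \<times> T)) (((-{0}) \<times> T) \<inter> ((exp ` (\<lambda>x. x / of_nat m) ` A) \<times> B))"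
      using AB by (intro openin_open_Int open_Times) auto
    moreover have "?f (w, t) \<in> ((-{0}) \<times> T) \<inter> ((exp ` (\<lambda>x. x / of_nat m) ` A) \<times> B)"
      using AB wt G by auto
    moreover have "((-{0}) \<times> T) \<inter> ((exp ` (\<lambda>x. x / of_nat m) ` A) \<times> B) \<subseteq> ?f ` U"
    proof
      fix p assume "p \<in> ((-{0}) \<times> T) \<inter> ((exp ` (\<lambda>x. x / of_nat m) ` A) \<times> B)"
      then obtain a b where ab: "p = (exp (a / of_nat m), b)" "a \<in> A" "b \<in> B" "b \<in> T" by auto
      then have "(a, b) \<in> U" using AB G by auto
      then show "p \<in> ?f ` U" using ab by force
    qed
    ultimately show "\<exists>V. openin (top_of_set ((-{0}) \<times> T)) V \<and> (exp (fst (w, t) / of_nat m), snd (w, t)) \<in> V \<and> V \<subseteq> ?f ` U"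
      by blast
  qed
qed

text \<open>Scaled by \<open>m\<close>, the exponential identifies points that differ by multiples
  of \<open>2 * m * pi * \<i>\<close>, so a lift with this period factors through it. The case
  \<open>m = 1\<close> is the map that gets lifted.\<close>

lemma continuous_map_exp_scaled:
  fixes T :: "real set"
  assumes "m > 0"
  shows "continuous_map (top_of_set (UNIV \<times> T)) (top_of_set ((-{0}) \<times> T))
    (\<lambda>p. (exp (fst p / of_nat m) :: complex, snd p))"
  using assms by (auto intro!: continuous_intros)

lemma image_exp_scaled:
  fixes T :: "real set"
  assumes "m > 0"
  shows "(\<lambda>p. (exp (fst p / of_nat m) :: complex, snd p)) ` (UNIV \<times> T) = (-{0}) \<times> T"
proof -
  have "(z, t) \<in> (\<lambda>p. (exp (fst p / of_nat m) :: complex, snd p)) ` (UNIV \<times> T)" if "z \<noteq> 0" "t \<in> T" for z t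
    using that assms by (intro image_eqI[of _ _ "(of_nat m * Ln z, t)"]) auto
  then show ?thesis by auto
qed

text \<open>The lift \<open>\<sigma>\<close> of the logarithm covering is periodic, with a period that is a multiple of \<open>2 \<pi> i\<close>
  because the fibres are finite; the quotient by its period is the component.\<close>

lemma finite_covering_punctured_component:
  fixes q :: "'a \<Rightarrow> complex \<times> real" and T :: "real set"
  assumes cov: "finite_covering X (top_of_set ((-{0}) \<times> T)) q"
    and T: "convex T" "closed T" and x1: "x1 \<in> topspace X"
  obtains m \<sigma> where "m > 0" "continuous_map (top_of_set (UNIV \<times> T)) X \<sigma>"
    "\<And>w t. t \<in> T \<Longrightarrow> q (\<sigma> (w, t)) = (exp w, t)"
    "\<And>w w' t t'. t \<in> T \<Longrightarrow> t' \<in> T \<Longrightarrow> \<sigma> (w, t) = \<sigma> (w', t') \<longleftrightarrow>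
       t = t' \<and> (\<exists>j::int. w - w' = 2 * of_nat m * of_int j * of_real pi * \<i>)"
    "open_map (top_of_set (UNIV \<times> T)) X \<sigma>"
    "\<sigma> ` (UNIV \<times> T) \<in> connected_components_of X" "x1 \<in> \<sigma> ` (UNIV \<times> T)"
proof -
  define E where "E = (UNIV :: complex set) \<times> T"
  define e where "e = (\<lambda>p::complex \<times> real. (exp (fst p), snd p))"
  define sh where "sh = (\<lambda>(j::int) (p::complex \<times> real). (fst p + 2 * of_int j * of_real pi * \<i>, snd p))"
  have E: "convex E" "closed E" unfolding E_def using T by (auto intro: convex_Times closed_Times)
  have e1: "e = (\<lambda>p. (exp (fst p / of_nat 1), snd p))" unfolding e_def by simp
  have ce: "continuous_map (top_of_set E) (top_of_set ((-{0}) \<times> T)) e"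
    and oe: "open_map (top_of_set E) (top_of_set ((-{0}) \<times> T)) e" and se: "e ` E = (-{0}) \<times> T"
    unfolding e1 E_def using open_map_exp_scaled[of 1 T] continuous_map_exp_scaled[of 1 T] image_exp_scaled[of 1 T] by auto
  have con: "connected_space (top_of_set E)"
    using convex_connected[OF E(1)] connectedin_def connectedin_iff_connected by blast
  have shE: "sh j p \<in> E" if "p \<in> E" for j p using that unfolding sh_def E_def by auto
  have csh: "continuous_map (top_of_set E) (top_of_set E) (sh j)" for j
    using shE by (auto simp: sh_def intro!: continuous_intros)
  have esh: "e (sh j p) = e p" for j p
    unfolding e_def sh_def by (auto simp: exp_eq intro!: exI[of _ j])
  have eeq: "\<exists>j. y = sh j z" if "e y = e z" for y z
  proof -
    have "exp (fst y) = exp (fst z)" "snd y = snd z" using that unfolding e_def by auto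
    then show ?thesis unfolding exp_eq sh_def by (auto simp: prod_eq_iff)
  qed
  have sh_add: "sh i (sh j p) = sh (i + j) p" for i j p
    unfolding sh_def by (simp add: algebra_simps)
  have q1: "q x1 \<in> (-{0}) \<times> T"
    using finite_covering_continuous[OF cov] x1 by (auto simp: continuous_map_def Pi_iff)
  then obtain w0 where w0: "w0 \<in> E" "q x1 = e w0" using se by (metis imageE)
  have lift: "\<exists>\<tau>. continuous_map (top_of_set E) X \<tau> \<and> (\<forall>z\<in>topspace (top_of_set E). q (\<tau> z) = e z) \<and> \<tau> z = y"
    if y: "z \<in> E" "y \<in> topspace X" "q y = e z" for z y
  proof -
    obtain \<sigma> where "continuous_map (top_of_set E) X \<sigma>" "\<And>w. w \<in> E \<Longrightarrow> q (\<sigma> w) = e w" "\<sigma> z = y"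
      by (rule finite_covering_lift_exists[OF cov E ce y]) blast
    then show ?thesis by auto
  qed
  obtain \<sigma> where \<sigma>: "continuous_map (top_of_set E) X \<sigma>" "\<And>z. z \<in> E \<Longrightarrow> q (\<sigma> z) = e z" "\<sigma> w0 = x1"
    using lift[OF w0(1) x1 w0(2)] by auto
  have \<sigma>X: "\<sigma> p \<in> topspace X" if "p \<in> E" for p using \<sigma>(1) that by (auto simp: continuous_map_def Pi_iff)
  have deck: "\<exists>d. continuous_map (top_of_set E) (top_of_set E) d \<and> (\<forall>u\<in>topspace (top_of_set E). e (d u) = e u) \<and> d z = y"
    if "y \<in> E" "z \<in> E" "e y = e z" for y z
    using eeq[OF that(3)] csh esh by metis
  note L = lift_image_component[OF cov con ce oe _ _ _ \<sigma>(1)]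
  have op: "open_map (top_of_set E) X \<sigma>" and co: "\<sigma> ` topspace (top_of_set E) \<in> connected_components_of X"
    by (rule L; use se lift deck \<sigma>(2) w0 in auto)+
  \<comment> \<open>Both translates of \<open>\<sigma>\<close> lift \<open>e\<close>, so one
    coincidence spreads over the connected set \<open>E\<close>.\<close>
  have shift: "\<sigma> (sh i p) = \<sigma> (sh j p)" if "p0 \<in> E" "p \<in> E" "\<sigma> (sh i p0) = \<sigma> (sh j p0)" for i j p p0
  proof -
    have "(\<sigma> \<circ> sh i) p = (\<sigma> \<circ> sh j) p"
    proof (rule finite_covering_lift_unique[OF cov con _ _ _ _ _])
      show "continuous_map (top_of_set E) X (\<sigma> \<circ> sh i)" "continuous_map (top_of_set E) X (\<sigma> \<circ> sh j)"
        using csh \<sigma> continuous_map_compose by blast+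
    qed (use that \<sigma> shE esh in auto)
    then show ?thesis by simp
  qed
  have sh0: "sh 0 p = p" for p unfolding sh_def by simp
  \<comment> \<open>\<open>J\<close> describes the periods of \<open>\<sigma>\<close> in units of
    \<open>2 * pi * \<i>\<close>; they form a subgroup of the integers, generated by its least
    positive element \<open>m\<close>.\<close>
  define J where "J = (\<lambda>j::int. \<forall>p\<in>E. \<sigma> (sh j p) = \<sigma> p)"
  have "\<exists>m>0. J (int m)"
  proof -
    let ?F = "{x \<in> topspace X. q x = e w0}"
    have "finite ?F" using finite_covering_finite_fibre[OF cov] q1 w0 by simp
    moreover have "range (\<lambda>n::nat. \<sigma> (sh (int n) w0)) \<subseteq> ?F"
      using \<sigma>(2)[OF shE[OF w0(1)]] \<sigma>X[OF shE[OF w0(1)]] esh by auto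
    ultimately have "\<not> inj (\<lambda>n::nat. \<sigma> (sh (int n) w0))"
      using finite_imageD infinite_UNIV_nat finite_subset by blast
    then obtain a b :: nat where ab: "a \<noteq> b" "\<sigma> (sh (int a) w0) = \<sigma> (sh (int b) w0)" by (auto simp: inj_def)
    define i j where "i = min a b" and "j = max a b"
    have ij: "i < j" "\<sigma> (sh (int i) w0) = \<sigma> (sh (int j) w0)" using ab unfolding i_def j_def by (auto simp: min_def max_def)
    have "J (int (j - i))" unfolding J_def
    proof
      fix p assume p: "p \<in> E"
      have "\<sigma> (sh (int i) (sh (- int i) p)) = \<sigma> (sh (int j) (sh (- int i) p))"
        using shift[OF w0(1) shE[OF p] ij(2)] .
      then show "\<sigma> (sh (int (j - i)) p) = \<sigma> p" using ij(1) by (simp add: sh_add sh0 of_nat_diff)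
    qed
    then show ?thesis using ij by (intro exI[of _ "j - i"]) auto
  qed
  then have ex: "\<exists>m. m > 0 \<and> J (int m)" by blast
  define m where "m = (LEAST m. m > 0 \<and> J (int m))"
  have m: "m > 0" "J (int m)" unfolding m_def using LeastI_ex[OF ex] by auto
  have mmin: "m \<le> n" if "n > 0" "J (int n)" for n unfolding m_def using that by (intro Least_le) auto
  have Jadd: "J (i + j)" if "J i" "J j" for i j
    using that shE unfolding J_def sh_add[symmetric] by simp
  have Jneg: "J (- i)" if "J i" for i
    unfolding J_def
  proof
    fix p assume "p \<in> E"
    then have "\<sigma> (sh i (sh (-i) p)) = \<sigma> (sh (-i) p)" using that shE unfolding J_def by blast
    then show "\<sigma> (sh (-i) p) = \<sigma> p" by (simp add: sh_add sh0)
  qed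
  have J0: "J 0" by (simp add: J_def sh0)
  have Jnat: "J (int n * int m)" for n
    by (induction n) (auto simp: J0 algebra_simps intro: Jadd m)
  have Jmult: "J (k * int m)" for k
  proof (cases "k \<ge> 0")
    case True then show ?thesis using Jnat[of "nat k"] by simp
  next
    case False then show ?thesis using Jneg[OF Jnat[of "nat (-k)"]] by simp
  qed
  \<comment> \<open>The remainder modulo \<open>m\<close> is again a period, and it is smaller than
    the least positive one.\<close>
  have Jdvd: "int m dvd j" if "J j" for j
  proof -
    have "J (j + (- (j div int m)) * int m)" by (rule Jadd[OF that Jmult])
    also have "j + (- (j div int m)) * int m = j mod int m" by (simp add: minus_div_mult_eq_mod)
    finally have "J (int (nat (j mod int m)))" using m by simp
    moreover have "nat (j mod int m) < m" using m by (simp add: nat_less_iff)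
    ultimately have "nat (j mod int m) = 0" using mmin[of "nat (j mod int m)"] by linarith
    then have "j mod int m = 0" using m(1) pos_mod_sign[of "int m" j] by linarith
    then show ?thesis by auto
  qed
  show thesis
  proof (rule that[OF m(1)])
    show "continuous_map (top_of_set (UNIV \<times> T)) X \<sigma>" using \<sigma> unfolding E_def by simp
    show "\<And>w t. t \<in> T \<Longrightarrow> q (\<sigma> (w, t)) = (exp w, t)" using \<sigma>(2) unfolding E_def e_def by auto
    show "open_map (top_of_set (UNIV \<times> T)) X \<sigma>" "\<sigma> ` (UNIV \<times> T) \<in> connected_components_of X"
      using op co unfolding E_def by auto
    show "x1 \<in> \<sigma> ` (UNIV \<times> T)" using \<sigma>(3) w0 unfolding E_def by blast
    show "\<sigma> (w, t) = \<sigma> (w', t') \<longleftrightarrow> t = t' \<and> (\<exists>j::int. w - w' = 2 * of_nat m * of_int j * of_real pi * \<i>)"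
      if t: "t \<in> T" "t' \<in> T" for w w' t t'
    proof
      assume eq: "\<sigma> (w, t) = \<sigma> (w', t')"
      have EE: "(w,t) \<in> E" "(w',t') \<in> E" using t unfolding E_def by auto
      then have "e (w, t) = e (w', t')" using \<sigma>(2) eq by metis
      then obtain j where j: "(w, t) = sh j (w', t')" using eeq by blast
      have "J j" unfolding J_def
      proof
        fix p assume "p \<in> E"
        have "\<sigma> (sh j (w', t')) = \<sigma> (sh 0 (w', t'))" using eq j sh0 by metis
        then have "\<sigma> (sh j p) = \<sigma> (sh 0 p)" using shift[OF EE(2) \<open>p \<in> E\<close>] by blast
        then show "\<sigma> (sh j p) = \<sigma> p" by (simp add: sh0)
      qed
      then obtain k where "j = int m * k" using Jdvd by (metis dvdE)
      then show "t = t' \<and> (\<exists>j::int. w - w' = 2 * of_nat m * of_int j * of_real pi * \<i>)"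
        using j unfolding sh_def by (auto intro!: exI[of _ k])
    next
      assume "t = t' \<and> (\<exists>j::int. w - w' = 2 * of_nat m * of_int j * of_real pi * \<i>)"
      then obtain j :: int where j: "t = t'" "w - w' = 2 * of_nat m * of_int j * of_real pi * \<i>" by blast
      have "w = w' + (w - w')" by simp
      then have "(w, t) = sh (j * int m) (w', t')" using j unfolding sh_def by (simp add: algebra_simps)
      then show "\<sigma> (w, t) = \<sigma> (w', t')" using Jmult[of j] t unfolding J_def E_def by auto
    qed
  qed
qed

lemma Hausdorff_finite_disjoint_nhds:
  assumes X: "Hausdorff_space X" and F: "finite F" "F \<subseteq> topspace X"
  obtains D where "\<And>x. x \<in> F \<Longrightarrow> openin X (D x) \<and> x \<in> D x"
    "\<And>x y. x \<in> F \<Longrightarrow> y \<in> F \<Longrightarrow> x \<noteq> y \<Longrightarrow> D x \<inter> D y = {}"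
proof -
  have "\<exists>A A'. openin X A \<and> openin X A' \<and> x \<in> A \<and> y \<in> A' \<and> A \<inter> A' = {}"
    if "x \<in> F" "y \<in> F" "x \<noteq> y" for x y
    using X that F unfolding Hausdorff_space_def disjnt_def by (meson subsetD)
  then obtain A A' where A: "\<And>x y. x \<in> F \<Longrightarrow> y \<in> F \<Longrightarrow> x \<noteq> y \<Longrightarrow>
    openin X (A x y) \<and> openin X (A' x y) \<and> x \<in> A x y \<and> y \<in> A' x y \<and> A x y \<inter> A' x y = {}" by metis
  \<comment> \<open>The separations of the pairs \<open>(x, y)\<close> and \<open>(y, x)\<close> are
    chosen independently, so \<open>D x\<close> uses \<open>x\<close> both as first and as second
    point.\<close>
  define D where "D = (\<lambda>x. topspace X \<inter> (\<Inter>y\<in>F - {x}. A x y \<inter> A' y x))"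
  show thesis
  proof (rule that[of D])
    fix x assume x: "x \<in> F"
    have "openin X (topspace X \<inter> \<Inter>((\<lambda>y. A x y \<inter> A' y x) ` (F - {x})))"
    proof (cases "F - {x} = {}")
      case True then show ?thesis by (metis image_empty Inter_empty Int_UNIV_right openin_topspace)
    next
      case False
      then have "openin X (\<Inter>((\<lambda>y. A x y \<inter> A' y x) ` (F - {x})))"
        using F A x by (intro openin_Inter) (auto intro!: openin_Int)
      then show ?thesis by blast
    qed
    then show "openin X (D x) \<and> x \<in> D x" using A x F unfolding D_def by auto
  next
    fix x y assume "x \<in> F" "y \<in> F" "x \<noteq> y"
    then have "D x \<subseteq> A x y" "D y \<subseteq> A' x y" "A x y \<inter> A' x y = {}" unfolding D_def using A by auto
    then show "D x \<inter> D y = {}" by blast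
  qed
qed

section \<open>Branched coverings of cells\<close>

text \<open>The power map will be the composite of \<open>q\<close> with the parametrization of a
  component. Its properness passes to that parametrization, which is thereby a closed
  embedding.\<close>

lemma proper_map_power_times:
  fixes T :: "real set"
  assumes m: "m > 0" and T: "closed T"
  shows "proper_map (top_of_set (UNIV \<times> T)) (top_of_set (UNIV \<times> T)) (\<lambda>p::complex \<times> real. (fst p ^ m, snd p))"
proof (rule compact_imp_proper_map_gen)
  let ?E = "(UNIV :: complex set) \<times> T" and ?f = "\<lambda>p::complex \<times> real. (fst p ^ m, snd p)"
  have cE: "closed ?E" using T by (intro closed_Times) auto
  show cf: "continuous_map (top_of_set ?E) (top_of_set ?E) ?f \<or> kc_space (top_of_set ?E)"
    by (auto intro!: continuous_intros)
  show "?f ` topspace (top_of_set ?E) \<subseteq> topspace (top_of_set ?E)" by auto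
  \<comment> \<open>A convergent sequence together with its limit is compact, so testing
    \<open>S\<close> against compact sets catches the limits of all its sequences.\<close>
  show "closedin (top_of_set ?E) S" if S: "S \<subseteq> topspace (top_of_set ?E)"
    "\<And>K. compactin (top_of_set ?E) K \<Longrightarrow> compactin (top_of_set ?E) (S \<inter> K)" for S
  proof -
    have "closed S"
    proof (rule closed_sequential_limits[THEN iffD2, rule_format])
      fix x l assume x: "(\<forall>n. x n \<in> S) \<and> x \<longlonglongrightarrow> l"
      have xE: "x n \<in> ?E" for n using x S(1) by (metis subsetD topspace_euclidean_subtopology)
      then have l: "l \<in> ?E" using x closed_sequentially[OF cE, of x l] by blast
      define K where "K = insert l (range x)"
      have "compact K" unfolding K_def using x compact_sequence_with_limit[of x l] by blast
      moreover have "K \<subseteq> ?E" unfolding K_def using l xE by blast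
      ultimately have "compact (S \<inter> K)" using S(2)[of K] by (simp add: compactin_subtopology)
      then have "closed (S \<inter> K)" by (rule compact_imp_closed)
      moreover have "\<forall>n. x n \<in> S \<inter> K" using x unfolding K_def by auto
      ultimately show "l \<in> S" using x closed_sequentially[of "S \<inter> K" x l] by auto
    qed
    then show ?thesis using S by (simp add: closed_subset)
  qed
  show "compactin (top_of_set ?E) {p \<in> topspace (top_of_set ?E). ?f p \<in> K}"
    if K: "compactin (top_of_set ?E) K" for K
  proof -
    have K': "compact K" "K \<subseteq> ?E" using K by (auto simp: compactin_subtopology)
    let ?P = "?f -` K"
    have "closed ?P"
      by (intro continuous_closed_vimage compact_imp_closed K' continuous_intros)
    moreover have "bounded ?P"
    proof -
      obtain B where B: "\<And>p. p \<in> K \<Longrightarrow> norm p \<le> B" using compact_imp_bounded[OF K'(1)] bounded_iff by metis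
      have "norm p \<le> max 1 B + B" if p: "p \<in> ?P" for p
      proof -
        have 1: "norm (?f p) \<le> B" using B p by auto
        have "norm (fst p) ^ m \<le> B" using norm_fst_le[of "fst p ^ m" "snd p"] 1 by (simp add: norm_power)
        \<comment> \<open>A modulus of at least \<open>1\<close> does not exceed its
          \<open>m\<close>-th power, as \<open>m > 0\<close>.\<close>
        moreover have "norm (fst p) \<le> max 1 (norm (fst p) ^ m)"
          using self_le_power[of "norm (fst p)" m] m by (cases "norm (fst p) \<ge> 1") auto
        ultimately have "norm (fst p) \<le> max 1 B" by linarith
        moreover have "norm (snd p) \<le> B" using norm_snd_le[of "snd p" "fst p ^ m"] 1 by simp
        moreover have "norm p \<le> norm (fst p) + norm (snd p)" using norm_Pair_le[of "fst p" "snd p"] by simp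
        ultimately show ?thesis by linarith
      qed
      then show ?thesis unfolding bounded_iff by blast
    qed
    ultimately have "compact ?P" using compact_eq_bounded_closed by blast
    moreover have "{p \<in> topspace (top_of_set ?E). ?f p \<in> K} = ?P" using K' by auto
    ultimately show ?thesis using K' by (auto simp: compactin_subtopology)
  qed
qed

lemma proper_map_cong:
  assumes f: "proper_map X Y f" and eq: "\<And>x. x \<in> topspace X \<Longrightarrow> f x = g x"
  shows "proper_map X Y g"
  unfolding proper_map_def closed_map_def
proof (intro conjI allI impI ballI)
  fix U assume U: "closedin X U"
  then have "g ` U = f ` U" using eq closedin_subset by (intro image_cong) force+
  then show "closedin Y (g ` U)" using f U unfolding proper_map_def closed_map_def by simp
next
  fix y assume "y \<in> topspace Y"
  moreover have "{x \<in> topspace X. g x = y} = {x \<in> topspace X. f x = y}" using eq by auto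
  ultimately show "compactin X {x \<in> topspace X. g x = y}" using f unfolding proper_map_def by simp
qed

text \<open>All that is kept of the local model is \<open>loc\<close>: near a point over the
  branching set the unbranched part is connected and dense. A component of the unbranched part that
  comes near such a point therefore contains a whole punctured neighbourhood of it, so adding the
  limit points yields an open set, and properness makes it closed. Finiteness of the fibres over the
  branching set pins the limits down.\<close>

lemma branched_covering_component:
  fixes q :: "'a \<Rightarrow> complex \<times> real" and T :: "real set"
  assumes X: "Hausdorff_space X" "regular_space X"
    and q: "continuous_map X (top_of_set (UNIV \<times> T)) q" "closed_map X (top_of_set (UNIV \<times> T)) q"
    and fin: "\<And>t. t \<in> T \<Longrightarrow> finite {x \<in> topspace X. q x = (0, t)}"
    and cov: "finite_covering (subtopology X {x. fst (q x) \<noteq> 0}) (top_of_set ((-{0}) \<times> T)) q"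
    and loc: "\<And>x. x \<in> topspace X \<Longrightarrow> fst (q x) = 0 \<Longrightarrow> \<exists>U. openin X U \<and> x \<in> U \<and>
        connectedin X (U \<inter> {x. fst (q x) \<noteq> 0}) \<and> U \<subseteq> X closure_of (U \<inter> {x. fst (q x) \<noteq> 0})"
    and T: "convex T" "closed T"
    and C: "C \<in> connected_components_of X"
  shows "subtopology X C homeomorphic_space top_of_set ((UNIV :: complex set) \<times> T)"
proof -
  define P where "P = {x. fst (q x) \<noteq> 0}"
  define X0 where "X0 = subtopology X P"
  define E where "E = (UNIV :: complex set) \<times> T"
  define E0 where "E0 = (-{0 :: complex}) \<times> T"
  note cov = cov[folded P_def, folded X0_def E0_def]
  note q = q[folded E_def]
  note loc = loc[folded P_def]
  have qE: "q x \<in> E" if "x \<in> topspace X" for x using q(1) that by (auto simp: continuous_map_def Pi_iff)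
  have oE0: "openin (top_of_set E) E0"
    unfolding E_def E0_def openin_open by (intro exI[of _ "(-{0}) \<times> UNIV"]) (auto intro!: open_Times)
  have "topspace X \<inter> P = {x \<in> topspace X. q x \<in> E0}" using qE unfolding P_def E0_def E_def by (auto simp: mem_Times_iff)
  then have oP: "openin X (topspace X \<inter> P)" using openin_continuous_map_preimage[OF q(1) oE0] by simp
  have tX0: "topspace X0 = topspace X \<inter> P" unfolding X0_def by simp
  have oX0: "openin X A" if "openin X0 A" for A
    using that oP unfolding X0_def by (metis openin_trans_full subtopology_restrict)
  have CX: "C \<subseteq> topspace X" by (rule connected_components_of_subset[OF C])
  have maxC: "D \<subseteq> C" if "connectedin X D" "x \<in> C" "x \<in> D" for D x
    using connected_components_of_maximal[OF C that(1)] that by (auto simp: disjnt_iff)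
  obtain x where x: "x \<in> C" using C nonempty_connected_components_of by blast
  \<comment> \<open>Even a component found through a branch point contains unbranched points,
    because these are dense near it.\<close>
  obtain x1 where x1: "x1 \<in> C" "x1 \<in> topspace X0"
  proof (cases "x \<in> P")
    case True then show thesis using that x CX unfolding tX0 by blast
  next
    case False
    then obtain U where U: "openin X U" "x \<in> U" "connectedin X (U \<inter> P)" "U \<subseteq> X closure_of (U \<inter> P)"
      using loc[of x] x CX unfolding P_def by auto
    have "connectedin X (X closure_of (U \<inter> P))" using U connectedin_closure_of by blast
    then have sub: "X closure_of (U \<inter> P) \<subseteq> C" using maxC x U by blast
    have "U \<inter> P \<noteq> {}" using U by force
    then obtain x1 where "x1 \<in> U \<inter> P" by blast
    moreover have "U \<inter> P \<subseteq> X closure_of (U \<inter> P)"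
      using U(1) openin_subset by (intro closure_of_subset) blast
    ultimately show thesis using that sub CX unfolding tX0 by blast
  qed
  obtain m \<sigma> where m: "m > 0" and \<sigma>: "continuous_map (top_of_set E) X0 \<sigma>"
    and q\<sigma>: "\<And>w t. t \<in> T \<Longrightarrow> q (\<sigma> (w, t)) = (exp w, t)"
    and \<sigma>eq: "\<And>w w' t t'. t \<in> T \<Longrightarrow> t' \<in> T \<Longrightarrow> \<sigma> (w, t) = \<sigma> (w', t') \<longleftrightarrow>
       t = t' \<and> (\<exists>j::int. w - w' = 2 * of_nat m * of_int j * of_real pi * \<i>)"
    and o\<sigma>: "open_map (top_of_set E) X0 \<sigma>"
    and co: "\<sigma> ` E \<in> connected_components_of X0" and x1\<sigma>: "x1 \<in> \<sigma> ` E"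
    using finite_covering_punctured_component[OF cov[unfolded E0_def] T x1(2)] unfolding E_def by blast
  have \<sigma>X: "continuous_map (top_of_set E) X \<sigma>" using \<sigma> unfolding X0_def by (simp add: continuous_map_in_subtopology)
  define em where "em = (\<lambda>p. (exp (fst p / of_nat m) :: complex, snd p :: real))"
  have cem: "continuous_map (top_of_set E) (top_of_set E0) em" and oem: "open_map (top_of_set E) (top_of_set E0) em"
    and sem: "em ` E = E0"
    unfolding em_def E_def E0_def using continuous_map_exp_scaled[OF m] open_map_exp_scaled[OF m] image_exp_scaled[OF m] by auto
  \<comment> \<open>The jumps of \<open>Ln\<close> are multiples of \<open>2 * pi * \<i>\<close>,
    which the factor \<open>m\<close> turns into periods of \<open>\<sigma>\<close>. Hence
    \<open>g \<circ> em\<close> is \<open>\<sigma>\<close>, and \<open>g\<close> is continuous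
    because \<open>em\<close> is a quotient map.\<close>
  define g where "g = (\<lambda>p. \<sigma> (of_nat m * Ln (fst p), snd p))"
  have gem: "g (em p) = \<sigma> p" if p: "p \<in> E" for p
  proof -
    have "exp (Ln (exp (fst p / of_nat m))) = exp (fst p / of_nat m)" by simp
    then obtain n :: int where n: "Ln (exp (fst p / of_nat m)) = fst p / of_nat m + (of_int (2 * n) * pi) * \<i>"
      unfolding exp_eq by blast
    have "of_nat m * Ln (exp (fst p / of_nat m)) - fst p = 2 * of_nat m * of_int n * of_real pi * \<i>"
      unfolding n using m by (simp add: field_simps)
    moreover have "snd p \<in> T" using p unfolding E_def by auto
    ultimately have "\<sigma> (of_nat m * Ln (exp (fst p / of_nat m)), snd p) = \<sigma> (fst p, snd p)"
      using \<sigma>eq by blast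
    then show ?thesis unfolding g_def em_def by simp
  qed
  have cg: "continuous_map (top_of_set E0) X g"
  proof (rule continuous_compose_quotient_map)
    show "quotient_map (top_of_set E) (top_of_set E0) em"
      using continuous_open_quotient_map[OF cem oem] sem by simp
    show "continuous_map (top_of_set E) X (g \<circ> em)"
      using continuous_map_eq[OF \<sigma>X, of "g \<circ> em"] gem by simp
  qed
  have qg: "q (g p) = (fst p ^ m, snd p)" if p: "p \<in> E0" for p
  proof -
    have "fst p \<noteq> 0" "snd p \<in> T" using p unfolding E0_def by auto
    then show ?thesis unfolding g_def using q\<sigma> by (simp add: exp_of_nat_mult)
  qed
  have g\<sigma>: "g ` E0 = \<sigma> ` E" unfolding sem[symmetric] using gem by (force simp: image_image)
  have injg: "p = p'" if p: "p \<in> E0" "p' \<in> E0" "g p = g p'" for p p'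
  proof -
    have pp: "fst p \<noteq> 0" "snd p \<in> T" "fst p' \<noteq> 0" "snd p' \<in> T" using p unfolding E0_def by auto
    then obtain j :: int where j: "snd p = snd p'" "of_nat m * Ln (fst p) - of_nat m * Ln (fst p') = 2 * of_nat m * of_int j * of_real pi * \<i>"
      using p(3) \<sigma>eq unfolding g_def by blast
    have "of_nat m * (Ln (fst p) - Ln (fst p')) = of_nat m * (2 * of_int j * of_real pi * \<i>)"
      using j(2) by (simp add: algebra_simps)
    then have "Ln (fst p) - Ln (fst p') = 2 * of_int j * of_real pi * \<i>"
      unfolding mult_cancel_left using m by simp
    then have "Ln (fst p) = Ln (fst p') + (of_int (2 * j) * pi) * \<i>"
      by (simp add: algebra_simps)
    then have "exp (Ln (fst p)) = exp (Ln (fst p'))" unfolding exp_eq by blast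
    then show ?thesis using pp j by (simp add: prod_eq_iff)
  qed
  have E0E: "E0 \<subseteq> E" unfolding E0_def E_def by auto
  have clE0: "E \<subseteq> closure E0"
    unfolding E_def E0_def closure_Times
    by (auto simp: closure_complement mem_Times_iff intro: closure_subset[THEN subsetD])
  \<comment> \<open>The limit is one of the finitely many points \<open>F\<close> over the branch
    point. If each had a neighbourhood that \<open>g\<close> leaves arbitrarily close to
    \<open>p\<close>, closedness of \<open>q\<close> would still put everything over a neighbourhood
    of the branch point into the disjoint sets \<open>V x\<close>; the connected image of
    \<open>H\<close> then lies in a single one, a contradiction.\<close>
  have lim: "\<exists>l. limitin X g l (atin_within euclidean p E0)" if p: "p \<in> E - E0" for p
  proof -
    obtain t where t: "p = (0, t)" "t \<in> T" using p unfolding E_def E0_def by auto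
    define F where "F = {x \<in> topspace X. q x = (0, t)}"
    have F: "finite F" "F \<subseteq> topspace X" unfolding F_def using fin t by auto
    obtain D where D: "\<And>x. x \<in> F \<Longrightarrow> openin X (D x) \<and> x \<in> D x"
      and Ddis: "\<And>x y. x \<in> F \<Longrightarrow> y \<in> F \<Longrightarrow> x \<noteq> y \<Longrightarrow> D x \<inter> D y = {}"
      by (rule Hausdorff_finite_disjoint_nhds[OF X(1) F]) blast
    have "\<exists>x\<in>F. limitin X g x (atin_within euclidean p E0)"
    proof (rule ccontr)
      assume "\<not> ?thesis"
      then have "\<forall>x\<in>F. \<exists>U. openin X U \<and> x \<in> U \<and> \<not> eventually (\<lambda>y. g y \<in> U) (atin_within euclidean p E0)"
        using F unfolding limitin_def by blast
      then obtain U where U: "\<And>x. x \<in> F \<Longrightarrow> openin X (U x) \<and> x \<in> U x \<and>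
         \<not> eventually (\<lambda>y. g y \<in> U x) (atin_within euclidean p E0)" by metis
      define V where "V = (\<lambda>x. U x \<inter> D x)"
      have V: "openin X (V x)" "x \<in> V x" if "x \<in> F" for x
        using U[OF that] D[OF that] unfolding V_def by auto
      define O' where "O' = (\<Union>x\<in>F. V x)"
      have oO: "openin X O'" unfolding O'_def using V by blast
      have "closedin (top_of_set E) (q ` (topspace X - O'))"
        using q(2) oO unfolding closed_map_def by blast
      then have "openin (top_of_set E) (E - q ` (topspace X - O'))"
        unfolding closedin_def by simp
      then obtain G where G: "open G" "E - q ` (topspace X - O') = E \<inter> G" by (auto simp: openin_open)
      have "(0, t) \<in> G"
      proof -
        have "(0, t) \<notin> q ` (topspace X - O')" using V(2) unfolding O'_def F_def by force
        then show ?thesis using G t unfolding E_def by auto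
      qed
      have qG: "x \<in> O'" if "x \<in> topspace X" "q x \<in> G" for x using G that qE by blast
      obtain A B where AB: "open A" "open B" "0 \<in> A" "t \<in> B" "A \<times> B \<subseteq> G"
        using G(1) \<open>(0,t) \<in> G\<close> by (metis open_prod_elim mem_Sigma_iff)
      obtain d1 where d1: "d1 > 0" "ball 0 d1 \<subseteq> A" using AB open_contains_ball by blast
      obtain d2 where d2: "d2 > 0" "ball t d2 \<subseteq> B" using AB open_contains_ball by blast
      \<comment> \<open>\<open>H\<close> is the preimage under the exponential of a punctured disk
        times an interval of \<open>T\<close>. It is convex, so connectedness is immediate in
        logarithmic coordinates.\<close>
      define H where "H = {w::complex. Re w < ln d1} \<times> (T \<inter> ball t d2)"
      have "convex H" unfolding H_def using T by (intro convex_Times convex_Int convex_halfspace_Re_lt) auto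
      then have "connectedin (top_of_set E) H"
        using convex_connected[of H] by (auto simp: connectedin_subtopology H_def E_def)
      then have conH: "connectedin X (\<sigma> ` H)" using connectedin_continuous_map_image[OF \<sigma>X] by blast
      have HO: "\<sigma> ` H \<subseteq> O'"
      proof clarify
        fix w s assume ws: "(w, s) \<in> H"
        have sX: "\<sigma> (w, s) \<in> topspace X" using conH connectedin_subset_topspace ws by blast
        have "exp (Re w) < exp (ln d1)" using ws unfolding H_def by simp
        then have "norm (exp w) < d1" using d1(1) by simp
        then have "(exp w, s) \<in> A \<times> B" using ws d1 d2 unfolding H_def by auto
        then have "q (\<sigma> (w, s)) \<in> G" using q\<sigma> AB ws unfolding H_def by auto
        then show "\<sigma> (w, s) \<in> O'" using qG sX by blast
      qed
      have "(of_real (ln d1 - 1), t) \<in> H" unfolding H_def using t d2 by auto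
      then obtain x where xF: "x \<in> F" "\<sigma> (of_real (ln d1 - 1), t) \<in> V x" using HO unfolding O'_def by blast
      have "\<sigma> ` H \<subseteq> V x"
      proof -
        define V' where "V' = (\<Union>y\<in>F - {x}. V y)"
        have oV': "openin X V'" unfolding V'_def using V by blast
        have "V x \<inter> V y = {}" if "y \<in> F - {x}" for y using Ddis[OF xF(1), of y] that unfolding V_def by auto
        then have "V x \<inter> V' = {}" unfolding V'_def by auto
        then have 1: "V x \<inter> V' \<inter> \<sigma> ` H = {}" by auto
        have 2: "\<sigma> ` H \<subseteq> V x \<union> V'" using HO unfolding O'_def V'_def by auto
        have 3: "V x \<inter> \<sigma> ` H \<noteq> {}" using xF(2) \<open>_ \<in> H\<close> by blast
        have "V' \<inter> \<sigma> ` H = {}"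
          using conH V(1)[OF xF(1)] oV' 1 2 3 unfolding connectedin by (metis)
        then show ?thesis using 2 by auto
      qed
      moreover have "eventually (\<lambda>y. g y \<in> U x) (atin_within euclidean p E0)"
        unfolding eventually_atin_within
      \<comment> \<open>In \<open>g\<close> the lift is evaluated at \<open>m * Ln z\<close>, whose
        real part is the logarithm of the modulus of \<open>z ^ m\<close>; hence the neighbourhood
        is cut out by \<open>z ^ m\<close>.\<close>
      proof (intro disjI2 exI[of _ "{z. norm (z ^ m) < d1} \<times> ball t d2"] conjI ballI impI)
        have "open {z::complex. norm (z ^ m) < d1}" by (intro open_Collect_less continuous_intros)
        then show "openin euclidean ({z::complex. norm (z ^ m) < d1} \<times> ball t d2)" by (auto intro: open_Times)
        show "p \<in> {z. norm (z ^ m) < d1} \<times> ball t d2" using t m d1 d2 by (simp add: power_0_left)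
        fix y :: "complex \<times> real" assume y: "y \<in> {z. norm (z ^ m) < d1} \<times> ball t d2" "y \<in> E0 \<and> y \<noteq> p"
        have "fst y \<noteq> 0" using y unfolding E0_def by auto
        have "exp (Re (of_nat m * Ln (fst y))) = norm (exp (of_nat m * Ln (fst y)))" by simp
        also have "\<dots> = norm (fst y ^ m)" using \<open>fst y \<noteq> 0\<close> by (simp add: exp_of_nat_mult)
        also have "\<dots> < d1" using y by auto
        finally have "exp (Re (of_nat m * Ln (fst y))) < exp (ln d1)" using d1(1) by simp
        then have "Re (of_nat m * Ln (fst y)) < ln d1" unfolding exp_less_cancel_iff .
        then have "(of_nat m * Ln (fst y), snd y) \<in> H" using y unfolding H_def E0_def by auto
        then show "g y \<in> U x" using \<open>\<sigma> ` H \<subseteq> V x\<close> unfolding g_def V_def by blast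
      qed
      ultimately show False using U[OF xF(1)] by blast
    qed
    then show ?thesis by blast
  qed
  obtain G where G: "continuous_map (top_of_set E) X G" "\<And>p. p \<in> E0 \<Longrightarrow> G p = g p"
  proof -
    have "E \<subseteq> euclidean closure_of E0" using clE0 by simp
    \<comment> \<open>Regularity of \<open>X\<close> turns the pointwise limits into a continuous
      extension.\<close>
    from continuous_map_extension_pointwise_alt[OF X(2) E0E this cg lim] that show thesis by blast
  qed
  have qG: "q (G p) = (fst p ^ m, snd p)" if p: "p \<in> E" for p
  proof (rule forall_in_closure_of_eq[of p "top_of_set E" E0 "euclidean" "\<lambda>p. q (G p)"])
    show "p \<in> top_of_set E closure_of E0"
      using p clE0 E0E by (auto simp: closure_of_subtopology Int_absorb1)
    have "continuous_map (top_of_set E) (top_of_set E) (q \<circ> G)" using G(1) q(1) continuous_map_compose by blast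
    then show "continuous_map (top_of_set E) euclidean (\<lambda>p. q (G p))" by (simp add: continuous_map_in_subtopology o_def)
    show "continuous_map (top_of_set E) euclidean (\<lambda>p. (fst p ^ m, snd p))" by (auto intro!: continuous_intros)
    show "q (G p) = (fst p ^ m, snd p)" if "p \<in> E0" for p using qg G that by simp
  qed auto
  \<comment> \<open>The composite with \<open>q\<close> is the power map; as \<open>X\<close> is
    Hausdorff, its properness forces that of \<open>G\<close>.\<close>
  have prp: "proper_map (top_of_set E) X G"
  proof (rule proper_map_from_composition_right[OF X(1) _ G(1) q(1)])
    show "proper_map (top_of_set E) (top_of_set E) (q \<circ> G)"
      by (rule proper_map_cong[OF proper_map_power_times[OF m T(2), folded E_def]]) (simp add: qG)
  qed
  then have clG: "closed_map (top_of_set E) X G" by (simp add: proper_map_def)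
  have injG: "inj_on G E"
  proof (rule inj_onI)
    fix p p' assume p: "p \<in> E" "p' \<in> E" "G p = G p'"
    then have e: "(fst p ^ m, snd p) = (fst p' ^ m, snd p')" using qG by metis
    show "p = p'"
    proof (cases "fst p = 0")
      case True
      then have "fst p' = 0" using e m by (auto simp: power_0_left)
      then show ?thesis using True e by (simp add: prod_eq_iff)
    next
      case False
      then have "fst p' \<noteq> 0" using e m by (auto simp: power_0_left)
      then have "p \<in> E0" "p' \<in> E0" using False p unfolding E_def E0_def by (auto simp: mem_Times_iff)
      then show ?thesis using injg G p by simp
    qed
  qed
  have emb: "embedding_map (top_of_set E) X G"
    using injective_closed_imp_embedding_map[OF G(1) clG] injG by simp
  have sub: "\<sigma> ` E \<subseteq> G ` E" using g\<sigma> G(2) E0E by (metis image_cong image_mono)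
  have GX: "G ` E \<subseteq> topspace X" using G(1) by (auto simp: continuous_map_def Pi_iff)
  have clGE: "closedin X (G ` E)" using clG unfolding closed_map_def by (metis closedin_topspace topspace_euclidean_subtopology)
  have "openin X (G ` E)"
  proof (subst openin_subopen, clarify)
    fix z t assume zt: "(z, t) \<in> E"
    show "\<exists>U. openin X U \<and> G (z, t) \<in> U \<and> U \<subseteq> G ` E"
    proof (cases "z = 0")
      case False
      then have "(z, t) \<in> E0" using zt unfolding E_def E0_def by auto
      then have "G (z, t) \<in> \<sigma> ` E" using G(2) g\<sigma> by (metis imageI)
      moreover have "openin X0 (\<sigma> ` E)" using o\<sigma> unfolding open_map_def by (metis openin_topspace topspace_euclidean_subtopology)
      ultimately show ?thesis using sub oX0 by blast
    next
      case True
      have x: "G (z, t) \<in> topspace X" "fst (q (G (z, t))) = 0" using GX zt qG[OF zt] True m by (auto simp: power_0_left)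
      then obtain U where U: "openin X U" "G (z, t) \<in> U" "connectedin X (U \<inter> P)" "U \<subseteq> X closure_of (U \<inter> P)"
        using loc by blast
      have "openin (top_of_set E) {p \<in> E. G p \<in> U}" using openin_continuous_map_preimage[OF G(1) U(1)] by simp
      then obtain Q where Q: "open Q" "{p \<in> E. G p \<in> U} = E \<inter> Q" by (auto simp: openin_open)
      have "(z, t) \<in> Q" using Q U zt by blast
      moreover have "(z, t) \<in> closure E0" using clE0 zt by blast
      ultimately obtain p where p: "p \<in> E0" "p \<in> Q" using Q(1) open_Int_closure_eq_empty[of Q E0] by blast
      then have "G p \<in> U" using Q E0E by blast
      moreover have "G p \<in> \<sigma> ` E" using G(2)[OF p(1)] g\<sigma> p by blast
      moreover have "\<sigma> ` E \<subseteq> P" using connected_components_of_subset[OF co] tX0 by blast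
      ultimately have "\<not> disjnt (\<sigma> ` E) (U \<inter> P)" by (auto simp: disjnt_iff)
      moreover have "connectedin X0 (U \<inter> P)" using U(3) unfolding X0_def connectedin_subtopology by blast
      ultimately have "U \<inter> P \<subseteq> \<sigma> ` E" using connected_components_of_maximal[OF co] by blast
      then have "X closure_of (U \<inter> P) \<subseteq> G ` E" using sub clGE by (intro closure_of_minimal) auto
      then show ?thesis using U by blast
    qed
  qed
  moreover have conC: "connectedin X C" using C connectedin_connected_components_of by blast
  moreover have "x1 \<in> G ` E" using x1\<sigma> sub by blast
  ultimately have "C \<subseteq> G ` E" using connectedin_clopen_cases[OF conC clGE] x1 by (auto simp: disjnt_iff)
  moreover have "connectedin (top_of_set E) E"
    using convex_connected[of E] T unfolding E_def by (auto simp: connectedin_subtopology convex_Times)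
  then have "connectedin X (G ` E)" using connectedin_continuous_map_image[OF G(1)] by blast
  then have "G ` E \<subseteq> C" using maxC x1(1) \<open>x1 \<in> G ` E\<close> by blast
  ultimately have "C = G ` E" by blast
  then show ?thesis
    using embedding_map_imp_homeomorphic_space[OF emb] unfolding E_def
    by (metis homeomorphic_space_sym topspace_euclidean_subtopology)
qed

section \<open>Finite coverings under restriction and change of the base\<close>

lemma finite_coveringE:
  assumes "finite_covering X Y q" "y \<in> topspace Y"
  obtains W \<V> where "openin Y W" "y \<in> W" "finite \<V>" "pairwise disjnt \<V>"
     "\<Union>\<V> = {x \<in> topspace X. q x \<in> W}"
     "\<And>V. V \<in> \<V> \<Longrightarrow> openin X V \<and> homeomorphic_map (subtopology X V) (subtopology Y W) q"
proof -
  have "\<exists>W \<V>. openin Y W \<and> y \<in> W \<and> finite \<V> \<and> pairwise disjnt \<V> \<and>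
        \<Union>\<V> = {x \<in> topspace X. q x \<in> W} \<and>
        (\<forall>V\<in>\<V>. openin X V \<and> homeomorphic_map (subtopology X V) (subtopology Y W) q)"
    using assms(1)[unfolded finite_covering_def, THEN conjunct2] assms(2) by (rule bspec)
  then show thesis
    by (elim exE conjE) (rule that, (assumption | erule (1) bspec)+)
qed

lemma finite_covering_restrict:
  assumes cov: "finite_covering X Y q"
  shows "finite_covering (subtopology X {x \<in> topspace X. q x \<in> B}) (subtopology Y B) q"
  unfolding finite_covering_def
proof (intro conjI ballI)
  show "continuous_map (subtopology X {x \<in> topspace X. q x \<in> B}) (subtopology Y B) q"
    using finite_covering_continuous[OF cov] by (auto simp: continuous_map_in_subtopology continuous_map_from_subtopology)
  fix y assume y: "y \<in> topspace (subtopology Y B)"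
  then have yY: "y \<in> topspace Y" by simp
  obtain W \<V> where W: "openin Y W" "y \<in> W" "finite \<V>" "pairwise disjnt \<V>"
     "\<Union>\<V> = {x \<in> topspace X. q x \<in> W}"
     and V: "\<And>V. V \<in> \<V> \<Longrightarrow> openin X V \<and> homeomorphic_map (subtopology X V) (subtopology Y W) q"
    by (rule finite_coveringE[OF cov yY], rule that)
  let ?B = "{x \<in> topspace X. q x \<in> B}"
  let ?\<V> = "(\<lambda>V. ?B \<inter> V) ` \<V>"
  have "\<forall>V\<in>?\<V>. openin (subtopology X ?B) V \<and>
       homeomorphic_map (subtopology (subtopology X ?B) V) (subtopology (subtopology Y B) (B \<inter> W)) q"
  proof clarify
    fix V assume V': "V \<in> \<V>"
    have VX: "V \<subseteq> topspace X" using V[OF V'] openin_subset by blast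
    have "homeomorphic_map (subtopology (subtopology X V) (?B \<inter> V)) (subtopology (subtopology Y W) (B \<inter> W)) q"
    proof (rule homeomorphic_map_subtopologies_alt)
      show "homeomorphic_map (subtopology X V) (subtopology Y W) q" using V[OF V'] by blast
      show "q x \<in> B \<inter> W \<longleftrightarrow> x \<in> ?B \<inter> V"
        if "x \<in> topspace (subtopology X V)" "q x \<in> topspace (subtopology Y W)" for x using that by auto
    qed
    then show "openin (subtopology X ?B) (?B \<inter> V) \<and>
      homeomorphic_map (subtopology (subtopology X ?B) (?B \<inter> V)) (subtopology (subtopology Y B) (B \<inter> W)) q"
      using V[OF V'] openin_subtopology_Int2[of X V ?B]
      by (auto simp: subtopology_subtopology inf_commute inf_left_commute)
  qed
  moreover have "pairwise disjnt ?\<V>"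
    unfolding pairwise_image using W(4) by (auto simp: pairwise_def disjnt_iff)
  moreover have "\<Union>?\<V> = {x \<in> topspace (subtopology X ?B). q x \<in> B \<inter> W}" using W(5) by auto
  moreover have "openin (subtopology Y B) (B \<inter> W)" by (rule openin_subtopology_Int2[OF W(1)])
  ultimately show "\<exists>W \<V>. openin (subtopology Y B) W \<and> y \<in> W \<and> finite \<V> \<and> pairwise disjnt \<V> \<and>
        \<Union>\<V> = {x \<in> topspace (subtopology X ?B). q x \<in> W} \<and>
        (\<forall>V\<in>\<V>. openin (subtopology X ?B) V \<and>
          homeomorphic_map (subtopology (subtopology X ?B) V) (subtopology (subtopology Y B) W) q)"
    using W(2,3) y by (intro exI[of _ "B \<inter> W"] exI[of _ ?\<V>] conjI) simp_all
qed

lemma finite_covering_compose_homeomorphic: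
  assumes cov: "finite_covering X Y q" and h: "homeomorphic_map Y Z h"
  shows "finite_covering X Z (h \<circ> q)"
  unfolding finite_covering_def
proof (intro conjI ballI)
  show "continuous_map X Z (h \<circ> q)"
    using finite_covering_continuous[OF cov] h continuous_map_compose homeomorphic_imp_continuous_map by blast
  fix z assume "z \<in> topspace Z"
  then obtain y where y: "y \<in> topspace Y" "z = h y" using homeomorphic_imp_surjective_map[OF h] by blast
  obtain W \<V> where W: "openin Y W" "y \<in> W" "finite \<V>" "pairwise disjnt \<V>"
     "\<Union>\<V> = {x \<in> topspace X. q x \<in> W}"
     and V: "\<And>V. V \<in> \<V> \<Longrightarrow> openin X V \<and> homeomorphic_map (subtopology X V) (subtopology Y W) q"
    by (rule finite_coveringE[OF cov y(1)], rule that)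
  have WY: "W \<subseteq> topspace Y" by (rule openin_subset[OF W(1)])
  have qX: "q x \<in> topspace Y" if "x \<in> topspace X" for x
    using finite_covering_continuous[OF cov] that by (auto simp: continuous_map_def Pi_iff)
  have inj: "inj_on h (topspace Y)" using homeomorphic_imp_injective_map[OF h] .
  have "homeomorphic_map (subtopology Y W) (subtopology Z (h ` W)) h"
    by (rule homeomorphic_map_subtopologies[OF h])
       (use WY homeomorphic_imp_surjective_map[OF h] in auto)
  then have "\<forall>V\<in>\<V>. openin X V \<and> homeomorphic_map (subtopology X V) (subtopology Z (h ` W)) (h \<circ> q)"
    using V homeomorphic_map_compose by blast
  moreover have "openin Z (h ` W)" using homeomorphic_imp_open_map[OF h] W(1) unfolding open_map_def by simp
  moreover have "(h (q x) \<in> h ` W) = (q x \<in> W)" if "x \<in> topspace X" for x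
    using inj_on_image_mem_iff[OF inj _ WY] qX that by blast
  then have "\<Union>\<V> = {x \<in> topspace X. (h \<circ> q) x \<in> h ` W}" using W(5) by auto
  ultimately show "\<exists>W \<V>. openin Z W \<and> z \<in> W \<and> finite \<V> \<and> pairwise disjnt \<V> \<and>
        \<Union>\<V> = {x \<in> topspace X. (h \<circ> q) x \<in> W} \<and>
        (\<forall>V\<in>\<V>. openin X V \<and> homeomorphic_map (subtopology X V) (subtopology Z W) (h \<circ> q))"
    using W(2-4) y by (intro exI[of _ "h ` W"] exI[of _ \<V>] conjI) simp_all
qed

text \<open>A connected \<open>C\<close> is mapped into one component \<open>A\<close> of
  \<open>Q\<close>. The component of the preimage of \<open>A\<close> around \<open>C\<close> is
  connected in the preimage of \<open>Q\<close> as well, so it is no larger than \<open>C\<close>.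
  The cells downstairs can therefore be treated one at a time.\<close>

lemma connected_component_preimage:
  assumes p: "continuous_map N M p"
    and C: "C \<in> connected_components_of (subtopology N {x \<in> topspace N. p x \<in> Q})"
  obtains A where "A \<in> connected_components_of (subtopology M Q)"
    "C \<in> connected_components_of (subtopology N {x \<in> topspace N. p x \<in> A})"
proof -
  let ?X = "subtopology N {x \<in> topspace N. p x \<in> Q}"
  obtain x where x: "x \<in> C" using C nonempty_connected_components_of by blast
  have CX: "C \<subseteq> {x \<in> topspace N. p x \<in> Q}" using connected_components_of_subset[OF C] by auto
  have conC: "connectedin N C" using connectedin_connected_components_of[OF C] connectedin_subtopology by blast
  have pxM: "p x \<in> topspace (subtopology M Q)"
    using p x CX by (auto simp: continuous_map_def Pi_iff)
  define A where "A = connected_component_of_set (subtopology M Q) (p x)"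
  have A: "A \<in> connected_components_of (subtopology M Q)"
    unfolding A_def connected_components_of_def using pxM by blast
  have "connectedin M (p ` C)" using connectedin_continuous_map_image[OF p conC] .
  then have "connectedin (subtopology M Q) (p ` C)" using CX by (auto simp: connectedin_subtopology)
  then have pC: "p ` C \<subseteq> A"
    unfolding A_def by (rule connected_component_of_maximal) (use x in blast)
  have AQ: "A \<subseteq> Q" using connected_components_of_subset[OF A] by auto
  let ?Y = "subtopology N {x \<in> topspace N. p x \<in> A}"
  let ?D = "connected_component_of_set ?Y x"
  have xY: "x \<in> topspace ?Y" using x CX pC by auto
  have D: "?D \<in> connected_components_of ?Y" unfolding connected_components_of_def using xY by blast
  have "connectedin ?Y C" using conC CX pC by (auto simp: connectedin_subtopology)
  then have "C \<subseteq> ?D" by (rule connected_component_of_maximal) (rule x)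
  moreover have "connectedin ?X ?D"
    using connectedin_connected_components_of[OF D] AQ by (auto simp: connectedin_subtopology)
  then have "?D \<subseteq> C"
    using connected_components_of_maximal[OF C, of ?D] x \<open>C \<subseteq> ?D\<close> by (auto simp: disjnt_iff)
  ultimately have "C = ?D" by blast
  then show thesis using that A D by metis
qed

text \<open>The cells of \<open>open_disk\<close> are modelled on real sequences that vanish from
  the index \<open>k\<close> on, while lifting and the exponential live on Euclidean types.\<close>

lemma euclidean_homeomorphic_Euclidean_space:
  "(euclidean :: 'e::euclidean_space topology) homeomorphic_space Euclidean_space (DIM('e))"
proof -
  let ?n = "DIM('e)"
  obtain b :: "nat \<Rightarrow> 'e" where b: "bij_betw b {..<?n} Basis"
    using ex_bij_betw_nat_finite[of "Basis :: 'e set"] by (auto simp: lessThan_atLeast0)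
  define f where "f = (\<lambda>(v::'e) i. if i < ?n then v \<bullet> b i else 0)"
  define g where "g = (\<lambda>x::nat \<Rightarrow> real. \<Sum>i<?n. x i *\<^sub>R b i)"
  have bB: "b i \<in> Basis" if "i < ?n" for i using b that by (auto simp: bij_betw_def)
  have gf: "g (f v) = v" for v
  proof -
    have "g (f v) = (\<Sum>i<?n. (v \<bullet> b i) *\<^sub>R b i)" unfolding g_def f_def by simp
    also have "\<dots> = (\<Sum>c\<in>Basis. (v \<bullet> c) *\<^sub>R c)" using sum.reindex_bij_betw[OF b, of "\<lambda>c. (v \<bullet> c) *\<^sub>R c"] .
    also have "\<dots> = v" by (rule euclidean_representation)
    finally show ?thesis .
  qed
  have fg: "f (g x) = x" if x: "x \<in> topspace (Euclidean_space ?n)" for x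
  proof
    fix i
    have x0: "x i = 0" if "i \<ge> ?n" for i using x that by (auto simp: topspace_Euclidean_space)
    show "f (g x) i = x i"
    proof (cases "i < ?n")
      case True
      have "g x \<bullet> b i = (\<Sum>j<?n. x j * (b j \<bullet> b i))" unfolding g_def by (simp add: inner_sum_left)
      also have "\<dots> = (\<Sum>j<?n. if j = i then x j else 0)"
      proof (rule sum.cong[OF refl])
        fix j assume "j \<in> {..<?n}"
        then have "b j \<bullet> b i = (if j = i then 1 else 0)"
          using True bB b by (auto simp: inner_Basis bij_betw_def inj_on_def)
        then show "x j * (b j \<bullet> b i) = (if j = i then x j else 0)" by simp
      qed
      also have "\<dots> = x i" using True by simp
      finally show ?thesis using True by (simp add: f_def)
    next
      case False then show ?thesis using x0 by (simp add: f_def)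
    qed
  qed
  have "continuous_map euclidean (Euclidean_space ?n) f"
    unfolding f_def
    by (rule iffD2[OF continuous_map_componentwise_Euclidean_space]) (auto intro!: continuous_intros)
  moreover have "continuous_map (Euclidean_space ?n) euclidean g"
    unfolding g_def Euclidean_space_def
    by (intro continuous_map_from_subtopology) (auto intro!: continuous_intros continuous_on_product_coordinates simp: euclidean_product_topology)
  ultimately have "homeomorphic_maps euclidean (Euclidean_space ?n) f g"
    unfolding homeomorphic_maps_def using gf fg by auto
  then show ?thesis by (auto simp: homeomorphic_space_def)
qed

lemma covering_cell_component:
  assumes cov: "finite_covering (subtopology N {x \<in> topspace N. p x \<in> L}) (subtopology M L) p"
    and A: "A \<subseteq> L" "A \<subseteq> topspace M" and cell: "subtopology M A homeomorphic_space (euclidean :: 'e::euclidean_space topology)"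
    and C: "C \<in> connected_components_of (subtopology N {x \<in> topspace N. p x \<in> A})"
  shows "subtopology N C homeomorphic_space subtopology M A"
proof -
  let ?L = "{x \<in> topspace N. p x \<in> L}" and ?A = "{x \<in> topspace N. p x \<in> A}"
  have "finite_covering (subtopology (subtopology N ?L) {x \<in> topspace (subtopology N ?L). p x \<in> A}) (subtopology (subtopology M L) A) p"
    by (rule finite_covering_restrict[OF cov])
  moreover have "subtopology (subtopology N ?L) {x \<in> topspace (subtopology N ?L). p x \<in> A} = subtopology N ?A"
    unfolding subtopology_subtopology using A by (intro arg_cong[of _ _ "subtopology N"]) auto
  moreover have "subtopology (subtopology M L) A = subtopology M A"
    unfolding subtopology_subtopology using A by (simp add: Int_absorb1)
  ultimately have cov': "finite_covering (subtopology N ?A) (subtopology M A) p" by simp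
  obtain h where "homeomorphic_map (subtopology M A) (euclidean :: 'e topology) h"
    using cell homeomorphic_space by blast
  from finite_covering_euclidean_component[OF cov' this C]
  have "subtopology (subtopology N ?A) C homeomorphic_space subtopology M A" .
  moreover have "C \<subseteq> ?A" using connected_components_of_subset[OF C] by auto
  ultimately show ?thesis by (simp add: subtopology_subtopology Int_absorb1)
qed

text \<open>The coordinates \<open>h\<close> bring the cell into the product form of
  \<open>branched_covering_component\<close>. Compactness of \<open>N\<close> enters here: it makes
  \<open>p\<close> closed and \<open>N\<close> regular, and both properties survive restriction to
  the preimage of \<open>A\<close>.\<close>

lemma branched_covering_cell_component:
  fixes h :: "'b \<Rightarrow> complex \<times> real" and T :: "real set"
  assumes N: "compact_space N" "Hausdorff_space N" and M: "Hausdorff_space M"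
    and p: "continuous_map N M p"
    and cov: "finite_covering (subtopology N {x \<in> topspace N. p x \<in> L}) (subtopology M L) p"
    and A: "A \<subseteq> topspace M"
    and h: "homeomorphic_map (subtopology M A) (top_of_set (UNIV \<times> T)) h"
    and hL: "\<And>y. y \<in> A \<Longrightarrow> y \<in> L \<longleftrightarrow> fst (h y) \<noteq> 0"
    and T: "convex T" "closed T"
    and fin: "\<And>y. y \<in> A - L \<Longrightarrow> finite {x \<in> topspace N. p x = y}"
    and loc: "\<And>x. x \<in> topspace N \<Longrightarrow> p x \<in> A - L \<Longrightarrow>
       \<exists>U. openin (subtopology N {x \<in> topspace N. p x \<in> A}) U \<and> x \<in> U \<and>
         connectedin N (U \<inter> {x. p x \<in> L}) \<and> U \<subseteq> N closure_of (U \<inter> {x. p x \<in> L})"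
    and C: "C \<in> connected_components_of (subtopology N {x \<in> topspace N. p x \<in> A})"
  shows "subtopology N C homeomorphic_space subtopology M A"
proof -
  define X where "X = subtopology N {x \<in> topspace N. p x \<in> A}"
  define q where "q = h \<circ> p"
  define E where "E = (UNIV :: complex set) \<times> T"
  have tX: "topspace X = {x \<in> topspace N. p x \<in> A}" unfolding X_def by auto
  have tA: "topspace (subtopology M A) = A" using A by auto
  have hinj: "inj_on h A" and hsur: "h ` A = E"
    using homeomorphic_imp_injective_map[OF h] homeomorphic_imp_surjective_map[OF h] tA by (auto simp: E_def)
  have pX: "continuous_map X (subtopology M A) p"
    unfolding X_def using p by (auto simp: continuous_map_in_subtopology continuous_map_from_subtopology)
  have "closed_map N M p" using N(1) M p continuous_imp_closed_map by blast
  then have clp: "closed_map X (subtopology M A) p"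
    unfolding X_def by (rule closed_map_restriction) auto
  have XH: "Hausdorff_space X" "regular_space X"
    unfolding X_def using N Hausdorff_space_subtopology compact_Hausdorff_imp_regular_space regular_space_subtopology by blast+
  have cq: "continuous_map X (top_of_set E) q"
    unfolding q_def E_def using pX h continuous_map_compose homeomorphic_imp_continuous_map by blast
  have clq: "closed_map X (top_of_set E) q"
    unfolding q_def E_def using clp h closed_map_compose homeomorphic_imp_closed_map by blast
  have qL: "fst (q x) \<noteq> 0 \<longleftrightarrow> p x \<in> L" if "x \<in> topspace X" for x using hL that unfolding q_def tX by auto
  have finq: "finite {x \<in> topspace X. q x = (0, t)}" if "t \<in> T" for t
  proof -
    have "(0, t) \<in> h ` A" using hsur that unfolding E_def by simp
    then obtain y where y: "y \<in> A" "h y = (0, t)" by (metis imageE)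
    have "y \<notin> L" using hL y by auto
    have "{x \<in> topspace X. q x = (0, t)} \<subseteq> {x \<in> topspace N. p x = y}"
      using inj_onD[OF hinj] y unfolding q_def tX by auto
    then show ?thesis using fin[of y] y \<open>y \<notin> L\<close> finite_subset by blast
  qed
  have covq: "finite_covering (subtopology X {x. fst (q x) \<noteq> 0}) (top_of_set ((-{0}) \<times> T)) q"
  proof -
    let ?L = "{x \<in> topspace N. p x \<in> L}"
    have 1: "finite_covering (subtopology (subtopology N ?L) {x \<in> topspace (subtopology N ?L). p x \<in> A}) (subtopology (subtopology M L) A) p"
      by (rule finite_covering_restrict[OF cov])
    \<comment> \<open>Outside the space \<open>p\<close> and \<open>q\<close> have arbitrary values,
      so the two descriptions of the unbranched part agree only after intersecting with
      \<open>topspace N\<close>.\<close>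
    have "topspace N \<inter> (?L \<inter> {x \<in> topspace (subtopology N ?L). p x \<in> A}) =
        topspace N \<inter> ({x \<in> topspace N. p x \<in> A} \<inter> {x. fst (q x) \<noteq> 0})"
      using qL unfolding tX by auto
    then have 2: "subtopology (subtopology N ?L) {x \<in> topspace (subtopology N ?L). p x \<in> A} = subtopology X {x. fst (q x) \<noteq> 0}"
      unfolding X_def subtopology_subtopology
      using subtopology_restrict[of N "?L \<inter> {x \<in> topspace (subtopology N ?L). p x \<in> A}"]
        subtopology_restrict[of N "{x \<in> topspace N. p x \<in> A} \<inter> {x. fst (q x) \<noteq> 0}"] by simp
    have "h ` (A \<inter> L) = (-{0}) \<times> T"
    proof
      show "h ` (A \<inter> L) \<subseteq> (-{0}) \<times> T"
      proof
        fix z assume "z \<in> h ` (A \<inter> L)"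
        then obtain y where y: "y \<in> A" "y \<in> L" "z = h y" by blast
        have "h y \<in> E" using y(1) hsur by (metis imageI)
        moreover have "fst (h y) \<noteq> 0" using hL[OF y(1)] y(2) by simp
        ultimately show "z \<in> (-{0}) \<times> T" unfolding y(3) E_def by (simp add: mem_Times_iff)
      qed
      show "(-{0}) \<times> T \<subseteq> h ` (A \<inter> L)"
      proof
        fix z assume z: "z \<in> (-{0::complex}) \<times> T"
        then have "z \<in> h ` A" using hsur unfolding E_def by auto
        then obtain y where y: "y \<in> A" "z = h y" by blast
        then have "y \<in> L" using hL[OF y(1)] z by auto
        then show "z \<in> h ` (A \<inter> L)" using y by blast
      qed
    qed
    then have "homeomorphic_map (subtopology (subtopology M A) (A \<inter> L)) (subtopology (top_of_set (UNIV \<times> T)) ((-{0}) \<times> T)) h"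
      by (intro homeomorphic_map_subtopologies[OF h]) (use A hsur in \<open>auto simp: E_def\<close>)
    moreover have "subtopology (subtopology M A) (A \<inter> L) = subtopology (subtopology M L) A"
      unfolding subtopology_subtopology by (simp add: inf_commute)
    moreover have "subtopology (top_of_set (UNIV \<times> T)) ((-{0}) \<times> T) = top_of_set ((-{0::complex}) \<times> T)"
      unfolding subtopology_subtopology by (intro arg_cong[of _ _ top_of_set]) auto
    ultimately have "homeomorphic_map (subtopology (subtopology M L) A) (top_of_set ((-{0}) \<times> T)) h" by simp
    from finite_covering_compose_homeomorphic[OF 1 this] show ?thesis unfolding 2 q_def .
  qed
  have locq: "\<exists>U. openin X U \<and> x \<in> U \<and>
        connectedin X (U \<inter> {x. fst (q x) \<noteq> 0}) \<and> U \<subseteq> X closure_of (U \<inter> {x. fst (q x) \<noteq> 0})"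
    if x: "x \<in> topspace X" "fst (q x) = 0" for x
  proof -
    have "x \<in> topspace N" "p x \<in> A - L" using x hL unfolding tX q_def by auto
    then obtain U where U: "openin X U" "x \<in> U" "connectedin N (U \<inter> {x. p x \<in> L})" "U \<subseteq> N closure_of (U \<inter> {x. p x \<in> L})"
      using loc unfolding X_def by blast
    have UX: "U \<subseteq> topspace X" using U openin_subset by blast
    have e: "U \<inter> {x. fst (q x) \<noteq> 0} = U \<inter> {x. p x \<in> L}" using UX qL by blast
    have "connectedin X (U \<inter> {x. p x \<in> L})" using U UX unfolding X_def tX connectedin_subtopology by auto
    moreover have "U \<subseteq> X closure_of (U \<inter> {x. p x \<in> L})"
    proof -
      have "{x \<in> topspace N. p x \<in> A} \<inter> (U \<inter> {x. p x \<in> L}) = U \<inter> {x. p x \<in> L}"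
        using UX unfolding tX by blast
      then show ?thesis unfolding X_def closure_of_subtopology using U(4) UX unfolding tX by auto
    qed
    ultimately show ?thesis using U e by metis
  qed
  have "subtopology X C homeomorphic_space top_of_set ((UNIV :: complex set) \<times> T)"
    by (rule branched_covering_component[OF XH cq[unfolded E_def] clq[unfolded E_def] finq covq locq T C[folded X_def]])
  moreover have "subtopology M A homeomorphic_space top_of_set ((UNIV :: complex set) \<times> T)"
    using h homeomorphic_space by blast
  moreover have "C \<subseteq> {x \<in> topspace N. p x \<in> A}" using connected_components_of_subset[OF C] by auto
  ultimately show ?thesis
    unfolding X_def by (metis homeomorphic_space_sym homeomorphic_space_trans inf.absorb2 subtopology_subtopology)
qed

section \<open>Calculus of smooth maps\<close>

lemma frechet_derivative_cong_open:
  assumes "open W" "x \<in> W" "\<And>y. y \<in> W \<Longrightarrow> g y = h y"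
  shows "frechet_derivative g (at x) = frechet_derivative h (at x)"
    and "g differentiable (at x) \<longleftrightarrow> h differentiable (at x)"
proof -
  have eq: "(g has_derivative D) (at x) \<longleftrightarrow> (h has_derivative D) (at x)" for D
    using has_derivative_transform_within_open[of g D x UNIV W h]
      has_derivative_transform_within_open[of h D x UNIV W g] assms by auto
  show "frechet_derivative g (at x) = frechet_derivative h (at x)"
    unfolding frechet_derivative_def eq ..
  show "g differentiable (at x) \<longleftrightarrow> h differentiable (at x)"
    unfolding differentiable_def eq ..
qed

lemma Ck_on_cong:
  assumes "open W" "\<And>y. y \<in> W \<Longrightarrow> g y = h y"
  shows "Ck_on k g W \<longleftrightarrow> Ck_on k h W"
  using assms(2)
proof (induction k arbitrary: g h)
  case 0 then show ?case by (simp cong: continuous_on_cong)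
next
  case (Suc k)
  have "Ck_on k (\<lambda>x. frechet_derivative g (at x) v) W \<longleftrightarrow> Ck_on k (\<lambda>x. frechet_derivative h (at x) v) W" for v
    using frechet_derivative_cong_open(1)[of W _ g h, OF assms(1) _ Suc.prems] by (intro Suc.IH) auto
  moreover have "(\<forall>x\<in>W. g differentiable (at x)) \<longleftrightarrow> (\<forall>x\<in>W. h differentiable (at x))"
    using frechet_derivative_cong_open(2)[of W _ g h, OF assms(1) _ Suc.prems] by auto
  ultimately show ?case by simp
qed

text \<open>Lets the inductions on the order work with any formula for the derivative in place of
  \<open>frechet_derivative\<close>.\<close>

lemma Ck_on_Suc_I:
  assumes W: "open W" and D: "\<And>x. x \<in> W \<Longrightarrow> (g has_derivative D x) (at x)"
    and k: "\<And>v. Ck_on k (\<lambda>x. D x v) W"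
  shows "Ck_on (Suc k) g W"
proof -
  have "frechet_derivative g (at x) = D x" if "x \<in> W" for x
    using frechet_derivative_at[OF D[OF that]] by simp
  then have "Ck_on k (\<lambda>x. frechet_derivative g (at x) v) W" for v
    using Ck_on_cong[OF W, of "\<lambda>x. frechet_derivative g (at x) v" "\<lambda>x. D x v"] k by simp
  moreover have "g differentiable (at x)" if "x \<in> W" for x
    using D[OF that] by (rule differentiableI)
  ultimately show ?thesis by simp
qed

lemma Ck_on_subset: "Ck_on k g W \<Longrightarrow> V \<subseteq> W \<Longrightarrow> Ck_on k g V"
  by (induction k arbitrary: g) (auto intro: continuous_on_subset)

lemma Ck_on_local:
  assumes "\<And>x. x \<in> W \<Longrightarrow> \<exists>V. open V \<and> x \<in> V \<and> Ck_on k g V"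
  shows "Ck_on k g W"
  using assms
proof (induction k arbitrary: g)
  case 0
  have "isCont g x" if x: "x \<in> W" for x
    using 0[OF x] continuous_on_eq_continuous_at by auto
  then show ?case by (simp add: continuous_at_imp_continuous_on)
next
  case (Suc k)
  show ?case
  proof (simp, intro conjI ballI allI)
    fix x assume "x \<in> W"
    then show "g differentiable (at x)" using Suc.prems[of x] by auto
  next
    fix v
    show "Ck_on k (\<lambda>x. frechet_derivative g (at x) v) W"
    proof (rule Suc.IH)
      fix x assume "x \<in> W"
      then obtain V where "open V" "x \<in> V" "Ck_on (Suc k) g V" using Suc.prems by blast
      then show "\<exists>V. open V \<and> x \<in> V \<and> Ck_on k (\<lambda>x. frechet_derivative g (at x) v) V" by auto
    qed
  qed
qed

lemma Ck_on_Suc_imp: "Ck_on (Suc k) g W \<Longrightarrow> Ck_on k g W"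
proof (induction k arbitrary: g)
  case 0
  then show ?case
    by (auto intro!: continuous_at_imp_continuous_on differentiable_imp_continuous_within)
next
  case (Suc k)
  have "Ck_on k (\<lambda>x. frechet_derivative g (at x) v) W" for v
    by (rule Suc.IH) (use Suc.prems in simp)
  then show ?case using Suc.prems by simp
qed

lemma Ck_on_const: "Ck_on k (\<lambda>x. c) W"
  by (induction k arbitrary: c) (auto simp: frechet_derivative_const)

lemma Ck_on_bounded_linear:
  assumes "bounded_linear L" shows "Ck_on k L W"
proof (cases k)
  case 0 then show ?thesis using linear_continuous_on[OF assms] by simp
next
  case (Suc j)
  have "(L has_derivative L) (at x)" for x by (rule bounded_linear_imp_has_derivative[OF assms])
  then have "frechet_derivative L (at x) = L" "L differentiable (at x)" for x
    using frechet_derivative_at differentiableI by metis+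
  then show ?thesis using Suc by (simp add: Ck_on_const)
qed

lemma Ck_on_has_derivative:
  "Ck_on (Suc k) g W \<Longrightarrow> x \<in> W \<Longrightarrow> (g has_derivative frechet_derivative g (at x)) (at x)"
  by (simp add: frechet_derivative_works[symmetric])

lemma Ck_on_linear_compose:
  assumes L: "bounded_linear L" and W: "open W"
  shows "Ck_on k g W \<Longrightarrow> Ck_on k (\<lambda>x. L (g x)) W"
proof (induction k arbitrary: g)
  case 0
  then show ?case using bounded_linear.continuous_on[OF L] by simp
next
  case (Suc k)
  show ?case
  proof (rule Ck_on_Suc_I[OF W])
    show "((\<lambda>x. L (g x)) has_derivative (\<lambda>v. L (frechet_derivative g (at x) v))) (at x)" if "x \<in> W" for x
      by (rule bounded_linear.has_derivative[OF L Ck_on_has_derivative[OF Suc.prems that]])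
    show "Ck_on k (\<lambda>x. L (frechet_derivative g (at x) v)) W" for v
      by (rule Suc.IH) (use Suc.prems in simp)
  qed
qed

lemma Ck_on_add:
  assumes W: "open W"
  shows "Ck_on k f W \<Longrightarrow> Ck_on k g W \<Longrightarrow> Ck_on k (\<lambda>x. f x + g x) W"
proof (induction k arbitrary: f g)
  case 0 then show ?case by (auto intro: continuous_intros)
next
  case (Suc k)
  show ?case
  proof (rule Ck_on_Suc_I[OF W])
    show "((\<lambda>x. f x + g x) has_derivative (\<lambda>v. frechet_derivative f (at x) v + frechet_derivative g (at x) v)) (at x)"
      if "x \<in> W" for x
      by (rule has_derivative_add[OF Ck_on_has_derivative[OF Suc.prems(1) that] Ck_on_has_derivative[OF Suc.prems(2) that]])
    show "Ck_on k (\<lambda>x. frechet_derivative f (at x) v + frechet_derivative g (at x) v) W" for v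
      by (rule Suc.IH) (use Suc.prems in simp_all)
  qed
qed

text \<open>Each term of the Leibniz rule pairs a derivative with an undifferentiated factor; the
  latter is used at one order less than it has.\<close>

lemma Ck_on_bilinear:
  assumes B: "bounded_bilinear B" and W: "open W"
  shows "Ck_on k f W \<Longrightarrow> Ck_on k g W \<Longrightarrow> Ck_on k (\<lambda>x. B (f x) (g x)) W"
proof (induction k arbitrary: f g)
  case 0 then show ?case using bounded_bilinear.continuous_on[OF B] by simp
next
  case (Suc k)
  show ?case
  proof (rule Ck_on_Suc_I[OF W])
    show "((\<lambda>x. B (f x) (g x)) has_derivative (\<lambda>v. B (f x) (frechet_derivative g (at x) v) + B (frechet_derivative f (at x) v) (g x))) (at x)"
      if "x \<in> W" for x
      by (rule bounded_bilinear.FDERIV[OF B Ck_on_has_derivative[OF Suc.prems(1) that] Ck_on_has_derivative[OF Suc.prems(2) that]])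
    show "Ck_on k (\<lambda>x. B (f x) (frechet_derivative g (at x) v) + B (frechet_derivative f (at x) v) (g x)) W" for v
      using Suc.prems Ck_on_Suc_imp[OF Suc.prems(1)] Ck_on_Suc_imp[OF Suc.prems(2)]
      by (intro Ck_on_add[OF W] Suc.IH) simp_all
  qed
qed

lemma Ck_on_sum:
  assumes W: "open W" and "finite I" "\<And>i. i \<in> I \<Longrightarrow> Ck_on k (f i) W"
  shows "Ck_on k (\<lambda>x. \<Sum>i\<in>I. f i x) W"
  using assms(2,3) by (induction I rule: finite_induct) (auto intro: Ck_on_const Ck_on_add[OF W])

text \<open>In the chain rule the derivative of \<open>h\<close> is taken in a direction that varies
  with the point. Expanding this direction in the basis leaves derivatives in fixed directions, the
  only ones that \<open>Ck_on\<close> controls.\<close>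

lemma Ck_on_compose:
  fixes g :: "'a::real_normed_vector \<Rightarrow> 'b::euclidean_space" and h :: "'b \<Rightarrow> 'c::real_normed_vector"
  assumes W: "open W" and V: "open V" and gW: "g ` W \<subseteq> V"
  shows "Ck_on k g W \<Longrightarrow> Ck_on k h V \<Longrightarrow> Ck_on k (h \<circ> g) W"
proof (induction k arbitrary: h)
  case 0
  then have "continuous_on (g ` W) h" using continuous_on_subset[OF _ gW] by simp
  then show ?case using continuous_on_compose[of W g h] 0 by simp
next
  case (Suc k)
  have g: "g differentiable (at x)" and h: "h differentiable (at (g x))" if "x \<in> W" for x
    using Suc.prems gW that by auto
  have D: "frechet_derivative (h \<circ> g) (at x) v =
      (\<Sum>b\<in>Basis. (frechet_derivative g (at x) v \<bullet> b) *\<^sub>R frechet_derivative h (at (g x)) b)" if "x \<in> W" for x v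
  proof -
    have lin: "linear (frechet_derivative h (at (g x)))" using h[OF that] linear_frechet_derivative by blast
    have "frechet_derivative (h \<circ> g) (at x) v = frechet_derivative h (at (g x)) (frechet_derivative g (at x) v)"
      using frechet_derivative_compose[OF g[OF that] h[OF that]] by simp
    also have "\<dots> = frechet_derivative h (at (g x)) (\<Sum>b\<in>Basis. (frechet_derivative g (at x) v \<bullet> b) *\<^sub>R b)"
      by (simp add: euclidean_representation)
    also have "\<dots> = (\<Sum>b\<in>Basis. (frechet_derivative g (at x) v \<bullet> b) *\<^sub>R frechet_derivative h (at (g x)) b)"
      by (simp add: linear_sum[OF lin] linear_scale[OF lin] cong: sum.cong)
    finally show ?thesis .
  qed
  have "Ck_on k (\<lambda>x. \<Sum>b\<in>Basis. (frechet_derivative g (at x) v \<bullet> b) *\<^sub>R frechet_derivative h (at (g x)) b) W" for v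
  proof (intro Ck_on_sum[OF W] finite_Basis Ck_on_bilinear[OF bounded_bilinear_scaleR W])
    fix b :: 'b assume "b \<in> Basis"
    show "Ck_on k (\<lambda>x. frechet_derivative g (at x) v \<bullet> b) W"
      using Suc.prems Ck_on_linear_compose[OF bounded_linear_inner_left W, of k "\<lambda>x. frechet_derivative g (at x) v" b] by simp
    have "Ck_on k ((\<lambda>y. frechet_derivative h (at y) b) \<circ> g) W"
      using Suc.prems Ck_on_Suc_imp[OF Suc.prems(1)] by (intro Suc.IH) auto
    then show "Ck_on k (\<lambda>x. frechet_derivative h (at (g x)) b) W" by (simp add: o_def)
  qed
  then have "Ck_on k (\<lambda>x. frechet_derivative (h \<circ> g) (at x) v) W" for v
    using D by (subst Ck_on_cong[OF W]) auto
  moreover have "\<forall>x\<in>W. (h \<circ> g) differentiable (at x)" by (intro ballI differentiable_chain_at g h)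
  ultimately show ?case unfolding Ck_on.simps by blast
qed

section \<open>Smoothness of all orders\<close>

lemma smooth_on_cong: "open W \<Longrightarrow> (\<And>y. y \<in> W \<Longrightarrow> g y = h y) \<Longrightarrow> smooth_on g W \<longleftrightarrow> smooth_on h W"
  unfolding smooth_on_def using Ck_on_cong by blast

lemma smooth_on_subset: "smooth_on g W \<Longrightarrow> V \<subseteq> W \<Longrightarrow> smooth_on g V"
  unfolding smooth_on_def using Ck_on_subset by blast

lemma smooth_on_local:
  assumes "\<And>x. x \<in> W \<Longrightarrow> \<exists>V. open V \<and> x \<in> V \<and> smooth_on g V"
  shows "smooth_on g W"
  unfolding smooth_on_def
proof (intro allI Ck_on_local)
  fix k x assume "x \<in> W"
  then show "\<exists>V. open V \<and> x \<in> V \<and> Ck_on k g V" using assms[of x] unfolding smooth_on_def by blast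
qed

lemma smooth_on_differentiable: "smooth_on g W \<Longrightarrow> x \<in> W \<Longrightarrow> g differentiable (at x)"
  unfolding smooth_on_def by (metis Ck_on.simps(2))

lemma smooth_on_continuous: "smooth_on g W \<Longrightarrow> continuous_on W g"
  unfolding smooth_on_def by (metis Ck_on.simps(1))

lemma smooth_on_derivative: "smooth_on g W \<Longrightarrow> smooth_on (\<lambda>x. frechet_derivative g (at x) v) W"
  unfolding smooth_on_def by (metis Ck_on.simps(2))

lemma smooth_on_const: "smooth_on (\<lambda>x. c) W"
  unfolding smooth_on_def using Ck_on_const by blast

lemma smooth_on_bounded_linear: "bounded_linear L \<Longrightarrow> smooth_on L W"
  unfolding smooth_on_def using Ck_on_bounded_linear by blast

lemma smooth_on_linear_compose: "bounded_linear L \<Longrightarrow> open W \<Longrightarrow> smooth_on g W \<Longrightarrow> smooth_on (\<lambda>x. L (g x)) W"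
  unfolding smooth_on_def using Ck_on_linear_compose by blast

lemma smooth_on_bilinear:
  "bounded_bilinear B \<Longrightarrow> open W \<Longrightarrow> smooth_on f W \<Longrightarrow> smooth_on g W \<Longrightarrow> smooth_on (\<lambda>x. B (f x) (g x)) W"
  unfolding smooth_on_def using Ck_on_bilinear by blast

lemma smooth_on_compose:
  fixes g :: "'a::real_normed_vector \<Rightarrow> 'b::euclidean_space"
  shows "open W \<Longrightarrow> open V \<Longrightarrow> g ` W \<subseteq> V \<Longrightarrow> smooth_on g W \<Longrightarrow> smooth_on h V \<Longrightarrow> smooth_on (h \<circ> g) W"
  unfolding smooth_on_def using Ck_on_compose by blast

lemma smooth_on_Pair:
  assumes W: "open W" and f: "smooth_on f W" and g: "smooth_on g W"
  shows "smooth_on (\<lambda>x. (f x, g x)) W"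
proof -
  have l: "bounded_linear (\<lambda>x. (x, 0))" "bounded_linear (\<lambda>y. (0, y))"
    by (auto intro!: bounded_linear_Pair bounded_linear_ident bounded_linear_zero)
  have "Ck_on k (\<lambda>x. (f x, 0) + (0, g x)) W" for k
    using Ck_on_add[OF W Ck_on_linear_compose[OF l(1) W] Ck_on_linear_compose[OF l(2) W]] f g
    unfolding smooth_on_def by blast
  then show ?thesis unfolding smooth_on_def by simp
qed

lemma smooth_on_power:
  fixes W :: "'a::{euclidean_space, real_normed_algebra_1} set"
  assumes W: "open W"
  shows "smooth_on (\<lambda>z. z ^ k) W"
proof (induction k)
  case 0 then show ?case by (simp add: smooth_on_const)
next
  case (Suc k)
  show ?case
    using smooth_on_bilinear[OF bounded_bilinear_mult W smooth_on_bounded_linear[OF bounded_linear_ident] Suc] by simp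
qed

text \<open>The derivative is again a product of inverses, so the product rule carries the
  induction.\<close>

lemma Ck_on_inverse_real: "Ck_on k (inverse :: real \<Rightarrow> real) (-{0})"
proof (induction k)
  case 0 then show ?case by (auto intro!: continuous_intros)
next
  case (Suc k)
  have op: "open (-{0::real})" by auto
  have D: "(inverse has_derivative (\<lambda>v. - (inverse x * v * inverse x))) (at x)" if "x \<noteq> 0" for x :: real
    using has_derivative_inverse'[OF that] by simp
  show ?case
  proof (rule Ck_on_Suc_I[OF op, where D = "\<lambda>x v. inverse x * inverse x * - v"])
    show "(inverse has_derivative (\<lambda>v. inverse x * inverse x * - v)) (at x)" if "x \<in> - {0}" for x :: real
      using D[of x] that by (simp add: mult.commute mult.left_commute)
    show "Ck_on k (\<lambda>x::real. inverse x * inverse x * - v) (-{0})" for v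
      by (intro Ck_on_bilinear[OF bounded_bilinear_mult op] Suc Ck_on_const)
  qed
qed

text \<open>Cramer's rule expresses the derivative of the inverse function by the partial derivatives
  of the function, which makes the induction on the order of differentiability work.\<close>

lemma inverse_function_smooth:
  fixes f :: "real ^ 2 \<Rightarrow> real ^ 2"
  assumes W: "open W" and f: "smooth_on f W" and x0: "x0 \<in> W"
    and inj: "inj (frechet_derivative f (at x0))"
  obtains U V g where "open U" "U \<subseteq> W" "x0 \<in> U" "open V" "homeomorphism U V f g" "smooth_on g V"
    "\<And>x. x \<in> U \<Longrightarrow> bij (frechet_derivative f (at x))"
proof -
  define F where "F = (\<lambda>x. Blinfun (frechet_derivative f (at x)))"
  have bl: "bounded_linear (frechet_derivative f (at x))" if "x \<in> W" for x
    using smooth_on_differentiable[OF f that] frechet_derivative_works has_derivative_bounded_linear by blast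
  have F: "blinfun_apply (F x) = frechet_derivative f (at x)" if "x \<in> W" for x
    unfolding F_def using bl[OF that] by (simp add: bounded_linear_Blinfun_apply)
  have derf: "(f has_derivative blinfun_apply (F x)) (at x)" if "x \<in> W" for x
    using F[OF that] smooth_on_differentiable[OF f that] frechet_derivative_works by metis
  have contf: "continuous_on W F"
  proof (rule continuous_on_blinfun_componentwise)
    fix i :: "real ^ 2"
    have "continuous_on W (\<lambda>x. frechet_derivative f (at x) i)"
      using smooth_on_continuous[OF smooth_on_derivative[OF f]] .
    then show "continuous_on W (\<lambda>x. blinfun_apply (F x) i)" using F by (simp cong: continuous_on_cong)
  qed
  have lin0: "linear (blinfun_apply (F x0))" using F[OF x0] bl[OF x0] bounded_linear.linear by metis
  have "inj (blinfun_apply (F x0))" using inj F x0 by simp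
  then obtain G where G: "linear G" "G \<circ> blinfun_apply (F x0) = id"
    using linear_injective_left_inverse[OF lin0] by blast
  define invf where "invf = Blinfun G"
  have "invf o\<^sub>L F x0 = id_blinfun"
    using G unfolding invf_def
    by (intro blinfun_eqI) (simp add: linear_conv_bounded_linear bounded_linear_Blinfun_apply fun_eq_iff)
  from inverse_function_theorem[OF W derf contf x0 this]
  obtain U V g g' where U: "open U" "U \<subseteq> W" "x0 \<in> U" and V: "open V" "f x0 \<in> V" and hom: "homeomorphism U V f g"
    and g': "\<And>y. y \<in> V \<Longrightarrow> (g has_derivative (g' y)) (at y)"
    "\<And>y. y \<in> V \<Longrightarrow> g' y = inv (blinfun_apply (F (g y)))"
    "\<And>y. y \<in> V \<Longrightarrow> bij (blinfun_apply (F (g y)))"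
    by (metis (no_types, lifting))
  have gV: "g y \<in> U" "f (g y) = y" if "y \<in> V" for y
    using hom that by (auto simp: homeomorphism_def)
  have gf: "f x \<in> V" "g (f x) = x" if "x \<in> U" for x
    using hom that by (auto simp: homeomorphism_def)
  define d where "d = (\<lambda>i x. frechet_derivative f (at x) (Finite_Cartesian_Product.axis i 1 :: real^2))"
  \<comment> \<open>The Jacobian determinant of \<open>f\<close>, whose columns are
    \<open>d 1\<close> and \<open>d 2\<close>.\<close>
  define \<Delta> where "\<Delta> = (\<lambda>x. d 1 x $ 1 * d 2 x $ 2 - d 1 x $ 2 * d 2 x $ 1)"
  have expand: "frechet_derivative f (at x) v = (v$1) *\<^sub>R d 1 x + (v$2) *\<^sub>R d 2 x" if "x \<in> W" for x v
  proof -
    have "v = (v$1) *\<^sub>R Finite_Cartesian_Product.axis 1 1 + (v$2) *\<^sub>R Finite_Cartesian_Product.axis 2 1"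
      by (simp add: vec_eq_iff forall_2 Finite_Cartesian_Product.axis_def)
    then have "frechet_derivative f (at x) v = frechet_derivative f (at x) ((v$1) *\<^sub>R Finite_Cartesian_Product.axis 1 1 + (v$2) *\<^sub>R Finite_Cartesian_Product.axis 2 1)"
      by simp
    also have "\<dots> = (v$1) *\<^sub>R d 1 x + (v$2) *\<^sub>R d 2 x"
      using bl[OF that] unfolding d_def by (simp add: linear_add linear_scale bounded_linear.linear)
    finally show ?thesis .
  qed
  have bijU: "bij (frechet_derivative f (at x))" if "x \<in> U" for x
    using g'(3)[of "f x"] gf[OF that] F U that by auto
  have \<Delta>0: "\<Delta> x \<noteq> 0" if x: "x \<in> U" for x
  proof
    assume "\<Delta> x = 0"
    let ?L = "frechet_derivative f (at x)"
    have xW: "x \<in> W" using x U by blast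
    have inj: "v = 0" if "?L v = 0" for v
    proof -
      have "?L v = ?L 0" using that bl[OF xW] by (simp add: linear_0 bounded_linear.linear)
      then show ?thesis using bijU[OF x] by (metis bij_def injD)
    qed
    \<comment> \<open>The columns of the adjugate matrix: with determinant zero they lie in the
      kernel, and injectivity makes them vanish.\<close>
    have "?L (vector [d 2 x $ 2, - (d 1 x $ 2)]) = 0" "?L (vector [- (d 2 x $ 1), d 1 x $ 1]) = 0"
      unfolding expand[OF xW] using \<open>\<Delta> x = 0\<close> unfolding \<Delta>_def by (auto simp: vec_eq_iff forall_2 algebra_simps)
    then have "vector [d 2 x $ 2, - (d 1 x $ 2)] = (0::real^2)" "vector [- (d 2 x $ 1), d 1 x $ 1] = (0::real^2)"
      using inj by blast+
    then have "d 1 x = 0" by (simp add: vec_eq_iff forall_2)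
    then have "?L (Finite_Cartesian_Product.axis 1 1) = 0" unfolding d_def .
    then have "Finite_Cartesian_Product.axis 1 1 = (0 :: real^2)" using inj by blast
    then show False by (simp add: axis_eq_0_iff)
  qed
  define I where "I = (\<lambda>x (v::real^2). (inverse (\<Delta> x) * (v$1 * d 2 x $ 2 - v$2 * d 2 x $ 1)) *\<^sub>R (Finite_Cartesian_Product.axis 1 1 :: real^2)
      + (inverse (\<Delta> x) * (v$2 * d 1 x $ 1 - v$1 * d 1 x $ 2)) *\<^sub>R Finite_Cartesian_Product.axis 2 1)"
  have gI: "g' y = I (g y)" if y: "y \<in> V" for y
  proof
    fix v :: "real ^ 2"
    let ?L = "frechet_derivative f (at (g y))"
    let ?D = "\<Delta> (g y)" and ?a = "d 1 (g y)" and ?b = "d 2 (g y)"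
    have gU: "g y \<in> U" and gW: "g y \<in> W" using gV[OF y] U by auto
    have D0: "?D \<noteq> 0" by (rule \<Delta>0[OF gU])
    define P where "P = v$1 * ?b$2 - v$2 * ?b$1"
    define Q where "Q = v$2 * ?a$1 - v$1 * ?a$2"
    have PQ: "P * ?a$1 + Q * ?b$1 = ?D * v $ 1" "P * ?a$2 + Q * ?b$2 = ?D * v $ 2"
      unfolding \<Delta>_def P_def Q_def by (simp_all add: algebra_simps)
    have I12: "I (g y) v $ 1 = inverse ?D * P" "I (g y) v $ 2 = inverse ?D * Q"
      unfolding I_def P_def Q_def by (simp_all add: Finite_Cartesian_Product.axis_def)
    have "?L (I (g y) v) $ i = inverse ?D * (P * ?a$i + Q * ?b$i)" for i
      unfolding expand[OF gW] I12 by (simp add: algebra_simps)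
    then have "?L (I (g y) v) $ 1 = v $ 1" "?L (I (g y) v) $ 2 = v $ 2"
      using PQ D0 by simp_all
    then have "?L (I (g y) v) = v" by (simp add: vec_eq_iff forall_2)
    then have "I (g y) v = inv ?L v" using bijU[OF gU] by (metis bij_inv_eq_iff)
    then show "g' y v = I (g y) v" using g'(2)[OF y] F[OF gW] by simp
  qed
  have dsm: "smooth_on (\<lambda>x. d i x $ j) U" for i j
  proof -
    have "smooth_on (d i) U" unfolding d_def using smooth_on_subset[OF smooth_on_derivative[OF f] U(2)] .
    then show ?thesis using smooth_on_linear_compose[OF bounded_linear_vec_nth U(1)] by blast
  qed
  have mult: "smooth_on (\<lambda>x. p x * q x) U" if "smooth_on p U" "smooth_on q U" for p q :: "real^2 \<Rightarrow> real"
    using smooth_on_bilinear[OF bounded_bilinear_mult U(1) that] .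
  have add: "smooth_on (\<lambda>x. p x + q x) U" if "smooth_on p U" "smooth_on q U" for p q :: "real^2 \<Rightarrow> 'z::real_normed_vector"
    using that Ck_on_add[OF U(1)] unfolding smooth_on_def by blast
  have diff: "smooth_on (\<lambda>x. p x - q x) U" if "smooth_on p U" "smooth_on q U" for p q :: "real^2 \<Rightarrow> real"
    using add[OF that(1) mult[OF smooth_on_const[of "-1"] that(2)]] by simp
  have "smooth_on \<Delta> U" unfolding \<Delta>_def by (intro diff mult dsm)
  then have "smooth_on (inverse \<circ> \<Delta>) U"
    using \<Delta>0 Ck_on_inverse_real by (intro smooth_on_compose[OF U(1), of "-{0}"]) (auto simp: smooth_on_def)
  then have inv\<Delta>: "smooth_on (\<lambda>x. inverse (\<Delta> x)) U" by (simp add: o_def)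
  have Ism: "smooth_on (\<lambda>x. I x v) U" for v
    unfolding I_def
    by (intro add smooth_on_bilinear[OF bounded_bilinear_scaleR U(1)] mult diff dsm inv\<Delta> smooth_on_const)
  \<comment> \<open>The inverse satisfies the equation \<open>g' y = I (g y)\<close> with smooth
    \<open>I\<close>, so each order of differentiability of \<open>g\<close> gives the next
    one.\<close>
  have gsm: "Ck_on k g V" for k
  proof (induction k)
    case 0 then show ?case using hom by (simp add: homeomorphism_def)
  next
    case (Suc k)
    show ?case
    proof (rule Ck_on_Suc_I[OF V(1)])
      show "(g has_derivative I (g y)) (at y)" if "y \<in> V" for y using g'(1)[OF that] gI[OF that] by simp
      have "Ck_on k ((\<lambda>x. I x v) \<circ> g) V" for v
        using Ism[of v] gV by (intro Ck_on_compose[OF V(1) U(1) _ Suc]) (auto simp: smooth_on_def)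
      then show "Ck_on k (\<lambda>y. I (g y) v) V" for v by (simp add: o_def)
    qed
  qed
  show thesis
    by (rule that[OF U V(1) hom _ bijU]) (use gsm in \<open>auto simp: smooth_on_def\<close>)
qed

section \<open>Charts and derivatives\<close>

lemma topological_chart_facts:
  assumes "topological_chart X U \<phi>"
  shows "openin X U" "U \<subseteq> topspace X" "inj_on \<phi> U" "open (\<phi> ` U)"
    "continuous_map (subtopology X U) euclidean \<phi>"
    "continuous_map (top_of_set (\<phi> ` U)) X (inv_into U \<phi>)"
    "\<And>A. openin X A \<Longrightarrow> A \<subseteq> U \<Longrightarrow> open (\<phi> ` A)"
    "\<And>G. open G \<Longrightarrow> openin X {x \<in> U. \<phi> x \<in> G}"
proof -
  have U: "openin X U" and o: "open (\<phi> ` U)" and h: "homeomorphic_map (subtopology X U) (top_of_set (\<phi> ` U)) \<phi>"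
    using assms unfolding topological_chart_def by auto
  show "openin X U" "open (\<phi> ` U)" by (rule U, rule o)
  show UX: "U \<subseteq> topspace X" using openin_subset[OF U] .
  have tU: "topspace (subtopology X U) = U" using UX by auto
  show inj: "inj_on \<phi> U" using homeomorphic_imp_injective_map[OF h] tU by simp
  show c: "continuous_map (subtopology X U) euclidean \<phi>"
    using homeomorphic_imp_continuous_map[OF h] by (simp add: continuous_map_in_subtopology)
  obtain g where g: "homeomorphic_maps (subtopology X U) (top_of_set (\<phi> ` U)) \<phi> g"
    using h homeomorphic_map_maps by blast
  have "g w = inv_into U \<phi> w" if "w \<in> \<phi> ` U" for w
  proof -
    from that obtain x where x: "x \<in> U" "w = \<phi> x" by blast
    then show ?thesis using g tU inj unfolding homeomorphic_maps_def by simp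
  qed
  moreover have "continuous_map (top_of_set (\<phi> ` U)) X g"
    using g unfolding homeomorphic_maps_def by (simp add: continuous_map_in_subtopology)
  ultimately show "continuous_map (top_of_set (\<phi> ` U)) X (inv_into U \<phi>)"
    by (metis continuous_map_eq topspace_euclidean_subtopology)
  show "open (\<phi> ` A)" if "openin X A" "A \<subseteq> U" for A
  proof -
    have "openin (subtopology X U) A" using that openin_open_subtopology[OF U] by simp
    then have "openin (top_of_set (\<phi> ` U)) (\<phi> ` A)"
      using homeomorphic_imp_open_map[OF h] unfolding open_map_def by simp
    then show ?thesis using o openin_open_trans by blast
  qed
  show "openin X {x \<in> U. \<phi> x \<in> G}" if "open G" for G
  proof -
    have "openin (subtopology X U) {x \<in> topspace (subtopology X U). \<phi> x \<in> G}"
      using openin_continuous_map_preimage[OF c] that by simp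
    then have "openin X {x \<in> topspace (subtopology X U). \<phi> x \<in> G}" by (rule openin_trans_full[OF _ U])
    then show ?thesis unfolding tU .
  qed
qed

lemma smooth_chart_topological: "smooth_chart M U \<phi> \<Longrightarrow> topological_chart (mtop M) U \<phi>"
  by (simp add: smooth_chart_def)

lemma atlas_smooth_chart: "smooth_manifold M \<Longrightarrow> (U, \<phi>) \<in> atlas M \<Longrightarrow> smooth_chart M U \<phi>"
  unfolding smooth_manifold_def smooth_chart_def by (fastforce simp: Int_commute)

lemma atlas_chart_at:
  assumes "smooth_manifold M" "x \<in> points M"
  obtains U \<phi> where "(U, \<phi>) \<in> atlas M" "x \<in> U"
  using assms unfolding smooth_manifold_def by blast

lemma atlas_openin: "smooth_manifold M \<Longrightarrow> (V, \<psi>) \<in> atlas M \<Longrightarrow> openin (mtop M) V"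
  unfolding smooth_manifold_def topological_chart_def by auto

text \<open>Smooth parametrizations of pieces of a manifold. Chart inverses, \<open>f\<close>,
  \<open>p\<close> and local inverses of \<open>p\<close> can be composed in this form without a
  manifold structure on the Euclidean source.\<close>

definition smooth_into :: "('a, 'e::euclidean_space) mfd \<Rightarrow> 'w::euclidean_space set \<Rightarrow> ('w \<Rightarrow> 'a) \<Rightarrow> bool" where
  "smooth_into M D \<sigma> \<longleftrightarrow> continuous_map (top_of_set D) (mtop M) \<sigma> \<and>
     (\<forall>(V, \<psi>)\<in>atlas M. smooth_on (\<psi> \<circ> \<sigma>) {w \<in> D. \<sigma> w \<in> V})"

lemma smooth_into_continuous: "smooth_into M D \<sigma> \<Longrightarrow> continuous_map (top_of_set D) (mtop M) \<sigma>"
  unfolding smooth_into_def by (rule conjunct1)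

lemma smooth_into_atlas:
  "smooth_into M D \<sigma> \<Longrightarrow> (V, \<psi>) \<in> atlas M \<Longrightarrow> smooth_on (\<psi> \<circ> \<sigma>) {w \<in> D. \<sigma> w \<in> V}"
  unfolding smooth_into_def by auto

lemma smooth_into_open_preimage:
  assumes "open D" "smooth_into M D \<sigma>" "openin (mtop M) V"
  shows "open {w \<in> D. \<sigma> w \<in> V}"
proof -
  have "openin (top_of_set D) {w \<in> topspace (top_of_set D). \<sigma> w \<in> V}"
    using assms(2,3) unfolding smooth_into_def by (intro openin_continuous_map_preimage) auto
  then show ?thesis using assms(1) openin_open_trans by simp
qed

lemma smooth_into_points: "smooth_into M D \<sigma> \<Longrightarrow> w \<in> D \<Longrightarrow> \<sigma> w \<in> points M"
  unfolding smooth_into_def continuous_map_def by auto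

text \<open>Passes from the charts of the atlas to arbitrary compatible ones, among them slice
  charts with values in \<open>complex \<times> real\<close>.\<close>

lemma smooth_into_chart:
  assumes M: "smooth_manifold M" and D: "open D" and \<sigma>: "smooth_into M D \<sigma>" and V: "smooth_chart M V \<psi>"
  shows "smooth_on (\<psi> \<circ> \<sigma>) {w \<in> D. \<sigma> w \<in> V}"
proof (rule smooth_on_local)
  fix w assume w: "w \<in> {w \<in> D. \<sigma> w \<in> V}"
  obtain W \<eta> where W: "(W, \<eta>) \<in> atlas M" "\<sigma> w \<in> W"
    using atlas_chart_at[OF M smooth_into_points[OF \<sigma>]] w by blast
  have cW: "smooth_chart M W \<eta>" by (rule atlas_smooth_chart[OF M W(1)])
  note tW = topological_chart_facts[OF smooth_chart_topological[OF cW]]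
  note tV = topological_chart_facts[OF smooth_chart_topological[OF V]]
  let ?G = "{w \<in> D. \<sigma> w \<in> V \<inter> W}"
  have oVW: "openin (mtop M) (V \<inter> W)" using tV(1) tW(1) by blast
  have oG: "open ?G" by (rule smooth_into_open_preimage[OF D \<sigma> oVW])
  have 1: "smooth_on (\<eta> \<circ> \<sigma>) ?G"
    using \<sigma> W(1) unfolding smooth_into_def by (auto elim: smooth_on_subset)
  have 2: "smooth_on (\<psi> \<circ> inv_into W \<eta>) (\<eta> ` (V \<inter> W))"
    using V W(1) unfolding smooth_chart_def by auto
  have "smooth_on ((\<psi> \<circ> inv_into W \<eta>) \<circ> (\<eta> \<circ> \<sigma>)) ?G"
    by (rule smooth_on_compose[OF oG tW(7)[OF oVW] _ 1 2]) auto
  then have "smooth_on (\<psi> \<circ> \<sigma>) ?G"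
    by (subst smooth_on_cong[OF oG, of _ "(\<psi> \<circ> inv_into W \<eta>) \<circ> (\<eta> \<circ> \<sigma>)"]) (auto simp: tW(3))
  then show "\<exists>G. open G \<and> w \<in> G \<and> smooth_on (\<psi> \<circ> \<sigma>) G" using oG w W by blast
qed

lemma smooth_into_subset:
  assumes \<sigma>: "smooth_into M D \<sigma>" and D': "D' \<subseteq> D"
  shows "smooth_into M D' \<sigma>"
  unfolding smooth_into_def
proof (intro conjI ballI, safe)
  show "continuous_map (top_of_set D') (mtop M) \<sigma>"
    by (rule continuous_map_from_subtopology_mono[OF smooth_into_continuous[OF \<sigma>] D'])
  fix V \<psi> assume "(V, \<psi>) \<in> atlas M"
  then have "smooth_on (\<psi> \<circ> \<sigma>) {w \<in> D. \<sigma> w \<in> V}"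
    by (rule smooth_into_atlas[OF \<sigma>])
  then show "smooth_on (\<psi> \<circ> \<sigma>) {w \<in> D'. \<sigma> w \<in> V}" by (rule smooth_on_subset) (use D' in auto)
qed

lemma smooth_into_cong:
  assumes "open D" "smooth_manifold M" "smooth_into M D \<sigma>" "\<And>w. w \<in> D \<Longrightarrow> \<sigma> w = \<tau> w"
  shows "smooth_into M D \<tau>"
  unfolding smooth_into_def
proof (intro conjI ballI, safe)
  show "continuous_map (top_of_set D) (mtop M) \<tau>"
    by (rule continuous_map_eq[OF smooth_into_continuous[OF assms(3)]]) (use assms(4) in simp)
  fix V \<psi> assume V: "(V, \<psi>) \<in> atlas M"
  have e: "{w \<in> D. \<tau> w \<in> V} = {w \<in> D. \<sigma> w \<in> V}" using assms(4) by auto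
  have "open {w \<in> D. \<sigma> w \<in> V}"
    by (rule smooth_into_open_preimage[OF assms(1,3) atlas_openin[OF assms(2) V]])
  moreover have "smooth_on (\<psi> \<circ> \<sigma>) {w \<in> D. \<sigma> w \<in> V}" by (rule smooth_into_atlas[OF assms(3) V])
  ultimately show "smooth_on (\<psi> \<circ> \<tau>) {w \<in> D. \<tau> w \<in> V}"
    unfolding e using smooth_on_cong[of "{w \<in> D. \<sigma> w \<in> V}" "\<psi> \<circ> \<sigma>" "\<psi> \<circ> \<tau>"] assms(4) by auto
qed

lemma smooth_into_compose:
  assumes D: "open D" "open D'" and M: "smooth_manifold M" and \<sigma>: "smooth_into M D \<sigma>"
    and g: "smooth_on g D'" "g ` D' \<subseteq> D"
  shows "smooth_into M D' (\<sigma> \<circ> g)"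
  unfolding smooth_into_def
proof (intro conjI ballI, safe)
  have "continuous_map (top_of_set D') (top_of_set D) g"
    using smooth_on_continuous[OF g(1)] g(2) by auto
  then show "continuous_map (top_of_set D') (mtop M) (\<sigma> \<circ> g)"
    by (rule continuous_map_compose) (rule smooth_into_continuous[OF \<sigma>])
  fix V \<psi> assume V: "(V, \<psi>) \<in> atlas M"
  have oV: "openin (mtop M) V" by (rule atlas_openin[OF M V])
  let ?G = "{w \<in> D. \<sigma> w \<in> V}" and ?G' = "{w \<in> D'. (\<sigma> \<circ> g) w \<in> V}"
  have oG: "open ?G" by (rule smooth_into_open_preimage[OF D(1) \<sigma> oV])
  have "?G' = D' \<inter> g -` ?G" using g by auto
  then have oG': "open ?G'"
    using continuous_open_preimage[OF smooth_on_continuous[OF g(1)] D(2) oG] by simp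
  have "smooth_on ((\<psi> \<circ> \<sigma>) \<circ> g) ?G'"
  proof (rule smooth_on_compose[OF oG' oG])
    show "smooth_on g ?G'" by (rule smooth_on_subset[OF g(1)]) auto
    show "smooth_on (\<psi> \<circ> \<sigma>) ?G" by (rule smooth_into_atlas[OF \<sigma> V])
  qed (use g in auto)
  then show "smooth_on (\<psi> \<circ> (\<sigma> \<circ> g)) ?G'" by (simp add: o_assoc)
qed

lemma smooth_into_smooth_map:
  assumes M: "smooth_manifold M" and N: "smooth_manifold N" and f: "smooth_map_on M W N f"
    and D: "open D" and \<sigma>: "smooth_into M D \<sigma>" "\<sigma> ` D \<subseteq> W"
  shows "smooth_into N D (f \<circ> \<sigma>)"
  unfolding smooth_into_def
proof (intro conjI ballI, safe)
  have W: "openin (mtop M) W" and cf: "continuous_map (subtopology (mtop M) W) (mtop N) f"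
    using f unfolding smooth_map_on_def by auto
  have c\<sigma>: "continuous_map (top_of_set D) (subtopology (mtop M) W) \<sigma>"
    using \<sigma> unfolding smooth_into_def continuous_map_in_subtopology by auto
  show c: "continuous_map (top_of_set D) (mtop N) (f \<circ> \<sigma>)"
    by (rule continuous_map_compose[OF c\<sigma> cf])
  fix V \<psi> assume V: "(V, \<psi>) \<in> atlas N"
  have oV: "openin (mtop N) V" by (rule atlas_openin[OF N V])
  show "smooth_on (\<psi> \<circ> (f \<circ> \<sigma>)) {w \<in> D. (f \<circ> \<sigma>) w \<in> V}"
  proof (rule smooth_on_local)
    fix w assume w: "w \<in> {w \<in> D. (f \<circ> \<sigma>) w \<in> V}"
    obtain U \<phi> where U: "(U, \<phi>) \<in> atlas M" "\<sigma> w \<in> U"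
      using atlas_chart_at[OF M smooth_into_points[OF \<sigma>(1)]] w by blast
    note tU = topological_chart_facts[OF smooth_chart_topological[OF atlas_smooth_chart[OF M U(1)]]]
    let ?A = "{x \<in> U \<inter> W. f x \<in> V}"
    have "openin (subtopology (mtop M) W) {x \<in> topspace (subtopology (mtop M) W). f x \<in> V}"
      using openin_continuous_map_preimage[OF cf oV] .
    then have "openin (mtop M) {x \<in> topspace (subtopology (mtop M) W). f x \<in> V}"
      using openin_trans_full[OF _ W] by blast
    then have "openin (mtop M) (U \<inter> {x \<in> topspace (subtopology (mtop M) W). f x \<in> V})"
      by (rule openin_Int[OF tU(1)])
    moreover have "U \<inter> {x \<in> topspace (subtopology (mtop M) W). f x \<in> V} = ?A" using tU(2) by auto
    ultimately have oA: "openin (mtop M) ?A" by simp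
    let ?G = "{w \<in> D. \<sigma> w \<in> ?A}"
    have oG: "open ?G" by (rule smooth_into_open_preimage[OF D \<sigma>(1) oA])
    have 1: "smooth_on (\<phi> \<circ> \<sigma>) ?G"
      using \<sigma> U(1) unfolding smooth_into_def by (auto elim: smooth_on_subset)
    have 2: "smooth_on (\<psi> \<circ> f \<circ> inv_into U \<phi>) (\<phi> ` ?A)"
      using f U V unfolding smooth_map_on_def by auto
    have oA': "open (\<phi> ` ?A)" by (rule tU(7)[OF oA]) auto
    have "smooth_on ((\<psi> \<circ> f \<circ> inv_into U \<phi>) \<circ> (\<phi> \<circ> \<sigma>)) ?G"
      by (rule smooth_on_compose[OF oG oA' _ 1 2]) auto
    then have "smooth_on (\<psi> \<circ> (f \<circ> \<sigma>)) ?G"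
      by (subst smooth_on_cong[OF oG, of _ "(\<psi> \<circ> f \<circ> inv_into U \<phi>) \<circ> (\<phi> \<circ> \<sigma>)"]) (auto simp: tU(3))
    moreover have "w \<in> ?G" using w U \<sigma> by auto
    ultimately show "\<exists>G. open G \<and> w \<in> G \<and> smooth_on (\<psi> \<circ> (f \<circ> \<sigma>)) G" using oG by blast
  qed
qed

lemma smooth_into_chart_inverse:
  assumes U: "smooth_chart M U \<phi>"
  shows "smooth_into M (\<phi> ` U) (inv_into U \<phi>)"
  unfolding smooth_into_def
proof (intro conjI ballI, safe)
  note tU = topological_chart_facts[OF smooth_chart_topological[OF U]]
  show "continuous_map (top_of_set (\<phi> ` U)) (mtop M) (inv_into U \<phi>)" by (rule tU(6))
  fix V \<psi> assume V: "(V, \<psi>) \<in> atlas M"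
  have "{w \<in> \<phi> ` U. inv_into U \<phi> w \<in> V} = \<phi> ` (U \<inter> V)" using tU(3) by auto
  then show "smooth_on (\<psi> \<circ> inv_into U \<phi>) {w \<in> \<phi> ` U. inv_into U \<phi> w \<in> V}"
    using U V unfolding smooth_chart_def by auto
qed

lemma smooth_chart_transition:
  assumes M: "smooth_manifold M" and U: "smooth_chart M U \<phi>" and V: "smooth_chart M V \<psi>"
  shows "smooth_on (\<psi> \<circ> inv_into U \<phi>) (\<phi> ` (U \<inter> V))"
proof -
  note tU = topological_chart_facts[OF smooth_chart_topological[OF U]]
  have "{w \<in> \<phi> ` U. inv_into U \<phi> w \<in> V} = \<phi> ` (U \<inter> V)" using tU(3) by auto
  then show ?thesis using smooth_into_chart[OF M tU(4) smooth_into_chart_inverse[OF U] V] by simp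
qed

lemma smooth_map_on_charts:
  assumes M: "smooth_manifold M" and N: "smooth_manifold N" and f: "smooth_map_on M W N f"
    and U: "smooth_chart M U \<phi>" and V: "smooth_chart N V \<psi>"
  shows "smooth_on (\<psi> \<circ> f \<circ> inv_into U \<phi>) (\<phi> ` {x \<in> U \<inter> W. f x \<in> V})"
proof -
  note tU = topological_chart_facts[OF smooth_chart_topological[OF U]]
  have W: "openin (mtop M) W" using f unfolding smooth_map_on_def by auto
  have oUW: "open (\<phi> ` (U \<inter> W))" by (rule tU(7)) (use tU(1) W in auto)
  have 1: "smooth_into M (\<phi> ` (U \<inter> W)) (inv_into U \<phi>)"
    by (rule smooth_into_subset[OF smooth_into_chart_inverse[OF U]]) auto
  have 2: "smooth_into N (\<phi> ` (U \<inter> W)) (f \<circ> inv_into U \<phi>)"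
    by (rule smooth_into_smooth_map[OF M N f oUW 1]) (use tU(3) in auto)
  have "{w \<in> \<phi> ` (U \<inter> W). (f \<circ> inv_into U \<phi>) w \<in> V} = \<phi> ` {x \<in> U \<inter> W. f x \<in> V}" using tU(3) by auto
  then show ?thesis using smooth_into_chart[OF N oUW 2 V] by (simp add: o_assoc)
qed

section \<open>Derivatives read in charts\<close>

lemma smooth_into_chart_differentiable:
  assumes M: "smooth_manifold M" and D: "open D" and \<sigma>: "smooth_into M D \<sigma>" and V: "smooth_chart M V \<psi>"
    and w: "w \<in> D" "\<sigma> w \<in> V"
  shows "(\<psi> \<circ> \<sigma>) differentiable (at w)"
  using smooth_on_differentiable[OF smooth_into_chart[OF M D \<sigma> V]] w by blast

text \<open>The chain rule with a chart inserted. Here \<open>F\<close> may be another chart, or a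
  chart preceded by \<open>f\<close> or \<open>p\<close>; the later comparisons of derivatives on
  manifolds are instances.\<close>

lemma frechet_derivative_through_chart:
  assumes M: "smooth_manifold M" and D: "open D" and \<sigma>: "smooth_into M D \<sigma>" and U: "smooth_chart M U \<phi>"
    and w: "w \<in> D" "\<sigma> w \<in> U" and F: "(F \<circ> inv_into U \<phi>) differentiable (at (\<phi> (\<sigma> w)))"
  shows "frechet_derivative (F \<circ> \<sigma>) (at w) =
     frechet_derivative (F \<circ> inv_into U \<phi>) (at (\<phi> (\<sigma> w))) \<circ> frechet_derivative (\<phi> \<circ> \<sigma>) (at w)"
proof -
  note tU = topological_chart_facts[OF smooth_chart_topological[OF U]]
  have oG: "open {w \<in> D. \<sigma> w \<in> U}" by (rule smooth_into_open_preimage[OF D \<sigma> tU(1)])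
  have "frechet_derivative (F \<circ> \<sigma>) (at w) = frechet_derivative ((F \<circ> inv_into U \<phi>) \<circ> (\<phi> \<circ> \<sigma>)) (at w)"
    by (rule frechet_derivative_cong_open(1)[OF oG]) (use w tU(3) in auto)
  also have "\<dots> = frechet_derivative (F \<circ> inv_into U \<phi>) (at ((\<phi> \<circ> \<sigma>) w)) \<circ> frechet_derivative (\<phi> \<circ> \<sigma>) (at w)"
    by (rule frechet_derivative_compose) (use smooth_into_chart_differentiable[OF M D \<sigma> U w] F in auto)
  finally show ?thesis by simp
qed

lemma frechet_derivative_chart_self:
  assumes "topological_chart X U \<phi>" "x \<in> U"
  shows "frechet_derivative (\<phi> \<circ> inv_into U \<phi>) (at (\<phi> x)) = id"
proof -
  note tU = topological_chart_facts[OF assms(1)]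
  have "frechet_derivative (\<phi> \<circ> inv_into U \<phi>) (at (\<phi> x)) = frechet_derivative id (at (\<phi> x))"
    by (rule frechet_derivative_cong_open(1)[OF tU(4)]) (use assms in \<open>auto simp: f_inv_into_f\<close>)
  then show ?thesis using frechet_derivative_id by (simp add: id_def)
qed

lemma frechet_derivative_transition_inverse:
  assumes M: "smooth_manifold M" and U: "smooth_chart M U \<phi>" and V: "smooth_chart M V \<psi>" and x: "x \<in> U" "x \<in> V"
  shows "frechet_derivative (\<phi> \<circ> inv_into V \<psi>) (at (\<psi> x)) \<circ> frechet_derivative (\<psi> \<circ> inv_into U \<phi>) (at (\<phi> x)) = id"
proof -
  note tU = topological_chart_facts[OF smooth_chart_topological[OF U]]
  have d: "(\<phi> \<circ> inv_into V \<psi>) differentiable (at (\<psi> (inv_into U \<phi> (\<phi> x))))"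
    using smooth_on_differentiable[OF smooth_chart_transition[OF M V U]] x tU(3) by auto
  have "frechet_derivative (\<phi> \<circ> inv_into U \<phi>) (at (\<phi> x)) =
     frechet_derivative (\<phi> \<circ> inv_into V \<psi>) (at (\<psi> (inv_into U \<phi> (\<phi> x)))) \<circ> frechet_derivative (\<psi> \<circ> inv_into U \<phi>) (at (\<phi> x))"
    by (rule frechet_derivative_through_chart[OF M tU(4) smooth_into_chart_inverse[OF U] V _ _ d])
      (use x tU(3) in auto)
  then show ?thesis using frechet_derivative_chart_self[OF smooth_chart_topological[OF U] x(1)] x tU(3) by simp
qed

lemma bij_frechet_derivative_transition:
  assumes "smooth_manifold M" "smooth_chart M U \<phi>" "smooth_chart M V \<psi>" "x \<in> U" "x \<in> V"
  shows "bij (frechet_derivative (\<psi> \<circ> inv_into U \<phi>) (at (\<phi> x)))"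
  using frechet_derivative_transition_inverse[OF assms] frechet_derivative_transition_inverse[OF assms(1,3,2,5,4)]
  using o_bij by blast

text \<open>Chart changes have surjective derivatives, so all members of the union in
  \<open>tangent_image\<close> coincide, and any compatible chart computes it.\<close>

lemma tangent_image_eq:
  assumes S: "smooth_manifold S" and U: "smooth_chart S U \<phi>" "s \<in> U"
    and d: "(\<psi> \<circ> f \<circ> inv_into U \<phi>) differentiable (at (\<phi> s))"
  shows "tangent_image S f \<psi> s = range (frechet_derivative (\<psi> \<circ> f \<circ> inv_into U \<phi>) (at (\<phi> s)))"
proof -
  let ?R = "range (frechet_derivative (\<psi> \<circ> f \<circ> inv_into U \<phi>) (at (\<phi> s)))"
  have *: "range (frechet_derivative (\<psi> \<circ> f \<circ> inv_into A \<alpha>) (at (\<alpha> s))) =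
      range (frechet_derivative (\<psi> \<circ> f \<circ> inv_into U \<phi>) (at (\<phi> s)))" if A: "(A, \<alpha>) \<in> atlas S" "s \<in> A" for A \<alpha>
  proof -
    have cA: "smooth_chart S A \<alpha>" by (rule atlas_smooth_chart[OF S A(1)])
    note tA = topological_chart_facts[OF smooth_chart_topological[OF cA]]
    have i: "inv_into A \<alpha> (\<alpha> s) = s" using A tA(3) by simp
    have eq: "frechet_derivative ((\<psi> \<circ> f) \<circ> inv_into A \<alpha>) (at (\<alpha> s)) =
       frechet_derivative ((\<psi> \<circ> f) \<circ> inv_into U \<phi>) (at (\<phi> (inv_into A \<alpha> (\<alpha> s)))) \<circ> frechet_derivative (\<phi> \<circ> inv_into A \<alpha>) (at (\<alpha> s))"
      by (rule frechet_derivative_through_chart[OF S tA(4) smooth_into_chart_inverse[OF cA] U(1)])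
        (use A U d i in auto)
    have "surj (frechet_derivative (\<phi> \<circ> inv_into A \<alpha>) (at (\<alpha> s)))"
      using bij_frechet_derivative_transition[OF S cA U(1) A(2) U(2)] bij_is_surj by blast
    note surj = this
    from eq have "range (frechet_derivative (\<psi> \<circ> f \<circ> inv_into A \<alpha>) (at (\<alpha> s))) =
       frechet_derivative (\<psi> \<circ> f \<circ> inv_into U \<phi>) (at (\<phi> s)) ` range (frechet_derivative (\<phi> \<circ> inv_into A \<alpha>) (at (\<alpha> s)))"
      unfolding i by (simp only: image_comp)
    then show ?thesis using surj by simp
  qed
  have sS: "s \<in> points S" using U topological_chart_facts(2)[OF smooth_chart_topological[OF U(1)]] by auto
  obtain A \<alpha> where A: "(A, \<alpha>) \<in> atlas S" "s \<in> A" by (rule atlas_chart_at[OF S sS])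
  have "tangent_image S f \<psi> s = (\<Union>(U, \<phi>)\<in>{(U, \<phi>)\<in>atlas S. s \<in> U}. ?R)"
    unfolding tangent_image_def
  proof (rule SUP_cong[OF refl])
    fix x assume x: "x \<in> {(U, \<phi>)\<in>atlas S. s \<in> U}"
    obtain A \<alpha> where xA: "x = (A, \<alpha>)" by (cases x)
    have "range (frechet_derivative (\<psi> \<circ> f \<circ> inv_into A \<alpha>) (at (\<alpha> s))) = ?R"
      by (rule *) (use x xA in auto)
    then show "(case x of (U, \<phi>) \<Rightarrow> range (frechet_derivative (\<psi> \<circ> f \<circ> inv_into U \<phi>) (at (\<phi> s)))) =
       (case x of (U, \<phi>') \<Rightarrow> ?R)" unfolding xA by simp
  qed
  also have "\<dots> = ?R" using A by auto
  finally show ?thesis .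
qed

lemma smooth_map_on_chart_differentiable:
  assumes M: "smooth_manifold M" and N: "smooth_manifold N" and f: "smooth_map_on M W N f"
    and U: "smooth_chart M U \<phi>" and V: "smooth_chart N V \<psi>" and x: "x \<in> U" "x \<in> W" "f x \<in> V"
  shows "(\<psi> \<circ> f \<circ> inv_into U \<phi>) differentiable (at (\<phi> x))"
  by (rule smooth_on_differentiable[OF smooth_map_on_charts[OF M N f U V]]) (use x in auto)

lemma frechet_derivative_smooth_map:
  assumes M: "smooth_manifold M" and N: "smooth_manifold N" and f: "smooth_map_on M W N f"
    and U: "smooth_chart M U \<phi>" and V: "smooth_chart N V \<psi>"
    and D: "open D" and \<sigma>: "smooth_into M D \<sigma>"
    and w: "w \<in> D" "\<sigma> w \<in> U" "\<sigma> w \<in> W" "f (\<sigma> w) \<in> V"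
  shows "frechet_derivative (\<psi> \<circ> f \<circ> \<sigma>) (at w) =
     frechet_derivative (\<psi> \<circ> f \<circ> inv_into U \<phi>) (at (\<phi> (\<sigma> w))) \<circ> frechet_derivative (\<phi> \<circ> \<sigma>) (at w)"
  by (rule frechet_derivative_through_chart[OF M D \<sigma> U w(1,2)])
    (rule smooth_map_on_chart_differentiable[OF M N f U V w(2-4)])

text \<open>On the side of \<open>S\<close> a chart change has bijective derivative. On the side of
  \<open>M\<close> it suffices that the map applied first in an injective composite is
  injective.\<close>

lemma immersion_charts:
  assumes S: "smooth_manifold S" and M: "smooth_manifold M" and f: "immersion S M f"
    and U: "smooth_chart S U \<phi>" and V: "smooth_chart M V \<psi>" and s: "s \<in> U" "f s \<in> V"
  shows "inj (frechet_derivative (\<psi> \<circ> f \<circ> inv_into U \<phi>) (at (\<phi> s)))"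
proof -
  have fs: "smooth_map_on S (points S) M f" using f unfolding immersion_def by blast
  note tU = topological_chart_facts[OF smooth_chart_topological[OF U]]
  note tV = topological_chart_facts[OF smooth_chart_topological[OF V]]
  have sS: "s \<in> points S" and fM: "f s \<in> points M" using s tU(2) tV(2) by auto
  obtain A \<alpha> where A: "(A, \<alpha>) \<in> atlas S" "s \<in> A" by (rule atlas_chart_at[OF S sS])
  obtain B \<beta> where B: "(B, \<beta>) \<in> atlas M" "f s \<in> B" by (rule atlas_chart_at[OF M fM])
  have cA: "smooth_chart S A \<alpha>" and cB: "smooth_chart M B \<beta>" using atlas_smooth_chart S M A B by blast+
  have i: "inv_into U \<phi> (\<phi> s) = s" using s tU(3) by simp
  have inj0: "inj (frechet_derivative (\<beta> \<circ> f \<circ> inv_into A \<alpha>) (at (\<alpha> s)))"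
    using f A B unfolding immersion_def by blast
  have "frechet_derivative (\<beta> \<circ> f \<circ> inv_into U \<phi>) (at (\<phi> s)) =
     frechet_derivative (\<beta> \<circ> f \<circ> inv_into A \<alpha>) (at (\<alpha> (inv_into U \<phi> (\<phi> s)))) \<circ> frechet_derivative (\<alpha> \<circ> inv_into U \<phi>) (at (\<phi> s))"
    by (rule frechet_derivative_smooth_map[OF S M fs cA cB tU(4) smooth_into_chart_inverse[OF U]])
      (use s A B i sS in auto)
  moreover have "inj (frechet_derivative (\<alpha> \<circ> inv_into U \<phi>) (at (\<phi> s)))"
    using bij_frechet_derivative_transition[OF S U cA s(1) A(2)] bij_is_inj by blast
  ultimately have inj1: "inj (frechet_derivative (\<beta> \<circ> f \<circ> inv_into U \<phi>) (at (\<phi> s)))"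
    using inj0 unfolding i by (simp add: inj_compose)
  have sf: "smooth_into M (\<phi> ` U) (f \<circ> inv_into U \<phi>)"
    by (rule smooth_into_smooth_map[OF S M fs tU(4) smooth_into_chart_inverse[OF U]])
      (use tU(2,3) in auto)
  have d: "(\<beta> \<circ> inv_into V \<psi>) differentiable (at (\<psi> ((f \<circ> inv_into U \<phi>) (\<phi> s))))"
    using smooth_on_differentiable[OF smooth_chart_transition[OF M V cB]] s B i by auto
  have "frechet_derivative (\<beta> \<circ> (f \<circ> inv_into U \<phi>)) (at (\<phi> s)) =
     frechet_derivative (\<beta> \<circ> inv_into V \<psi>) (at (\<psi> ((f \<circ> inv_into U \<phi>) (\<phi> s)))) \<circ> frechet_derivative (\<psi> \<circ> (f \<circ> inv_into U \<phi>)) (at (\<phi> s))"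
    by (rule frechet_derivative_through_chart[OF M tU(4) sf V _ _ d]) (use s i in auto)
  then have "inj (frechet_derivative (\<beta> \<circ> inv_into V \<psi>) (at (\<psi> (f s))) \<circ> frechet_derivative (\<psi> \<circ> f \<circ> inv_into U \<phi>) (at (\<phi> s)))"
    using inj1 i by (simp add: o_assoc)
  then show ?thesis using inj_on_imageI2 by blast
qed

lemma det_matrix_compose:
  fixes A B :: "real ^ 'n \<Rightarrow> real ^ 'n"
  assumes "linear A" "linear B"
  shows "det (matrix (A \<circ> B)) = det (matrix A) * det (matrix B)"
  using matrix_compose[OF assms(2,1)] det_mul by metis

section \<open>Projection along the branching set\<close>

text \<open>For \<open>\<epsilon> = 1\<close> or \<open>\<epsilon> = -1\<close> an identification of
  the complex plane with \<open>real ^ 2\<close>. The sign allows a projection to the complex plane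
  to be matched with a given orientation of the surface.\<close>

definition plane_of :: "real \<Rightarrow> complex \<Rightarrow> real ^ 2" where
  "plane_of \<epsilon> z = vector [Re z, \<epsilon> * Im z]"

definition complex_of_plane :: "real \<Rightarrow> real ^ 2 \<Rightarrow> complex" where
  "complex_of_plane \<epsilon> v = Complex (v $ 1) (\<epsilon> * v $ 2)"

lemma plane_inverse:
  assumes "\<epsilon> * \<epsilon> = 1"
  shows "complex_of_plane \<epsilon> (plane_of \<epsilon> z) = z" "plane_of \<epsilon> (complex_of_plane \<epsilon> v) = v"
proof -
  have e: "\<epsilon> * (\<epsilon> * x) = x" for x using assms by (simp flip: mult.assoc)
  show "complex_of_plane \<epsilon> (plane_of \<epsilon> z) = z" "plane_of \<epsilon> (complex_of_plane \<epsilon> v) = v"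
    unfolding complex_of_plane_def plane_of_def using e by (simp_all add: vec_eq_iff forall_2 complex_eq_iff)
qed

lemma bounded_linear_plane_of: "bounded_linear (plane_of \<epsilon>)"
  unfolding linear_conv_bounded_linear[symmetric]
  by (intro linearI) (simp_all add: plane_of_def vec_eq_iff forall_2 algebra_simps)

lemma bounded_linear_complex_of_plane: "bounded_linear (complex_of_plane \<epsilon>)"
  unfolding linear_conv_bounded_linear[symmetric]
  by (intro linearI) (simp_all add: complex_of_plane_def complex_eq_iff algebra_simps)

text \<open>Conjugation by a reflection does not change a determinant, so both signs give the
  determinant of complex multiplication by \<open>c\<close>.\<close>

lemma det_plane_mult:
  assumes "\<epsilon> * \<epsilon> = 1"
  shows "det (matrix (\<lambda>v. plane_of \<epsilon> (c * complex_of_plane \<epsilon> v))) = (cmod c)\<^sup>2"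
proof -
  have e: "\<epsilon> * (\<epsilon> * x) = x" for x using assms by (simp flip: mult.assoc)
  show ?thesis
    unfolding det_2 matrix_def plane_of_def complex_of_plane_def cmod_power2
    by (simp add: Finite_Cartesian_Product.axis_def e power2_eq_square algebra_simps)
qed

definition plane_power :: "real \<Rightarrow> nat \<Rightarrow> real ^ 2 \<Rightarrow> real ^ 2" where
  "plane_power \<epsilon> k v = plane_of \<epsilon> (complex_of_plane \<epsilon> v ^ k)"

lemma smooth_on_plane_power: "open W \<Longrightarrow> smooth_on (plane_power \<epsilon> k) W"
proof -
  assume W: "open W"
  have 1: "smooth_on (complex_of_plane \<epsilon>) W" by (rule smooth_on_bounded_linear[OF bounded_linear_complex_of_plane])
  have "smooth_on ((\<lambda>z. z ^ k) \<circ> complex_of_plane \<epsilon>) W"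
    by (rule smooth_on_compose[OF W open_UNIV _ 1 smooth_on_power[OF open_UNIV]]) auto
  then have "smooth_on (\<lambda>v. plane_of \<epsilon> (((\<lambda>z. z ^ k) \<circ> complex_of_plane \<epsilon>) v)) W"
    by (rule smooth_on_linear_compose[OF bounded_linear_plane_of W])
  then show ?thesis unfolding plane_power_def by (simp add: o_def)
qed

lemma frechet_derivative_plane_power:
  "frechet_derivative (plane_power \<epsilon> k) (at v) =
     (\<lambda>h. plane_of \<epsilon> (of_nat k * complex_of_plane \<epsilon> v ^ (k - 1) * complex_of_plane \<epsilon> h))"
proof -
  have "((\<lambda>z::complex. z ^ k) has_derivative (*) (of_nat k * complex_of_plane \<epsilon> v ^ (k - 1))) (at (complex_of_plane \<epsilon> v))"
    using DERIV_power[OF DERIV_ident, of k "complex_of_plane \<epsilon> v"] unfolding has_field_derivative_def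
    by (simp add: mult.commute)
  then have "(plane_power \<epsilon> k has_derivative
     (\<lambda>h. plane_of \<epsilon> (of_nat k * complex_of_plane \<epsilon> v ^ (k - 1) * complex_of_plane \<epsilon> h))) (at v)"
    unfolding plane_power_def
    by (intro bounded_linear.has_derivative[OF bounded_linear_plane_of]
        has_derivative_compose[OF bounded_linear_imp_has_derivative[OF bounded_linear_complex_of_plane]])
  then show ?thesis using frechet_derivative_at by metis
qed

lemma det_plane_power:
  assumes "\<epsilon> * \<epsilon> = 1" "k \<ge> 1" "complex_of_plane \<epsilon> v \<noteq> 0"
  shows "det (matrix (frechet_derivative (plane_power \<epsilon> k) (at v))) > 0"
  unfolding frechet_derivative_plane_power using assms det_plane_mult[OF assms(1)] by simp

lemma linear_frechet_smooth:
  "smooth_on g W \<Longrightarrow> x \<in> W \<Longrightarrow> linear (frechet_derivative g (at x))"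
  using smooth_on_differentiable linear_frechet_derivative by blast

text \<open>Serves to make the projection of a sheet along \<open>K\<close> a chart of the
  surface.\<close>

lemma smooth_chart_reparametrize:
  fixes h :: "'f::euclidean_space \<Rightarrow> 'g::euclidean_space"
  assumes S: "smooth_manifold S" and A0: "smooth_chart S A0 \<beta>" and U: "open U" "U \<subseteq> \<beta> ` A0"
    and V: "open V" and hom: "homeomorphism U V h g" and h: "smooth_on h U" and g: "smooth_on g V"
  defines "A \<equiv> {s \<in> A0. \<beta> s \<in> U}"
  shows "smooth_chart S A (h \<circ> \<beta>)" and "(h \<circ> \<beta>) ` A = V"
    "\<And>w. w \<in> V \<Longrightarrow> inv_into A (h \<circ> \<beta>) w = inv_into A0 \<beta> (g w)"
proof -
  note tA = topological_chart_facts[OF smooth_chart_topological[OF A0]]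
  have hU: "h x \<in> V" "g (h x) = x" if "x \<in> U" for x using hom that by (auto simp: homeomorphism_def)
  have gV: "g w \<in> U" "h (g w) = w" if "w \<in> V" for w using hom that by (auto simp: homeomorphism_def)
  have AA: "A \<subseteq> A0" unfolding A_def by auto
  have oA: "openin (mtop S) A" unfolding A_def by (rule tA(8)[OF U(1)])
  have ig: "inv_into A0 \<beta> (g w) \<in> A" "\<beta> (inv_into A0 \<beta> (g w)) = g w" if "w \<in> V" for w
  proof -
    have "g w \<in> \<beta> ` A0" using gV(1)[OF that] U(2) by blast
    then show "inv_into A0 \<beta> (g w) \<in> A" "\<beta> (inv_into A0 \<beta> (g w)) = g w"
      unfolding A_def using gV(1)[OF that] by (auto simp: inv_into_into f_inv_into_f)
  qed
  have inj: "inj_on (h \<circ> \<beta>) A"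
  proof (rule inj_onI)
    fix x y assume xy: "x \<in> A" "y \<in> A" "(h \<circ> \<beta>) x = (h \<circ> \<beta>) y"
    then have "\<beta> x = \<beta> y" using hU(2) unfolding A_def by (metis comp_apply mem_Collect_eq)
    then show "x = y" using xy AA tA(3) by (meson inj_onD subsetD)
  qed
  show im: "(h \<circ> \<beta>) ` A = V"
  proof
    show "(h \<circ> \<beta>) ` A \<subseteq> V" using hU unfolding A_def by auto
    show "V \<subseteq> (h \<circ> \<beta>) ` A"
    proof
      fix w assume "w \<in> V"
      then show "w \<in> (h \<circ> \<beta>) ` A" using ig[of w] gV[of w] by (intro image_eqI[of _ _ "inv_into A0 \<beta> (g w)"]) auto
    qed
  qed
  show inv: "inv_into A (h \<circ> \<beta>) w = inv_into A0 \<beta> (g w)" if "w \<in> V" for w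
    using inv_into_f_eq[OF inj ig(1)[OF that], of w] ig(2)[OF that] gV(2)[OF that] by simp
  have ig_into: "smooth_into S V (inv_into A0 \<beta> \<circ> g)"
    by (rule smooth_into_compose[OF tA(4) V S smooth_into_chart_inverse[OF A0] g]) (use gV U in auto)
  then have inv_smooth: "smooth_into S V (inv_into A (h \<circ> \<beta>))"
    by (rule smooth_into_cong[OF V S]) (simp add: inv)
  have cont: "continuous_map (subtopology (mtop S) A) euclidean (h \<circ> \<beta>)"
  proof (rule continuous_map_compose[of _ "top_of_set U"])
    show "continuous_map (subtopology (mtop S) A) (top_of_set U) \<beta>"
      using continuous_map_from_subtopology_mono[OF tA(5) AA] unfolding A_def
      by (auto simp: continuous_map_in_subtopology)
    show "continuous_map (top_of_set U) euclidean h"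
      using smooth_on_continuous[OF h] by simp
  qed
  have "homeomorphic_maps (subtopology (mtop S) A) (top_of_set V) (h \<circ> \<beta>) (inv_into A (h \<circ> \<beta>))"
    unfolding homeomorphic_maps_def
  proof (intro conjI ballI)
    show "continuous_map (subtopology (mtop S) A) (top_of_set V) (h \<circ> \<beta>)"
      using cont im by (auto simp: continuous_map_in_subtopology)
    show "continuous_map (top_of_set V) (subtopology (mtop S) A) (inv_into A (h \<circ> \<beta>))"
      using smooth_into_continuous[OF inv_smooth] inv ig by (auto simp: continuous_map_in_subtopology)
    show "inv_into A (h \<circ> \<beta>) ((h \<circ> \<beta>) x) = x" if "x \<in> topspace (subtopology (mtop S) A)" for x
      using that inj by (intro inv_into_f_f) auto
    show "(h \<circ> \<beta>) (inv_into A (h \<circ> \<beta>) y) = y" if "y \<in> topspace (top_of_set V)" for y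
      using that im by (intro f_inv_into_f) auto
  qed
  then have top: "topological_chart (mtop S) A (h \<circ> \<beta>)"
    unfolding topological_chart_def im using oA V homeomorphic_maps_map by blast
  show "smooth_chart S A (h \<circ> \<beta>)"
    unfolding smooth_chart_def
  proof (intro conjI ballI, rule top, safe)
    fix W \<psi> assume W: "(W, \<psi>) \<in> atlas S"
    have cW: "smooth_chart S W \<psi>" by (rule atlas_smooth_chart[OF S W])
    note tW = topological_chart_facts[OF smooth_chart_topological[OF cW]]
    have "{w \<in> V. inv_into A (h \<circ> \<beta>) w \<in> W} = (h \<circ> \<beta>) ` (A \<inter> W)"
    proof
      show "{w \<in> V. inv_into A (h \<circ> \<beta>) w \<in> W} \<subseteq> (h \<circ> \<beta>) ` (A \<inter> W)"
      proof
        fix w assume w: "w \<in> {w \<in> V. inv_into A (h \<circ> \<beta>) w \<in> W}"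
        then have wi: "w \<in> (h \<circ> \<beta>) ` A" using im by simp
        show "w \<in> (h \<circ> \<beta>) ` (A \<inter> W)"
          using f_inv_into_f[OF wi] inv_into_into[OF wi] w by (intro image_eqI[of _ _ "inv_into A (h \<circ> \<beta>) w"]) auto
      qed
      show "(h \<circ> \<beta>) ` (A \<inter> W) \<subseteq> {w \<in> V. inv_into A (h \<circ> \<beta>) w \<in> W}"
        using inj im by (auto simp: inv_into_f_f simp del: comp_apply)
    qed
    then show "smooth_on (\<psi> \<circ> inv_into A (h \<circ> \<beta>)) ((h \<circ> \<beta>) ` (A \<inter> W))"
      using smooth_into_atlas[OF inv_smooth W] by simp
    have oAW: "open (\<psi> ` (A \<inter> W))" by (rule tW(7)) (use oA tW(1) in auto)
    have 1: "smooth_on (\<beta> \<circ> inv_into W \<psi>) (\<psi> ` (A \<inter> W))"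
      by (rule smooth_on_subset[OF smooth_chart_transition[OF S cW A0]]) (use AA in auto)
    have "smooth_on (h \<circ> (\<beta> \<circ> inv_into W \<psi>)) (\<psi> ` (A \<inter> W))"
    proof (rule smooth_on_compose[OF oAW U(1) _ 1 h])
      show "(\<beta> \<circ> inv_into W \<psi>) ` (\<psi> ` (A \<inter> W)) \<subseteq> U" using tW(3) unfolding A_def by auto
    qed
    then show "smooth_on ((h \<circ> \<beta>) \<circ> inv_into W \<psi>) (\<psi> ` (A \<inter> W))" by (simp add: o_assoc)
  qed
qed

text \<open>A transition between slice charts preserves the axis, so transversality does not depend on
  the slice chart: the projection along the axis is a local diffeomorphism on each sheet.\<close>

lemma slice_transition_derivative:
  assumes M: "smooth_manifold M" and V: "slice_chart M K V \<psi>" and V': "slice_chart M K V' \<psi>'"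
    and y: "y \<in> V" "y \<in> V'" "y \<in> K" and b: "b \<in> axis"
  shows "fst (frechet_derivative (\<psi> \<circ> inv_into V' \<psi>') (at (\<psi>' y)) b) = 0"
proof -
  have cV: "smooth_chart M V \<psi>" and cV': "smooth_chart M V' \<psi>'"
    and sV: "\<psi> ` (V \<inter> K) = \<psi> ` V \<inter> axis" and sV': "\<psi>' ` (V' \<inter> K) = \<psi>' ` V' \<inter> axis"
    using V V' unfolding slice_chart_def by auto
  note tV = topological_chart_facts[OF smooth_chart_topological[OF cV]]
  note tV' = topological_chart_facts[OF smooth_chart_topological[OF cV']]
  define \<tau> where "\<tau> = \<psi> \<circ> inv_into V' \<psi>'"
  define G where "G = \<psi>' ` (V' \<inter> V)"
  have oG: "open G" unfolding G_def by (rule tV'(7)) (use tV(1) tV'(1) in auto)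
  have sm: "smooth_on \<tau> G" unfolding \<tau>_def G_def by (rule smooth_chart_transition[OF M cV' cV])
  have yG: "\<psi>' y \<in> G" unfolding G_def using y by auto
  have "\<psi>' y \<in> \<psi>' ` (V' \<inter> K)" using y by blast
  then have "\<psi>' y \<in> axis" using sV' by auto
  then obtain t0 where t0: "\<psi>' y = (0, t0)" unfolding axis_def by auto
  obtain s where b': "b = (0, s)" using b unfolding axis_def by auto
  have ax: "fst (\<tau> (0, t)) = 0" if "(0, t) \<in> G" for t
  proof -
    obtain z where z: "z \<in> V'" "z \<in> V" "(0, t) = \<psi>' z" using \<open>(0, t) \<in> G\<close> unfolding G_def by blast
    have "\<psi>' z \<in> \<psi>' ` V' \<inter> axis" using z unfolding axis_def by (metis IntI UNIV_I imageI mem_Sigma_iff singletonI)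
    then have "\<psi>' z \<in> \<psi>' ` (V' \<inter> K)" using sV' by simp
    then obtain z' where z': "z' \<in> V'" "z' \<in> K" "\<psi>' z = \<psi>' z'" by blast
    have "z' = z" using inj_onD[OF tV'(3)] z' z by metis
    then have "\<psi> z \<in> \<psi> ` (V \<inter> K)" using z z' by blast
    then have "\<psi> z \<in> axis" using sV by blast
    moreover have "\<tau> (0, t) = \<psi> z" unfolding \<tau>_def z(3) using z tV'(3) by simp
    ultimately show ?thesis unfolding axis_def by auto
  qed
  \<comment> \<open>A line that runs inside the axis with velocity \<open>b\<close>. The first
    coordinate of \<open>\<tau>\<close> vanishes along it, so its derivative in this direction is
    zero.\<close>
  define c where "c = (\<lambda>u::real. (0::complex, t0 + u * s))"
  have dc: "(c has_derivative (\<lambda>u. (0, u * s))) (at 0)"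
    unfolding c_def by (auto intro!: derivative_eq_intros)
  have d\<tau>: "(\<tau> has_derivative frechet_derivative \<tau> (at (c 0))) (at (c 0))"
    using smooth_on_differentiable[OF sm yG] t0 unfolding c_def by (simp add: frechet_derivative_works)
  have d1: "((\<lambda>u. fst (\<tau> (c u))) has_derivative (\<lambda>u. fst (frechet_derivative \<tau> (at (c 0)) (0, u * s)))) (at 0)"
    by (intro has_derivative_fst has_derivative_compose[OF dc d\<tau>])
  have oc: "open (c -` G)" unfolding c_def by (intro open_vimage oG continuous_intros)
  have 0: "0 \<in> c -` G" using yG t0 unfolding c_def by simp
  have "((\<lambda>u. fst (\<tau> (c u))) has_derivative (\<lambda>u. 0)) (at 0)"
  proof (rule has_derivative_transform_within_open[OF _ oc 0])
    show "((\<lambda>u. 0) has_derivative (\<lambda>u. 0)) (at 0)" by simp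
    show "0 = fst (\<tau> (c u))" if "u \<in> c -` G" for u using that ax unfolding c_def by auto
  qed
  then have "(\<lambda>u. fst (frechet_derivative \<tau> (at (c 0)) (0, u * s))) = (\<lambda>u. 0)"
    using has_derivative_unique[OF d1] by blast
  then have "fst (frechet_derivative \<tau> (at (c 0)) (0, 1 * s)) = 0" by metis
  then show ?thesis unfolding b' \<tau>_def[symmetric] t0 c_def by simp
qed

text \<open>Transversality is given in some slice chart \<open>\<psi>'\<close> and says that the
  tangent plane spans modulo the axis. The chart change maps the axis directions into the axis, so
  the projection is surjective in \<open>\<psi>\<close> as well; between planes this means
  injective.\<close>

lemma transverse_projection:
  assumes S: "smooth_manifold S" and M: "smooth_manifold M" and f: "smooth_map_on S (points S) M f"
    and tr: "transverse S M f K" and V: "slice_chart M K V \<psi>"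
    and A: "smooth_chart S A (\<beta> :: 's \<Rightarrow> real ^ 2)" and s: "s \<in> A" "f s \<in> V" "f s \<in> K"
    and \<epsilon>: "\<epsilon> * \<epsilon> = 1"
  shows "inj (\<lambda>v. plane_of \<epsilon> (fst (frechet_derivative (\<psi> \<circ> f \<circ> inv_into A \<beta>) (at (\<beta> s)) v)))"
proof -
  note tA = topological_chart_facts[OF smooth_chart_topological[OF A]]
  have sS: "s \<in> points S" using tA(2) s by auto
  have cV: "smooth_chart M V \<psi>" using V unfolding slice_chart_def by auto
  obtain V' \<psi>' where V': "f s \<in> V'" "slice_chart M K V' \<psi>'"
     "{a + b |a b. a \<in> tangent_image S f \<psi>' s \<and> b \<in> axis} = UNIV"
    using tr sS s unfolding transverse_def by blast
  have cV': "smooth_chart M V' \<psi>'" using V' unfolding slice_chart_def by auto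
  have i: "inv_into A \<beta> (\<beta> s) = s" using tA(3) s by simp
  have sf: "smooth_into M (\<beta> ` A) (f \<circ> inv_into A \<beta>)"
    by (rule smooth_into_smooth_map[OF S M f tA(4) smooth_into_chart_inverse[OF A]])
      (use tA(2,3) in auto)
  define D where "D = frechet_derivative (\<psi> \<circ> (f \<circ> inv_into A \<beta>)) (at (\<beta> s))"
  define D' where "D' = frechet_derivative (\<psi>' \<circ> (f \<circ> inv_into A \<beta>)) (at (\<beta> s))"
  define L where "L = frechet_derivative (\<psi> \<circ> inv_into V' \<psi>') (at (\<psi>' (f s)))"
  have dL: "(\<psi> \<circ> inv_into V' \<psi>') differentiable (at (\<psi>' (f s)))"
    by (rule smooth_on_differentiable[OF smooth_chart_transition[OF M cV' cV]]) (use s V' in auto)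
  have DL: "D = L \<circ> D'"
    unfolding D_def D'_def L_def
    using frechet_derivative_through_chart[OF M tA(4) sf cV', of "\<beta> s" \<psi>] s V' i dL by simp
  have linL: "linear L" unfolding L_def using dL linear_frechet_derivative by blast
  have dD: "(\<psi> \<circ> (f \<circ> inv_into A \<beta>)) differentiable (at (\<beta> s))"
    by (rule smooth_into_chart_differentiable[OF M tA(4) sf cV]) (use s i in auto)
  have linD: "linear D" unfolding D_def using dD linear_frechet_derivative by blast
  have ti: "tangent_image S f \<psi>' s = range D'"
    unfolding D'_def o_assoc
    by (rule tangent_image_eq[OF S A s(1)])
      (use smooth_into_chart_differentiable[OF M tA(4) sf cV', of "\<beta> s"] s V' i in \<open>auto simp: o_assoc\<close>)
  have surjL: "surj L"
    unfolding L_def using bij_frechet_derivative_transition[OF M cV' cV V'(1) s(2)] bij_is_surj by blast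
  have "surj (\<lambda>v. fst (D v))"
  proof (rule surjI)
    fix z
    have "\<exists>v. fst (D v) = z"
    proof -
      obtain u where u: "L u = (z, 0)" using surjL by (metis surjD)
      have "u \<in> {a + b |a b. a \<in> tangent_image S f \<psi>' s \<and> b \<in> axis}" using V'(3) by simp
      then obtain v b where vb: "u = D' v + b" "b \<in> axis" unfolding ti by blast
      have "L u = D v + L b" unfolding vb(1) DL using linear_add[OF linL] by simp
      moreover have "fst (L b) = 0"
        unfolding L_def by (rule slice_transition_derivative[OF M V V'(2) s(2) V'(1) s(3) vb(2)])
      ultimately have "fst (D v) = z" using u by (metis add.right_neutral fst_add fst_conv)
      then show ?thesis by blast
    qed
    then show "fst (D (SOME v. fst (D v) = z)) = z" by (rule someI_ex)
  qed
  moreover have "surj (plane_of \<epsilon>)" using plane_inverse(2)[OF \<epsilon>] by (metis surjI)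
  ultimately have "surj (plane_of \<epsilon> \<circ> (\<lambda>v. fst (D v)))" by (rule comp_surj)
  moreover have "linear (plane_of \<epsilon> \<circ> (\<lambda>v. fst (D v)))"
    by (intro linear_compose[of "\<lambda>v. fst (D v)"] linear_compose[OF linD, of fst, unfolded o_def]
        bounded_linear.linear[OF bounded_linear_plane_of] bounded_linear.linear[OF bounded_linear_fst])
  ultimately have "inj (plane_of \<epsilon> \<circ> (\<lambda>v. fst (D v)))" using linear_surjective_imp_injective by blast
  then show ?thesis unfolding D_def by (simp add: o_def)
qed

text \<open>The condition under the quantifier of \<open>orientable\<close>, named so that one
  orientation of \<open>S\<close> can be kept fixed.\<close>

definition oriented_atlas :: "('a, real ^ 'n) mfd \<Rightarrow> ('a set \<times> ('a \<Rightarrow> real ^ 'n)) set \<Rightarrow> bool" where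
  "oriented_atlas M B \<longleftrightarrow> (\<forall>(U, \<phi>)\<in>B. smooth_chart M U \<phi>) \<and> (\<Union>(U, \<phi>)\<in>B. U) = points M \<and>
     (\<forall>(U, \<phi>)\<in>B. \<forall>(V, \<psi>)\<in>B. \<forall>x\<in>U \<inter> V.
        det (matrix (frechet_derivative (\<psi> \<circ> inv_into U \<phi>) (at (\<phi> x)))) > 0)"

lemma oriented_atlasD:
  assumes "oriented_atlas M B"
  shows "(U, \<phi>) \<in> B \<Longrightarrow> smooth_chart M U \<phi>"
    "(U, \<phi>) \<in> B \<Longrightarrow> (V, \<psi>) \<in> B \<Longrightarrow> x \<in> U \<Longrightarrow> x \<in> V \<Longrightarrow>
       det (matrix (frechet_derivative (\<psi> \<circ> inv_into U \<phi>) (at (\<phi> x)))) > 0"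
    "x \<in> points M \<Longrightarrow> \<exists>U \<phi>. (U, \<phi>) \<in> B \<and> x \<in> U"
proof -
  note D = assms[unfolded oriented_atlas_def]
  show "smooth_chart M U \<phi>" if "(U, \<phi>) \<in> B" using conjunct1[OF D] that by auto
  show "det (matrix (frechet_derivative (\<psi> \<circ> inv_into U \<phi>) (at (\<phi> x)))) > 0"
    if "(U, \<phi>) \<in> B" "(V, \<psi>) \<in> B" "x \<in> U" "x \<in> V"
    using bspec[OF bspec[OF conjunct2[OF conjunct2[OF D]] that(1), simplified] that(2)] that(3,4) by auto
  have "(\<Union>(U, \<phi>)\<in>B. U) = points M" by (rule conjunct1[OF conjunct2[OF D]])
  then have "x \<in> (\<Union>(U, \<phi>)\<in>B. U)" if "x \<in> points M" using that by simp
  then show "\<exists>U \<phi>. (U, \<phi>) \<in> B \<and> x \<in> U" if "x \<in> points M" using that by auto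
qed

lemma det_reflection: "det (matrix (\<lambda>v. plane_of \<epsilon> (complex_of_plane 1 v))) = \<epsilon>"
  unfolding det_2 matrix_def plane_of_def complex_of_plane_def
  by (simp add: Finite_Cartesian_Product.axis_def)

text \<open>The inverse function theorem makes the slice projection \<open>h0\<close> a local
  coordinate. Its Jacobian relative to \<open>B\<close> has a sign \<open>\<epsilon>\<close> at
  \<open>s0\<close>, and the chart is shrunk to \<open>U2\<close>, where this sign persists.\<close>

lemma oriented_slice_projection_chart:
  fixes S :: "('s, real ^ 2) mfd" and M :: "('a, real ^ 3) mfd"
  assumes S: "smooth_manifold S" and M: "smooth_manifold M" and f: "smooth_map_on S (points S) M f"
    and tr: "transverse S M f K" and V: "slice_chart M K V \<psi>" and B: "oriented_atlas S B"
    and s0: "s0 \<in> points S" "f s0 \<in> V" "f s0 \<in> K"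
  obtains \<epsilon> A \<gamma> where "\<epsilon> * \<epsilon> = 1" "s0 \<in> A" "smooth_chart S A \<gamma>"
    "\<And>s. s \<in> A \<Longrightarrow> f s \<in> V \<and> \<gamma> s = plane_of \<epsilon> (fst (\<psi> (f s)))"
    "\<And>A' \<beta> s. (A', \<beta>) \<in> B \<Longrightarrow> s \<in> A \<Longrightarrow> s \<in> A' \<Longrightarrow>
       det (matrix (frechet_derivative (\<beta> \<circ> inv_into A \<gamma>) (at (\<gamma> s)))) > 0"
proof -
  obtain A0 \<beta> where A0: "(A0, \<beta>) \<in> B" "s0 \<in> A0" using oriented_atlasD(3)[OF B s0(1)] by blast
  have cA: "smooth_chart S A0 \<beta>" by (rule oriented_atlasD(1)[OF B A0(1)])
  have cV: "smooth_chart M V \<psi>" using V unfolding slice_chart_def by blast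
  note tA = topological_chart_facts[OF smooth_chart_topological[OF cA]]
  note tV = topological_chart_facts[OF smooth_chart_topological[OF cV]]
  let ?P = "\<psi> \<circ> f \<circ> inv_into A0 \<beta>"
  define W where "W = \<beta> ` {s \<in> A0. f s \<in> V}"
  have W': "{x \<in> A0 \<inter> points S. f x \<in> V} = {s \<in> A0. f s \<in> V}" using tA(2) by auto
  have smP: "smooth_on ?P W" using smooth_map_on_charts[OF S M f cA cV] unfolding W_def W' .
  have cf: "continuous_map (mtop S) (mtop M) f"
    using f unfolding smooth_map_on_def by simp
  have "openin (mtop S) (A0 \<inter> {x \<in> points S. f x \<in> V})"
    using openin_continuous_map_preimage[OF cf tV(1)] tA(1) by blast
  moreover have "A0 \<inter> {x \<in> points S. f x \<in> V} = {s \<in> A0. f s \<in> V}" using tA(2) by auto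
  ultimately have oW: "open W" unfolding W_def by (intro tA(7)) auto
  define h0 where "h0 = (\<lambda>x. plane_of 1 (fst (?P x)))"
  have blL: "bounded_linear (\<lambda>z. plane_of e (fst z))" for e
    using bounded_linear_compose[OF bounded_linear_plane_of bounded_linear_fst] .
  have smh0: "smooth_on h0 W" unfolding h0_def by (rule smooth_on_linear_compose[OF blL oW smP])
  have Dh0: "frechet_derivative h0 (at x) = (\<lambda>v. plane_of 1 (fst (frechet_derivative ?P (at x) v)))" if "x \<in> W" for x
  proof -
    have "(?P has_derivative frechet_derivative ?P (at x)) (at x)"
      using smooth_on_differentiable[OF smP that] frechet_derivative_works by blast
    from bounded_linear.has_derivative[OF blL this]
    show ?thesis unfolding h0_def using frechet_derivative_at by metis
  qed
  have s0W: "\<beta> s0 \<in> W" unfolding W_def using A0 s0 by blast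
  have inj0: "inj (frechet_derivative h0 (at (\<beta> s0)))"
    unfolding Dh0[OF s0W] by (rule transverse_projection[OF S M f tr V cA A0(2) s0(2,3)]) simp
  obtain U1 V1 g where U1: "open U1" "U1 \<subseteq> W" "\<beta> s0 \<in> U1" and V1: "open V1" and hom: "homeomorphism U1 V1 h0 g"
    and smg: "smooth_on g V1" and bij: "\<And>x. x \<in> U1 \<Longrightarrow> bij (frechet_derivative h0 (at x))"
    by (rule inverse_function_smooth[OF oW smh0 s0W inj0]) blast
  define d where "d = (\<lambda>x. det (matrix (frechet_derivative h0 (at x))))"
  have d0: "d x \<noteq> 0" if x: "x \<in> U1" for x
  proof -
    have "linear (frechet_derivative h0 (at x))" using linear_frechet_smooth[OF smh0] x U1 by blast
    then show ?thesis unfolding d_def using bij[OF x] det_nz_iff_inj bij_is_inj by blast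
  qed
  have "continuous_on U1 d"
    unfolding d_def det_2 matrix_def
    using smooth_on_continuous[OF smooth_on_subset[OF smooth_on_derivative[OF smh0] U1(2)]]
    by (simp add: continuous_intros)
  define \<epsilon> where "\<epsilon> = sgn (d (\<beta> s0))"
  have \<epsilon>: "\<epsilon> * \<epsilon> = 1" unfolding \<epsilon>_def using d0[OF U1(3)] by (simp add: sgn_if)
  define U2 where "U2 = U1 \<inter> d -` {u. \<epsilon> * u > 0}"
  have "open {u. \<epsilon> * u > 0}" by (intro open_Collect_less continuous_intros)
  then have oU2: "open U2"
    unfolding U2_def using continuous_open_preimage[OF \<open>continuous_on U1 d\<close> U1(1)] by blast
  have s0U2: "\<beta> s0 \<in> U2"
    unfolding U2_def \<epsilon>_def using U1(3) d0[OF U1(3)] by (auto simp: sgn_if)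
  \<comment> \<open>The identity or a reflection. It replaces \<open>plane_of 1\<close> by
    \<open>plane_of \<epsilon>\<close> afterwards, since \<open>\<epsilon>\<close> is only known
    from the Jacobian of \<open>h0\<close>.\<close>
  define R where "R = (\<lambda>v. plane_of \<epsilon> (complex_of_plane 1 v))"
  define R' where "R' = (\<lambda>v. plane_of 1 (complex_of_plane \<epsilon> v))"
  have blR: "bounded_linear R" "bounded_linear R'"
    unfolding R_def R'_def using bounded_linear_compose[OF bounded_linear_plane_of bounded_linear_complex_of_plane] by auto
  have RR: "R (R' v) = v" "R' (R v) = v" for v
    unfolding R_def R'_def using plane_inverse[of 1] plane_inverse[OF \<epsilon>] by auto
  define h where "h = R \<circ> h0"
  define V2 where "V2 = {w \<in> R' -` V1. g (R' w) \<in> U2}"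
  have hU: "h0 x \<in> V1" "g (h0 x) = x" if "x \<in> U1" for x using hom that by (auto simp: homeomorphism_def)
  have gV: "g w \<in> U1" "h0 (g w) = w" if "w \<in> V1" for w using hom that by (auto simp: homeomorphism_def)
  have oRV: "open (R' -` V1)"
    using open_vimage[OF V1] linear_continuous_on[OF blR(2)] by blast
  have smg2: "smooth_on (g \<circ> R') (R' -` V1)"
    by (rule smooth_on_compose[OF oRV V1 _ smooth_on_bounded_linear[OF blR(2)] smg]) auto
  have "V2 = (R' -` V1) \<inter> (g \<circ> R') -` U2" unfolding V2_def by auto
  then have oV2: "open V2"
    using continuous_open_preimage[OF smooth_on_continuous[OF smg2] oRV oU2] by simp
  have smg2': "smooth_on (g \<circ> R') V2" by (rule smooth_on_subset[OF smg2]) (auto simp: V2_def)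
  have U2W: "U2 \<subseteq> W" unfolding U2_def using U1 by blast
  have smh: "smooth_on h U2"
    unfolding h_def o_def using smooth_on_subset[OF smooth_on_linear_compose[OF blR(1) oW smh0] U2W] .
  have hom2: "homeomorphism U2 V2 h (g \<circ> R')"
  proof (rule homeomorphismI)
    show "continuous_on U2 h" "continuous_on V2 (g \<circ> R')"
      using smooth_on_continuous smh smg2' by blast+
    show "h ` U2 \<subseteq> V2" unfolding h_def V2_def U2_def by (auto simp: RR hU)
    show "(g \<circ> R') ` V2 \<subseteq> U2" unfolding V2_def by auto
    show "(g \<circ> R') (h x) = x" if "x \<in> U2" for x using that hU unfolding h_def U2_def by (simp add: RR)
    show "h ((g \<circ> R') y) = y" if "y \<in> V2" for y using that gV unfolding h_def V2_def by (simp add: RR)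
  qed
  have U2A: "U2 \<subseteq> \<beta> ` A0" using U2W unfolding W_def by blast
  define A where "A = {s \<in> A0. \<beta> s \<in> U2}"
  note RP = smooth_chart_reparametrize[OF S cA oU2 U2A oV2 hom2 smh smg2', folded A_def]
  have A: "f s \<in> V \<and> (h \<circ> \<beta>) s = plane_of \<epsilon> (fst (\<psi> (f s)))" if s: "s \<in> A" for s
  proof -
    have sA0: "s \<in> A0" and "\<beta> s \<in> W" using s U2W unfolding A_def by auto
    then obtain s' where s': "s' \<in> A0" "f s' \<in> V" "\<beta> s = \<beta> s'" unfolding W_def by blast
    then have "s' = s" using inj_onD[OF tA(3)] sA0 by metis
    then have "f s \<in> V" using s' by simp
    moreover have "(h \<circ> \<beta>) s = plane_of \<epsilon> (fst (\<psi> (f s)))"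
      unfolding h_def h0_def R_def using plane_inverse(1)[of 1] sA0 tA(3) by simp
    ultimately show ?thesis by blast
  qed
  have det: "det (matrix (frechet_derivative (\<beta>' \<circ> inv_into A (h \<circ> \<beta>)) (at ((h \<circ> \<beta>) s)))) > 0"
    if A': "(A', \<beta>') \<in> B" "s \<in> A" "s \<in> A'" for A' \<beta>' s
  proof -
    have cA': "smooth_chart S A' \<beta>'" by (rule oriented_atlasD(1)[OF B A'(1)])
    let ?\<gamma> = "h \<circ> \<beta>"
    note t\<gamma> = topological_chart_facts[OF smooth_chart_topological[OF RP(1)]]
    have sA0: "s \<in> A0" and sU2: "\<beta> s \<in> U2" using A' unfolding A_def by auto
    have i: "inv_into A ?\<gamma> (?\<gamma> s) = s" by (rule inv_into_f_f[OF t\<gamma>(3) A'(2)])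
    have dd: "(\<beta>' \<circ> inv_into A0 \<beta>) differentiable (at (\<beta> s))"
      by (rule smooth_on_differentiable[OF smooth_chart_transition[OF S cA cA']]) (use sA0 A' in auto)
    have ddb: "(\<beta> \<circ> inv_into A ?\<gamma>) differentiable (at (?\<gamma> s))"
      by (rule smooth_on_differentiable[OF smooth_chart_transition[OF S RP(1) cA]]) (use sA0 A' in auto)
    have ddc: "(?\<gamma> \<circ> inv_into A0 \<beta>) differentiable (at (\<beta> s))"
      by (rule smooth_on_differentiable[OF smooth_chart_transition[OF S cA RP(1)]]) (use sA0 A' in auto)
    have gin: "?\<gamma> s \<in> ?\<gamma> ` A" by (rule imageI[OF A'(2)])
    \<comment> \<open>The change from the new chart to \<open>\<beta>'\<close> passes through
      \<open>\<beta>\<close>. The part up to \<open>\<beta>\<close> is inverse to the derivative of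
      \<open>h\<close>, whose determinant is positive by the choice of
      \<open>\<epsilon>\<close>.\<close>
    have e1: "frechet_derivative (\<beta>' \<circ> inv_into A ?\<gamma>) (at (?\<gamma> s)) =
      frechet_derivative (\<beta>' \<circ> inv_into A0 \<beta>) (at (\<beta> s)) \<circ> frechet_derivative (\<beta> \<circ> inv_into A ?\<gamma>) (at (?\<gamma> s))"
      using frechet_derivative_through_chart[OF S t\<gamma>(4) smooth_into_chart_inverse[OF RP(1)] cA gin, of \<beta>'] dd
      unfolding i using sA0 by simp
    have e2: "frechet_derivative (\<beta> \<circ> inv_into A ?\<gamma>) (at (?\<gamma> s)) \<circ> frechet_derivative (?\<gamma> \<circ> inv_into A0 \<beta>) (at (\<beta> s)) = id"
      by (rule frechet_derivative_transition_inverse[OF S cA RP(1) sA0 A'(2)])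
    have e3: "frechet_derivative (?\<gamma> \<circ> inv_into A0 \<beta>) (at (\<beta> s)) = frechet_derivative h (at (\<beta> s))"
      by (rule frechet_derivative_cong_open(1)[OF oU2 sU2]) (use U2A in \<open>auto simp: f_inv_into_f\<close>)
    have e4: "frechet_derivative h (at (\<beta> s)) = R \<circ> frechet_derivative h0 (at (\<beta> s))"
    proof -
      have "(h0 has_derivative frechet_derivative h0 (at (\<beta> s))) (at (\<beta> s))"
        using smooth_on_differentiable[OF smh0] sU2 U2W frechet_derivative_works by blast
      from bounded_linear.has_derivative[OF blR(1) this]
      show ?thesis unfolding h_def o_def using frechet_derivative_at by metis
    qed
    have "det (matrix (frechet_derivative h (at (\<beta> s)))) = \<epsilon> * d (\<beta> s)"
      unfolding e4 d_def
      using det_matrix_compose[of R "frechet_derivative h0 (at (\<beta> s))"] det_reflection[of \<epsilon>]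
        linear_frechet_smooth[OF smh0, of "\<beta> s"] sU2 U2W bounded_linear.linear[OF blR(1)]
      unfolding R_def by auto
    then have p: "det (matrix (frechet_derivative h (at (\<beta> s)))) > 0" using sU2 unfolding U2_def by auto
    have "det (matrix (frechet_derivative (\<beta> \<circ> inv_into A ?\<gamma>) (at (?\<gamma> s)))) * det (matrix (frechet_derivative h (at (\<beta> s)))) = 1"
      using det_matrix_compose[OF linear_frechet_derivative[OF ddb] linear_frechet_derivative[OF ddc]]
      unfolding e2 unfolding e3 matrix_id_mat_1 det_I by simp
    then have "det (matrix (frechet_derivative (\<beta> \<circ> inv_into A ?\<gamma>) (at (?\<gamma> s)))) > 0"
      using p by (metis zero_less_mult_pos2 zero_less_one)
    then show ?thesis
      unfolding e1 det_matrix_compose[OF linear_frechet_derivative[OF dd] linear_frechet_derivative[OF ddb]]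
      using oriented_atlasD(2)[OF B A0(1) A'(1) sA0 A'(3)] by simp
  qed
  show thesis
    by (rule that[OF \<epsilon> _ RP(1) A det]) (use A0 s0U2 in \<open>auto simp: A_def\<close>)
qed

section \<open>The fibre product of a surface and a branched covering\<close>

text \<open>The domain of the lifted surface is the fibre product of \<open>f\<close> and \<open>p\<close>, given by a topology \<open>X\<close>
  on an arbitrary type with coordinate maps \<open>a\<close> and \<open>b\<close>.\<close>

locale surface_pullback =
  fixes S :: "('s, real ^ 2) mfd" and M :: "('a, real ^ 3) mfd" and N :: "('b, real ^ 3) mfd"
    and f :: "'s \<Rightarrow> 'a" and p :: "'b \<Rightarrow> 'a" and K :: "'a set" and n :: nat
    and B :: "('s set \<times> ('s \<Rightarrow> real ^ 2)) set"
    and X :: "'c topology" and a :: "'c \<Rightarrow> 's" and b :: "'c \<Rightarrow> 'b"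
  assumes S: "smooth_manifold S" and M: "smooth_manifold M" and N: "smooth_manifold N"
    and B: "oriented_atlas S B"
    and imm: "immersion S M f"
    and gp: "general_position S M f"
    and pm: "smooth_map_on N (points N) M p"
    and cov: "\<And>y. y \<in> points M - K \<Longrightarrow>
       \<exists>W. openin (mtop M) W \<and> y \<in> W \<and> W \<inter> K = {} \<and> evenly_covered N M p n W"
    and branch: "\<And>x. x \<in> points N \<Longrightarrow> p x \<in> K \<Longrightarrow>
        \<exists>k\<ge>1. \<exists>U V (\<phi> :: 'b \<Rightarrow> complex \<times> real) \<psi>. x \<in> U \<and> smooth_chart N U \<phi> \<and>
           slice_chart M K V \<psi> \<and> p ` U \<subseteq> V \<and>
           (\<forall>u\<in>U. \<psi> (p u) = (fst (\<phi> u) ^ k, snd (\<phi> u)))"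
    and tr: "transverse S M f K"
    and nonsing: "K \<inter> singular_points S f = {}"
    and X: "homeomorphic_map X (subtopology (prod_topology (mtop S) (mtop N)) {(s, x). f s = p x}) (\<lambda>r. (a r, b r))"
begin

lemma f_smooth: "smooth_map_on S (points S) M f"
  using imm unfolding immersion_def by blast

lemma f_continuous: "continuous_map (mtop S) (mtop M) f"
  using f_smooth unfolding smooth_map_on_def by simp

lemma p_continuous: "continuous_map (mtop N) (mtop M) p"
  using pm unfolding smooth_map_on_def by simp

lemma f_points: "s \<in> points S \<Longrightarrow> f s \<in> points M"
  using f_continuous by (auto simp: continuous_map_def Pi_iff)

lemma p_points: "x \<in> points N \<Longrightarrow> p x \<in> points M"
  using p_continuous by (auto simp: continuous_map_def Pi_iff)

lemma image_X: "(\<lambda>r. (a r, b r)) ` topspace X = {(s, x). s \<in> points S \<and> x \<in> points N \<and> f s = p x}"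
  using homeomorphic_imp_surjective_map[OF X] by auto

lemma X_points: "r \<in> topspace X \<Longrightarrow> a r \<in> points S \<and> b r \<in> points N \<and> f (a r) = p (b r)"
  using image_X by blast

lemma X_inj: "r \<in> topspace X \<Longrightarrow> r' \<in> topspace X \<Longrightarrow> a r = a r' \<Longrightarrow> b r = b r' \<Longrightarrow> r = r'"
  using homeomorphic_imp_injective_map[OF X] by (simp add: inj_on_def)

lemma X_ex: "s \<in> points S \<Longrightarrow> x \<in> points N \<Longrightarrow> f s = p x \<Longrightarrow> \<exists>r\<in>topspace X. a r = s \<and> b r = x"
proof -
  assume "s \<in> points S" "x \<in> points N" "f s = p x"
  then have "(s, x) \<in> (\<lambda>r. (a r, b r)) ` topspace X" unfolding image_X by simp
  then show ?thesis by auto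
qed

lemma ab_continuous: "continuous_map X (prod_topology (mtop S) (mtop N)) (\<lambda>r. (a r, b r))"
  using homeomorphic_imp_continuous_map[OF X] by (simp add: continuous_map_in_subtopology)

lemma a_continuous: "continuous_map X (mtop S) a"
  using ab_continuous by (simp add: continuous_map_pairwise o_def)

lemma b_continuous: "continuous_map X (mtop N) b"
  using ab_continuous by (simp add: continuous_map_pairwise o_def)

lemma continuous_into_X:
  assumes \<sigma>: "\<And>z. z \<in> topspace Z \<Longrightarrow> \<sigma> z \<in> topspace X"
    and c: "continuous_map Z (mtop S) (a \<circ> \<sigma>)" "continuous_map Z (mtop N) (b \<circ> \<sigma>)"
  shows "continuous_map Z X \<sigma>"
proof -
  let ?Y = "subtopology (prod_topology (mtop S) (mtop N)) {(s, x). f s = p x}"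
  obtain g where g: "homeomorphic_maps X ?Y (\<lambda>r. (a r, b r)) g" using X homeomorphic_map_maps by blast
  have "continuous_map Z ?Y (\<lambda>z. (a (\<sigma> z), b (\<sigma> z)))"
    using c X_points[OF \<sigma>] by (auto simp: continuous_map_in_subtopology continuous_map_pairwise o_def)
  then have "continuous_map Z X (g \<circ> (\<lambda>z. (a (\<sigma> z), b (\<sigma> z))))"
    using g continuous_map_compose unfolding homeomorphic_maps_def by blast
  then show ?thesis
    by (rule continuous_map_eq) (use g \<sigma> in \<open>auto simp: homeomorphic_maps_def\<close>)
qed

lemma local_diffeomorphism:
  assumes x: "x \<in> points N" "p x \<notin> K"
  obtains V W where "x \<in> V" "openin (mtop N) V" "openin (mtop M) W" "W \<inter> K = {}" "diffeomorphism_on N V M W p"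
proof -
  obtain W where W: "openin (mtop M) W" "p x \<in> W" "W \<inter> K = {}" "evenly_covered N M p n W"
    using cov[of "p x"] p_points x by blast
  from W(4) obtain \<V> where V: "\<Union>\<V> = {x \<in> points N. p x \<in> W}" "\<forall>V\<in>\<V>. diffeomorphism_on N V M W p"
    unfolding evenly_covered_def by (elim exE conjE) (rule that)
  have "x \<in> \<Union>\<V>" unfolding V(1) using x W by simp
  then obtain V' where "V' \<in> \<V>" "x \<in> V'" by blast
  moreover from this have "diffeomorphism_on N V' M W p" using V(2) by blast
  moreover from this have "openin (mtop N) V'" unfolding diffeomorphism_on_def smooth_map_on_def by blast
  ultimately show thesis using that W by blast
qed

text \<open>A chart of the fibre product takes its coordinates from a chart of \<open>S\<close> or,
  at branch points, from the complex coordinate of a chart of \<open>N\<close>. Being restrictions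
  of smooth functions on a factor, such coordinates have smooth transitions.\<close>

definition coordinate_on :: "'c set \<Rightarrow> ('c \<Rightarrow> real ^ 2) \<Rightarrow> bool" where
  "coordinate_on U \<eta> \<longleftrightarrow>
     (\<exists>A \<beta>. smooth_chart S A (\<beta> :: 's \<Rightarrow> real ^ 2) \<and> (\<forall>r\<in>U. a r \<in> A \<and> \<eta> r = \<beta> (a r))) \<or>
     (\<exists>V (\<phi> :: 'b \<Rightarrow> complex \<times> real) l. smooth_chart N V \<phi> \<and> bounded_linear l \<and>
        (\<forall>r\<in>U. b r \<in> V \<and> \<eta> r = l (fst (\<phi> (b r)))))"

text \<open>Orientation is compared with \<open>B\<close> only off \<open>K\<close>: at a branch
  point with local degree above \<open>1\<close> the coordinate map \<open>a\<close> has zero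
  Jacobian.\<close>

definition pchart :: "'c set \<Rightarrow> ('c \<Rightarrow> real ^ 2) \<Rightarrow> bool" where
  "pchart U \<eta> \<longleftrightarrow> topological_chart X U \<eta> \<and> smooth_into S (\<eta> ` U) (a \<circ> inv_into U \<eta>) \<and>
     smooth_into N (\<eta> ` U) (b \<circ> inv_into U \<eta>) \<and> coordinate_on U \<eta> \<and>
     (\<forall>r\<in>U. p (b r) \<notin> K \<longrightarrow> (\<forall>A \<beta>. (A, \<beta>) \<in> B \<longrightarrow> a r \<in> A \<longrightarrow>
        det (matrix (frechet_derivative (\<beta> \<circ> (a \<circ> inv_into U \<eta>)) (at (\<eta> r)))) > 0))"

lemma pchartI:
  assumes U: "openin X U" and \<eta>: "continuous_map (subtopology X U) euclidean \<eta>" "coordinate_on U \<eta>"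
    and D: "open D" "\<eta> ` U = D"
    and \<sigma>: "smooth_into S D \<sigma>S" "smooth_into N D \<sigma>N"
    and inv: "\<And>r. r \<in> U \<Longrightarrow> \<sigma>S (\<eta> r) = a r" "\<And>r. r \<in> U \<Longrightarrow> \<sigma>N (\<eta> r) = b r"
    and det: "\<And>r A \<beta>. r \<in> U \<Longrightarrow> p (b r) \<notin> K \<Longrightarrow> (A, \<beta>) \<in> B \<Longrightarrow> a r \<in> A \<Longrightarrow>
       det (matrix (frechet_derivative (\<beta> \<circ> \<sigma>S) (at (\<eta> r)))) > 0"
  shows "pchart U \<eta>"
proof -
  have UX: "U \<subseteq> topspace X" by (rule openin_subset[OF U])
  have inj: "inj_on \<eta> U"
  proof (rule inj_onI)
    fix r r' assume r: "r \<in> U" "r' \<in> U" "\<eta> r = \<eta> r'"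
    then have "a r = a r'" "b r = b r'" using inv by metis+
    then show "r = r'" using X_inj r UX by blast
  qed
  let ?i = "inv_into U \<eta>"
  have i: "?i w \<in> U" "\<eta> (?i w) = w" if "w \<in> D" for w
    using that D(2) inv_into_into[of w \<eta> U] f_inv_into_f[of w \<eta> U] by auto
  have ai: "\<sigma>S w = (a \<circ> ?i) w" "\<sigma>N w = (b \<circ> ?i) w" if "w \<in> D" for w
    using inv[OF i(1)[OF that]] i(2)[OF that] by auto
  have sS: "smooth_into S D (a \<circ> ?i)" by (rule smooth_into_cong[OF D(1) S \<sigma>(1) ai(1)])
  have sN: "smooth_into N D (b \<circ> ?i)" by (rule smooth_into_cong[OF D(1) N \<sigma>(2) ai(2)])
  have ci: "continuous_map (top_of_set D) X ?i"
    by (rule continuous_into_X) (use i UX smooth_into_continuous[OF sS] smooth_into_continuous[OF sN] in auto)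
  have "homeomorphic_maps (subtopology X U) (top_of_set D) \<eta> ?i"
    unfolding homeomorphic_maps_def
  proof (intro conjI ballI)
    show "continuous_map (subtopology X U) (top_of_set D) \<eta>"
      using \<eta>(1) D(2) by (auto simp: continuous_map_in_subtopology)
    show "continuous_map (top_of_set D) (subtopology X U) ?i"
      using ci i by (auto simp: continuous_map_in_subtopology)
    show "?i (\<eta> x) = x" if "x \<in> topspace (subtopology X U)" for x
      using that inj by (intro inv_into_f_f) auto
    show "\<eta> (?i y) = y" if "y \<in> topspace (top_of_set D)" for y using that i by auto
  qed
  then have top: "topological_chart X U \<eta>"
    unfolding topological_chart_def D(2) using U D(1) homeomorphic_maps_map by blast
  have "det (matrix (frechet_derivative (\<beta> \<circ> (a \<circ> ?i)) (at (\<eta> r)))) > 0"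
    if r: "r \<in> U" "p (b r) \<notin> K" "(A, \<beta>) \<in> B" "a r \<in> A" for r A \<beta>
  proof -
    have "\<eta> r \<in> D" using r D(2) by blast
    have "frechet_derivative (\<beta> \<circ> (a \<circ> ?i)) (at (\<eta> r)) = frechet_derivative (\<beta> \<circ> \<sigma>S) (at (\<eta> r))"
      by (rule frechet_derivative_cong_open(1)[OF D(1) \<open>\<eta> r \<in> D\<close>]) (use ai in auto)
    then show ?thesis using det[OF r] by simp
  qed
  then show ?thesis unfolding pchart_def D(2) using top sS sN \<eta>(2) by blast
qed

lemma pchartD:
  assumes "pchart U \<eta>"
  shows "topological_chart X U \<eta>" "smooth_into S (\<eta> ` U) (a \<circ> inv_into U \<eta>)"
    "smooth_into N (\<eta> ` U) (b \<circ> inv_into U \<eta>)" "coordinate_on U \<eta>"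
    "\<And>r A \<beta>. r \<in> U \<Longrightarrow> p (b r) \<notin> K \<Longrightarrow> (A, \<beta>) \<in> B \<Longrightarrow> a r \<in> A \<Longrightarrow>
       det (matrix (frechet_derivative (\<beta> \<circ> (a \<circ> inv_into U \<eta>)) (at (\<eta> r)))) > 0"
  using assms unfolding pchart_def by auto

lemma pchart_transition_smooth:
  assumes U: "pchart U \<eta>" and U': "pchart U' \<eta>'"
  shows "smooth_on (\<eta>' \<circ> inv_into U \<eta>) (\<eta> ` (U \<inter> U'))"
proof -
  note t = topological_chart_facts[OF pchartD(1)[OF U]]
  note t' = topological_chart_facts[OF pchartD(1)[OF U']]
  have oD: "open (\<eta> ` (U \<inter> U'))" by (rule t(7)) (use t(1) t'(1) in auto)
  have i: "inv_into U \<eta> w \<in> U'" "inv_into U \<eta> w \<in> U" if "w \<in> \<eta> ` (U \<inter> U')" for w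
    using that t(3) by auto
  from pchartD(4)[OF U'] show ?thesis unfolding coordinate_on_def
  proof (elim disjE exE conjE)
    fix A \<beta> assume A: "smooth_chart S A (\<beta> :: 's \<Rightarrow> real ^ 2)" and \<eta>': "\<forall>r\<in>U'. a r \<in> A \<and> \<eta>' r = \<beta> (a r)"
    have "smooth_on (\<beta> \<circ> (a \<circ> inv_into U \<eta>)) (\<eta> ` (U \<inter> U'))"
      by (rule smooth_on_subset[OF smooth_into_chart[OF S t(4) pchartD(2)[OF U] A]]) (use i \<eta>' in auto)
    then show ?thesis
      by (subst smooth_on_cong[OF oD, of _ "\<beta> \<circ> (a \<circ> inv_into U \<eta>)"]) (use i \<eta>' in auto)
  next
    fix V and \<phi> :: "'b \<Rightarrow> complex \<times> real" and l
    assume V: "smooth_chart N V \<phi>" and l: "bounded_linear l" and \<eta>': "\<forall>r\<in>U'. b r \<in> V \<and> \<eta>' r = l (fst (\<phi> (b r)))"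
    have "smooth_on (\<phi> \<circ> (b \<circ> inv_into U \<eta>)) (\<eta> ` (U \<inter> U'))"
      by (rule smooth_on_subset[OF smooth_into_chart[OF N t(4) pchartD(3)[OF U] V]]) (use i \<eta>' in auto)
    then have "smooth_on (\<lambda>w. l (fst ((\<phi> \<circ> (b \<circ> inv_into U \<eta>)) w))) (\<eta> ` (U \<inter> U'))"
      by (intro smooth_on_linear_compose[OF l oD] smooth_on_linear_compose[OF bounded_linear_fst oD])
    then show ?thesis
      by (subst smooth_on_cong[OF oD, of _ "\<lambda>w. l (fst ((\<phi> \<circ> (b \<circ> inv_into U \<eta>)) w))"]) (use i \<eta>' in auto)
  qed
qed

text \<open>Both charts have positive Jacobian relative to a common member of \<open>B\<close>, and
  the transition is their quotient.\<close>

lemma pchart_transition_det: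
  assumes U: "pchart U \<eta>" and U': "pchart U' \<eta>'" and r: "r \<in> U" "r \<in> U'" "p (b r) \<notin> K"
  shows "det (matrix (frechet_derivative (\<eta>' \<circ> inv_into U \<eta>) (at (\<eta> r)))) > 0"
proof -
  note t = topological_chart_facts[OF pchartD(1)[OF U]]
  note t' = topological_chart_facts[OF pchartD(1)[OF U']]
  have rX: "r \<in> topspace X" using r t(2) by blast
  obtain A \<beta> where A: "(A, \<beta>) \<in> B" "a r \<in> A" using oriented_atlasD(3)[OF B] X_points[OF rX] by blast
  have cA: "smooth_chart S A \<beta>" by (rule oriented_atlasD(1)[OF B A(1)])
  let ?\<tau> = "\<eta>' \<circ> inv_into U \<eta>"
  define D where "D = \<eta> ` (U \<inter> U')"
  have oD: "open D" unfolding D_def by (rule t(7)) (use t(1) t'(1) in auto)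
  have rD: "\<eta> r \<in> D" unfolding D_def using r by blast
  have d\<tau>: "?\<tau> differentiable (at (\<eta> r))"
    using smooth_on_differentiable[OF pchart_transition_smooth[OF U U']] rD unfolding D_def by blast
  have i: "inv_into U \<eta> (\<eta> r) = r" "inv_into U' \<eta>' (\<eta>' r) = r" using r t(3) t'(3) by auto
  have dS': "(\<beta> \<circ> (a \<circ> inv_into U' \<eta>')) differentiable (at (\<eta>' r))"
    by (rule smooth_into_chart_differentiable[OF S t'(4) pchartD(2)[OF U'] cA]) (use r A i in auto)
  have "frechet_derivative (\<beta> \<circ> (a \<circ> inv_into U \<eta>)) (at (\<eta> r)) =
     frechet_derivative ((\<beta> \<circ> (a \<circ> inv_into U' \<eta>')) \<circ> ?\<tau>) (at (\<eta> r))"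
    by (rule frechet_derivative_cong_open(1)[OF oD rD]) (use t(3) t'(3) in \<open>auto simp: D_def\<close>)
  also have "\<dots> = frechet_derivative (\<beta> \<circ> (a \<circ> inv_into U' \<eta>')) (at (\<eta>' r)) \<circ> frechet_derivative ?\<tau> (at (\<eta> r))"
    using frechet_derivative_compose[OF d\<tau>, of "\<beta> \<circ> (a \<circ> inv_into U' \<eta>')"] dS' i by simp
  finally have "det (matrix (frechet_derivative (\<beta> \<circ> (a \<circ> inv_into U \<eta>)) (at (\<eta> r)))) =
     det (matrix (frechet_derivative (\<beta> \<circ> (a \<circ> inv_into U' \<eta>')) (at (\<eta>' r)))) * det (matrix (frechet_derivative ?\<tau> (at (\<eta> r))))"
    using det_matrix_compose[OF linear_frechet_derivative[OF dS'] linear_frechet_derivative[OF d\<tau>]] by simp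
  moreover have "det (matrix (frechet_derivative (\<beta> \<circ> (a \<circ> inv_into U \<eta>)) (at (\<eta> r)))) > 0"
    by (rule pchartD(5)[OF U r(1,3) A])
  moreover have "det (matrix (frechet_derivative (\<beta> \<circ> (a \<circ> inv_into U' \<eta>')) (at (\<eta>' r)))) > 0"
    by (rule pchartD(5)[OF U' r(2,3) A])
  ultimately show ?thesis by (metis zero_less_mult_pos)
qed

text \<open>In both kinds of coordinates \<open>b\<close> is followed by a map such that the
  composite has injective derivative: after \<open>p\<close> it becomes the immersion
  \<open>f\<close> in coordinates from \<open>S\<close>, and coordinates from \<open>N\<close>
  return the parameter itself.\<close>

lemma pchart_immersive:
  assumes U: "pchart U \<eta>" and r: "r \<in> U" and V: "smooth_chart N V (\<psi> :: 'b \<Rightarrow> real ^ 3)" "b r \<in> V"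
  shows "inj (frechet_derivative (\<psi> \<circ> (b \<circ> inv_into U \<eta>)) (at (\<eta> r)))"
proof -
  note t = topological_chart_facts[OF pchartD(1)[OF U]]
  have i: "inv_into U \<eta> (\<eta> r) = r" using r t(3) by auto
  have rD: "\<eta> r \<in> \<eta> ` U" using r by blast
  have rX: "r \<in> topspace X" using r t(2) by blast
  have fab: "f (a r) = p (b r)" using X_points[OF rX] by blast
  have b\<eta>: "(b \<circ> inv_into U \<eta>) (\<eta> r) = b r" and a\<eta>: "(a \<circ> inv_into U \<eta>) (\<eta> r) = a r" using i by auto
  note sS = pchartD(2)[OF U] and sN = pchartD(3)[OF U]
  have id: "frechet_derivative (\<eta> \<circ> inv_into U \<eta>) (at (\<eta> r)) = id"
    by (rule frechet_derivative_chart_self[OF pchartD(1)[OF U] r])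
  from pchartD(4)[OF U] show ?thesis unfolding coordinate_on_def
  proof (elim disjE exE conjE)
    fix A \<beta> assume A: "smooth_chart S A (\<beta> :: 's \<Rightarrow> real ^ 2)" and \<eta>: "\<forall>r\<in>U. a r \<in> A \<and> \<eta> r = \<beta> (a r)"
    obtain C \<gamma> where C: "(C, \<gamma>) \<in> atlas M" "p (b r) \<in> C"
      by (rule atlas_chart_at[OF M, of "p (b r)"]) (use X_points[OF rX] p_points in auto)
    have cC: "smooth_chart M C \<gamma>" by (rule atlas_smooth_chart[OF M C(1)])
    have T: "frechet_derivative (\<beta> \<circ> (a \<circ> inv_into U \<eta>)) (at (\<eta> r)) = id"
      using frechet_derivative_cong_open(1)[OF t(4) rD, of "\<beta> \<circ> (a \<circ> inv_into U \<eta>)" "\<eta> \<circ> inv_into U \<eta>"]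
        \<eta> id by (auto simp: inv_into_into)
    have 1: "frechet_derivative (\<gamma> \<circ> f \<circ> (a \<circ> inv_into U \<eta>)) (at (\<eta> r)) =
        frechet_derivative (\<gamma> \<circ> f \<circ> inv_into A \<beta>) (at (\<beta> (a r))) \<circ> id"
      using frechet_derivative_smooth_map[OF S M f_smooth A cC t(4) sS rD] \<eta> r X_points[OF rX] C(2)
      unfolding a\<eta> T by simp
    have 2: "frechet_derivative (\<gamma> \<circ> p \<circ> (b \<circ> inv_into U \<eta>)) (at (\<eta> r)) =
        frechet_derivative (\<gamma> \<circ> p \<circ> inv_into V \<psi>) (at (\<psi> (b r))) \<circ> frechet_derivative (\<psi> \<circ> (b \<circ> inv_into U \<eta>)) (at (\<eta> r))"
      using frechet_derivative_smooth_map[OF N M pm V(1) cC t(4) sN rD] V(2) X_points[OF rX] C(2)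
      unfolding b\<eta> by simp
    have 3: "frechet_derivative (\<gamma> \<circ> f \<circ> (a \<circ> inv_into U \<eta>)) (at (\<eta> r)) = frechet_derivative (\<gamma> \<circ> p \<circ> (b \<circ> inv_into U \<eta>)) (at (\<eta> r))"
      by (rule frechet_derivative_cong_open(1)[OF t(4) rD]) (use t(2,3) X_points in \<open>auto simp: subset_iff\<close>)
    have "inj (frechet_derivative (\<gamma> \<circ> f \<circ> inv_into A \<beta>) (at (\<beta> (a r))))"
      by (rule immersion_charts[OF S M imm A cC]) (use \<eta> r C(2) fab in auto)
    then have "inj (frechet_derivative (\<gamma> \<circ> p \<circ> inv_into V \<psi>) (at (\<psi> (b r))) \<circ> frechet_derivative (\<psi> \<circ> (b \<circ> inv_into U \<eta>)) (at (\<eta> r)))"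
      using 1 2 3 by simp
    then show ?thesis by (rule inj_on_imageI2)
  next
    fix W and \<phi> :: "'b \<Rightarrow> complex \<times> real" and l
    assume W: "smooth_chart N W \<phi>" and l: "bounded_linear l" and \<eta>: "\<forall>r\<in>U. b r \<in> W \<and> \<eta> r = l (fst (\<phi> (b r)))"
    have bl: "bounded_linear (\<lambda>x. l (fst x))" using bounded_linear_compose[OF l bounded_linear_fst] .
    have d: "(\<phi> \<circ> (b \<circ> inv_into U \<eta>)) differentiable (at (\<eta> r))"
      by (rule smooth_into_chart_differentiable[OF N t(4) sN W rD]) (use b\<eta> \<eta> r in auto)
    have "((\<lambda>x. l (fst ((\<phi> \<circ> (b \<circ> inv_into U \<eta>)) x))) has_derivative
        (\<lambda>v. l (fst (frechet_derivative (\<phi> \<circ> (b \<circ> inv_into U \<eta>)) (at (\<eta> r)) v)))) (at (\<eta> r))"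
      by (rule bounded_linear.has_derivative[OF bl iffD1[OF frechet_derivative_works d]])
    moreover have "frechet_derivative (\<lambda>x. l (fst ((\<phi> \<circ> (b \<circ> inv_into U \<eta>)) x))) (at (\<eta> r)) = id"
      unfolding id[symmetric]
      by (rule frechet_derivative_cong_open(1)[OF t(4) rD]) (use \<eta> in \<open>auto simp: inv_into_into\<close>)
    ultimately have "(\<lambda>v. l (fst (frechet_derivative (\<phi> \<circ> (b \<circ> inv_into U \<eta>)) (at (\<eta> r)) v))) = id"
      using frechet_derivative_at by metis
    then have inj: "inj (frechet_derivative (\<phi> \<circ> (b \<circ> inv_into U \<eta>)) (at (\<eta> r)))"
      by (metis (mono_tags, lifting) id_apply injI)
    have dd: "(\<phi> \<circ> inv_into V \<psi>) differentiable (at (\<psi> (b r)))"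
      by (rule smooth_on_differentiable[OF smooth_chart_transition[OF N V(1) W]]) (use V(2) \<eta> r in auto)
    have "frechet_derivative (\<phi> \<circ> (b \<circ> inv_into U \<eta>)) (at (\<eta> r)) =
        frechet_derivative (\<phi> \<circ> inv_into V \<psi>) (at (\<psi> (b r))) \<circ> frechet_derivative (\<psi> \<circ> (b \<circ> inv_into U \<eta>)) (at (\<eta> r))"
      using frechet_derivative_through_chart[OF N t(4) sN V(1) rD, of \<phi>] V(2) dd unfolding b\<eta> by blast
    then have "inj (frechet_derivative (\<phi> \<circ> inv_into V \<psi>) (at (\<psi> (b r))) \<circ> frechet_derivative (\<psi> \<circ> (b \<circ> inv_into U \<eta>)) (at (\<eta> r)))"
      using inj by simp
    then show ?thesis by (rule inj_on_imageI2)
  qed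
qed

text \<open>With a local inverse of \<open>p\<close> at hand, the fibre product is locally the graph
  of this inverse composed with \<open>f\<close>, so a chart of \<open>S\<close> serves as its
  chart.\<close>

lemma pchart_unbranched:
  assumes r0: "r0 \<in> topspace X" "p (b r0) \<notin> K"
  obtains U \<eta> where "pchart U \<eta>" "r0 \<in> U" "\<And>r. r \<in> U \<Longrightarrow> p (b r) \<notin> K"
proof -
  obtain A \<beta> where A: "(A, \<beta>) \<in> B" "a r0 \<in> A" using oriented_atlasD(3)[OF B] X_points[OF r0(1)] by blast
  have cA: "smooth_chart S A \<beta>" by (rule oriented_atlasD(1)[OF B A(1)])
  note tA = topological_chart_facts[OF smooth_chart_topological[OF cA]]
  obtain V W where V: "b r0 \<in> V" "openin (mtop N) V" "openin (mtop M) W" "W \<inter> K = {}" "diffeomorphism_on N V M W p"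
    by (rule local_diffeomorphism[OF _ r0(2)]) (use X_points[OF r0(1)] in auto)
  have bij: "bij_betw p V W" and sp': "smooth_map_on M W N (inv_into V p)"
    using V(5) unfolding diffeomorphism_on_def by auto
  have VN: "V \<subseteq> points N" by (rule openin_subset[OF V(2)])
  define U where "U = {r \<in> topspace X. a r \<in> A} \<inter> {r \<in> topspace X. b r \<in> V}"
  define \<eta> where "\<eta> = \<beta> \<circ> a"
  define C where "C = A \<inter> {s \<in> points S. f s \<in> W}"
  have oC: "openin (mtop S) C"
    unfolding C_def by (intro openin_Int tA(1) openin_continuous_map_preimage[OF f_continuous V(3)])
  have CA: "C \<subseteq> A" unfolding C_def by blast
  define D where "D = \<beta> ` C"
  have oD: "open D" unfolding D_def by (rule tA(7)[OF oC CA])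
  have aU: "a r \<in> C" "b r \<in> V" "r \<in> topspace X" if "r \<in> U" for r
    using that X_points[of r] bij_betw_apply[OF bij, of "b r"] unfolding U_def C_def by auto
  have im: "\<eta> ` U = D"
  proof
    show "\<eta> ` U \<subseteq> D" unfolding \<eta>_def D_def using aU by auto
    show "D \<subseteq> \<eta> ` U"
    proof
      fix w assume "w \<in> D"
      then obtain s where s: "s \<in> A" "s \<in> points S" "f s \<in> W" "w = \<beta> s" unfolding D_def C_def by blast
      define x where "x = inv_into V p (f s)"
      have x: "x \<in> V" "p x = f s"
        unfolding x_def using s(3) bij by (auto simp: bij_betw_def inv_into_into f_inv_into_f)
      then obtain r where "r \<in> topspace X" "a r = s" "b r = x" using X_ex[of s x] s VN by auto
      then show "w \<in> \<eta> ` U" using s x unfolding U_def \<eta>_def by (intro image_eqI[of _ _ r]) auto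
    qed
  qed
  define \<sigma>S where "\<sigma>S = inv_into A \<beta>"
  define \<sigma>N where "\<sigma>N = inv_into V p \<circ> (f \<circ> \<sigma>S)"
  have sS: "smooth_into S D \<sigma>S"
    unfolding \<sigma>S_def D_def by (rule smooth_into_subset[OF smooth_into_chart_inverse[OF cA]]) (use CA in auto)
  have \<sigma>C: "\<sigma>S w \<in> C" if "w \<in> D" for w using that tA(3) CA unfolding D_def \<sigma>S_def by auto
  have sf: "smooth_into M D (f \<circ> \<sigma>S)"
    by (rule smooth_into_smooth_map[OF S M f_smooth oD sS]) (use \<sigma>C in \<open>auto simp: C_def\<close>)
  have sN: "smooth_into N D \<sigma>N"
    unfolding \<sigma>N_def by (rule smooth_into_smooth_map[OF M N sp' oD sf]) (use \<sigma>C in \<open>auto simp: C_def\<close>)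
  have inv1: "\<sigma>S (\<eta> r) = a r" if "r \<in> U" for r
    unfolding \<sigma>S_def \<eta>_def using aU[OF that] CA tA(3) by auto
  have inv2: "\<sigma>N (\<eta> r) = b r" if "r \<in> U" for r
    unfolding \<sigma>N_def using inv1[OF that] aU[OF that] X_points[of r] bij by (simp add: bij_betw_def)
  have "pchart U \<eta>"
  proof (rule pchartI[OF _ _ _ oD im sS sN inv1 inv2])
    show "openin X U"
      unfolding U_def using tA(1) V(2) a_continuous b_continuous by (intro openin_Int openin_continuous_map_preimage)
    show "continuous_map (subtopology X U) euclidean \<eta>"
      unfolding \<eta>_def
    proof (rule continuous_map_compose[OF _ tA(5)])
      show "continuous_map (subtopology X U) (subtopology (mtop S) A) a"
        using a_continuous aU CA by (auto simp: continuous_map_in_subtopology continuous_map_from_subtopology)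
    qed
    show "coordinate_on U \<eta>"
      unfolding coordinate_on_def
    proof (intro disjI1 exI conjI)
      show "smooth_chart S A \<beta>" by (rule cA)
      show "\<forall>r\<in>U. a r \<in> A \<and> \<eta> r = \<beta> (a r)" unfolding \<eta>_def using aU CA by auto
    qed
    fix r A' \<beta>' assume r: "r \<in> U" "p (b r) \<notin> K" "(A', \<beta>') \<in> B" "a r \<in> A'"
    show "det (matrix (frechet_derivative (\<beta>' \<circ> \<sigma>S) (at (\<eta> r)))) > 0"
      unfolding \<sigma>S_def \<eta>_def comp_apply[of \<beta> a r]
      by (rule oriented_atlasD(2)[OF B A(1) r(3) _ r(4)]) (use aU[OF r(1)] CA in auto)
  qed
  moreover have "r0 \<in> U" unfolding U_def using r0 A V by auto
  moreover have "p (b r) \<notin> K" if "r \<in> U" for r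
    using aU[OF that] bij_betw_apply[OF bij] V(4) by blast
  ultimately show thesis using that by blast
qed

lemma branch_zero_iff:
  fixes \<phi> :: "'b \<Rightarrow> complex \<times> real"
  assumes k: "k \<ge> (1::nat)" and V: "slice_chart M K V \<psi>" "p ` U \<subseteq> V"
    and p\<phi>: "\<And>u. u \<in> U \<Longrightarrow> \<psi> (p u) = (fst (\<phi> u) ^ k, snd (\<phi> u))" and u: "u \<in> U"
  shows "p u \<in> K \<longleftrightarrow> fst (\<phi> u) = 0"
proof -
  have cV: "smooth_chart M V \<psi>" and Vax: "\<psi> ` (V \<inter> K) = \<psi> ` V \<inter> axis" using V(1) unfolding slice_chart_def by auto
  note tV = topological_chart_facts[OF smooth_chart_topological[OF cV]]
  have pV: "p u \<in> V" using V(2) u by blast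
  show ?thesis
  proof
    assume "p u \<in> K"
    then have "\<psi> (p u) \<in> \<psi> ` (V \<inter> K)" using pV by blast
    then have "fst (\<psi> (p u)) = 0" unfolding Vax axis_def by auto
    then show "fst (\<phi> u) = 0" using p\<phi>[OF u] by simp
  next
    assume z: "fst (\<phi> u) = 0"
    have "\<psi> (p u) \<in> axis" using p\<phi>[OF u] z k unfolding axis_def by (simp add: power_0_left)
    then have "\<psi> (p u) \<in> \<psi> ` V \<inter> axis" using imageI[OF pV] by blast
    then obtain y where y: "y \<in> V" "y \<in> K" "\<psi> (p u) = \<psi> y" unfolding Vax[symmetric] by blast
    then have "p u = y" using inj_onD[OF tV(3)] pV by metis
    then show "p u \<in> K" using y by simp
  qed
qed

text \<open>Near a branch point the sheet is a graph over the disk transverse to \<open>K\<close>, and its preimage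
  is a graph over the \<open>k\<close>-fold branched cover of this disk.\<close>

lemma pchart_branched:
  assumes r0: "r0 \<in> topspace X" "p (b r0) \<in> K"
  obtains U \<eta> where "pchart U \<eta>" "r0 \<in> U" "\<And>r. r \<in> U \<Longrightarrow> p (b r) \<in> K \<Longrightarrow> r = r0"
    "\<exists>A. openin (mtop S) A \<and> a r0 \<in> A \<and> inj_on f A"
proof -
  have r0': "a r0 \<in> points S" "b r0 \<in> points N" "f (a r0) = p (b r0)" using X_points[OF r0(1)] by auto
  obtain k U0 V and \<phi> :: "'b \<Rightarrow> complex \<times> real" and \<psi> where k: "k \<ge> 1" and U0: "b r0 \<in> U0" "smooth_chart N U0 \<phi>"
    and V: "slice_chart M K V \<psi>" "p ` U0 \<subseteq> V" and p\<phi>: "\<And>u. u \<in> U0 \<Longrightarrow> \<psi> (p u) = (fst (\<phi> u) ^ k, snd (\<phi> u))"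
    using branch[OF r0'(2) r0(2)] by blast
  have cV: "smooth_chart M V \<psi>" using V(1) unfolding slice_chart_def by auto
  note tV = topological_chart_facts[OF smooth_chart_topological[OF cV]]
  note tU = topological_chart_facts[OF smooth_chart_topological[OF U0(2)]]
  have fr0: "f (a r0) \<in> V" "f (a r0) \<in> K" using r0' U0 V r0 by auto
  obtain \<epsilon> A \<gamma> where \<epsilon>: "\<epsilon> * \<epsilon> = 1" and A: "a r0 \<in> A" "smooth_chart S A \<gamma>"
    and A\<gamma>: "\<And>s. s \<in> A \<Longrightarrow> f s \<in> V \<and> \<gamma> s = plane_of \<epsilon> (fst (\<psi> (f s)))"
    and det\<gamma>: "\<And>A' \<beta> s. (A', \<beta>) \<in> B \<Longrightarrow> s \<in> A \<Longrightarrow> s \<in> A' \<Longrightarrow>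
       det (matrix (frechet_derivative (\<beta> \<circ> inv_into A \<gamma>) (at (\<gamma> s)))) > 0"
    by (rule oriented_slice_projection_chart[OF S M f_smooth tr V(1) B r0'(1) fr0]) blast
  note tA = topological_chart_facts[OF smooth_chart_topological[OF A(2)]]
  note PI = plane_inverse[OF \<epsilon>]
  let ?P = "plane_of \<epsilon>" and ?C = "complex_of_plane \<epsilon>" and ?W = "plane_power \<epsilon> k"
  define U where "U = {r \<in> topspace X. a r \<in> A} \<inter> {r \<in> topspace X. b r \<in> U0}"
  \<comment> \<open>The complex coordinate upstairs, read with the sign \<open>\<epsilon>\<close> of
    the chart \<open>\<gamma>\<close> downstairs; in these charts \<open>a\<close> becomes the power
    map \<open>?W\<close>.\<close>
  define \<eta> where "\<eta> = (\<lambda>r. ?P (fst (\<phi> (b r))))"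
  define D1 where "D1 = ?W -` (\<gamma> ` A)"
  have oD1: "open D1"
    unfolding D1_def using open_vimage[OF tA(4)] smooth_on_continuous[OF smooth_on_plane_power[OF open_UNIV]] by blast
  define \<sigma>S where "\<sigma>S = inv_into A \<gamma> \<circ> ?W"
  have sS1: "smooth_into S D1 \<sigma>S"
    unfolding \<sigma>S_def
    by (rule smooth_into_compose[OF tA(4) oD1 S smooth_into_chart_inverse[OF A(2)] smooth_on_plane_power[OF oD1]])
      (auto simp: D1_def)
  have \<sigma>A: "\<sigma>S w \<in> A" "\<gamma> (\<sigma>S w) = ?W w" if "w \<in> D1" for w
    using that unfolding D1_def \<sigma>S_def by (auto simp: inv_into_into f_inv_into_f)
  have sf1: "smooth_into M D1 (f \<circ> \<sigma>S)"
    by (rule smooth_into_smooth_map[OF S M f_smooth oD1 sS1]) (use \<sigma>A tA(2) in auto)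
  have "smooth_on (\<psi> \<circ> (f \<circ> \<sigma>S)) {w \<in> D1. (f \<circ> \<sigma>S) w \<in> V}" by (rule smooth_into_chart[OF M oD1 sf1 cV])
  moreover have "{w \<in> D1. (f \<circ> \<sigma>S) w \<in> V} = D1" using \<sigma>A A\<gamma> by auto
  ultimately have sm\<psi>: "smooth_on (\<psi> \<circ> (f \<circ> \<sigma>S)) D1" by simp
  \<comment> \<open>The preimage of the sheet in the branched chart: the complex coordinate is free,
    and the height is that of the sheet over its \<open>k\<close>-th power.\<close>
  define G where "G = (\<lambda>w. (?C w, snd (\<psi> (f (\<sigma>S w)))))"
  have smG: "smooth_on G D1"
    unfolding G_def
    using smooth_on_linear_compose[OF bounded_linear_snd oD1 sm\<psi>]
    by (intro smooth_on_Pair[OF oD1] smooth_on_bounded_linear[OF bounded_linear_complex_of_plane]) (simp add: o_def)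
  define D where "D = {w \<in> D1. G w \<in> \<phi> ` U0}"
  have "D = D1 \<inter> G -` (\<phi> ` U0)" unfolding D_def by auto
  then have oD: "open D" using continuous_open_preimage[OF smooth_on_continuous[OF smG] oD1 tU(4)] by simp
  have DD1: "D \<subseteq> D1" unfolding D_def by auto
  define \<sigma>N where "\<sigma>N = inv_into U0 \<phi> \<circ> G"
  have sS: "smooth_into S D \<sigma>S" by (rule smooth_into_subset[OF sS1 DD1])
  have sN: "smooth_into N D \<sigma>N"
    unfolding \<sigma>N_def
    by (rule smooth_into_compose[OF tU(4) oD N smooth_into_chart_inverse[OF U0(2)] smooth_on_subset[OF smG DD1]])
      (auto simp: D_def)
  have rU: "\<eta> r \<in> D \<and> \<sigma>S (\<eta> r) = a r \<and> \<sigma>N (\<eta> r) = b r \<and> ?W (\<eta> r) = \<gamma> (a r)" if r: "r \<in> U" for r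
  proof -
    have rX: "r \<in> topspace X" "a r \<in> A" "b r \<in> U0" using r unfolding U_def by auto
    have fp: "f (a r) = p (b r)" using X_points[OF rX(1)] by blast
    have pp: "\<psi> (f (a r)) = (fst (\<phi> (b r)) ^ k, snd (\<phi> (b r)))" using p\<phi>[OF rX(3)] fp by simp
    have W: "?W (\<eta> r) = \<gamma> (a r)"
      unfolding plane_power_def \<eta>_def PI using A\<gamma>[OF rX(2)] pp by simp
    then have 1: "\<eta> r \<in> D1" unfolding D1_def using rX by auto
    have 2: "\<sigma>S (\<eta> r) = a r" unfolding \<sigma>S_def comp_apply W using rX tA(3) by simp
    have "G (\<eta> r) = \<phi> (b r)" unfolding G_def 2 pp unfolding \<eta>_def PI by simp
    then have "\<eta> r \<in> D" "\<sigma>N (\<eta> r) = b r" unfolding D_def \<sigma>N_def using 1 rX tU(3) by auto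
    then show ?thesis using 2 W by blast
  qed
  have im: "\<eta> ` U = D"
  proof
    show "\<eta> ` U \<subseteq> D" using rU by blast
    show "D \<subseteq> \<eta> ` U"
    proof
      fix w assume w: "w \<in> D"
      then have w1: "w \<in> D1" using DD1 by blast
      have x: "\<sigma>N w \<in> U0" "\<phi> (\<sigma>N w) = G w"
        using w unfolding D_def \<sigma>N_def by (auto simp: inv_into_into f_inv_into_f)
      have s: "\<sigma>S w \<in> A" "f (\<sigma>S w) \<in> V" using \<sigma>A[OF w1] A\<gamma> by auto
      have "?P (fst (\<psi> (f (\<sigma>S w)))) = ?P (?C w ^ k)"
        using \<sigma>A[OF w1] A\<gamma>[OF s(1)] unfolding plane_power_def by simp
      then have "fst (\<psi> (f (\<sigma>S w))) = ?C w ^ k" using PI(1) by metis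
      then have "\<psi> (f (\<sigma>S w)) = \<psi> (p (\<sigma>N w))"
        using p\<phi>[OF x(1)] unfolding x(2) G_def by (simp add: prod_eq_iff)
      moreover have "p (\<sigma>N w) \<in> V" using x(1) V(2) by blast
      ultimately have "f (\<sigma>S w) = p (\<sigma>N w)" using inj_onD[OF tV(3)] s(2) by metis
      then obtain r where r: "r \<in> topspace X" "a r = \<sigma>S w" "b r = \<sigma>N w"
        using X_ex[of "\<sigma>S w" "\<sigma>N w"] s(1) x(1) tA(2) tU(2) by blast
      have "\<eta> r = w" unfolding \<eta>_def r(3) x(2) unfolding G_def using PI(2) by simp
      moreover have "r \<in> U" unfolding U_def using r s x by simp
      ultimately show "w \<in> \<eta> ` U" by blast
    qed
  qed
  have zero: "fst (\<phi> (b r)) = 0" if r: "r \<in> U" "p (b r) \<in> K" for r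
    using branch_zero_iff[where U = U0 and u = "b r" and \<phi> = \<phi>, OF k V p\<phi>] r unfolding U_def by auto
  have nonzero: "fst (\<phi> (b r)) \<noteq> 0" if r: "r \<in> U" "p (b r) \<notin> K" for r
    using branch_zero_iff[where U = U0 and u = "b r" and \<phi> = \<phi>, OF k V p\<phi>] r unfolding U_def by auto
  have pU: "pchart U \<eta>"
  proof (rule pchartI[OF _ _ _ oD im sS sN])
    show "openin X U"
      unfolding U_def using tA(1) tU(1) a_continuous b_continuous by (intro openin_Int openin_continuous_map_preimage)
    have "continuous_map (subtopology X U) (subtopology (mtop N) U0) b"
      using b_continuous unfolding U_def by (auto simp: continuous_map_in_subtopology continuous_map_from_subtopology)
    then have "continuous_map (subtopology X U) euclidean (\<phi> \<circ> b)" using tU(5) continuous_map_compose by blast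
    moreover have "bounded_linear (\<lambda>x :: complex \<times> real. ?P (fst x))"
      using bounded_linear_compose[OF bounded_linear_plane_of bounded_linear_fst] .
    then have "continuous_map euclidean euclidean (\<lambda>x :: complex \<times> real. ?P (fst x))"
      using linear_continuous_on by simp
    ultimately have "continuous_map (subtopology X U) euclidean ((\<lambda>x. ?P (fst x)) \<circ> (\<phi> \<circ> b))"
      by (rule continuous_map_compose)
    then show "continuous_map (subtopology X U) euclidean \<eta>" unfolding \<eta>_def by (simp add: o_def)
    show "coordinate_on U \<eta>"
      unfolding coordinate_on_def
    proof (intro disjI2 exI conjI)
      show "smooth_chart N U0 \<phi>" "bounded_linear ?P" by (rule U0(2), rule bounded_linear_plane_of)
      show "\<forall>r\<in>U. b r \<in> U0 \<and> \<eta> r = ?P (fst (\<phi> (b r)))" unfolding U_def \<eta>_def by auto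
    qed
    show "\<sigma>S (\<eta> r) = a r" "\<sigma>N (\<eta> r) = b r" if "r \<in> U" for r using rU[OF that] by auto
    fix r A' \<beta> assume r: "r \<in> U" "p (b r) \<notin> K" "(A', \<beta>) \<in> B" "a r \<in> A'"
    have rA: "a r \<in> A" using r unfolding U_def by auto
    have cA': "smooth_chart S A' \<beta>" by (rule oriented_atlasD(1)[OF B r(3)])
    have d1: "(\<beta> \<circ> inv_into A \<gamma>) differentiable (at (?W (\<eta> r)))"
      using smooth_on_differentiable[OF smooth_chart_transition[OF S A(2) cA']] rA r(4) rU[OF r(1)] by auto
    have W\<eta>: "?W (\<eta> r) = \<gamma> (a r)" using rU[OF r(1)] by blast
    have d2: "?W differentiable (at (\<eta> r))"
      using smooth_on_differentiable[OF smooth_on_plane_power[OF open_UNIV]] by blast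
    have "frechet_derivative (\<beta> \<circ> \<sigma>S) (at (\<eta> r)) =
       frechet_derivative (\<beta> \<circ> inv_into A \<gamma>) (at (\<gamma> (a r))) \<circ> frechet_derivative ?W (at (\<eta> r))"
      unfolding \<sigma>S_def o_assoc W\<eta>[symmetric] by (rule frechet_derivative_compose[OF d2 d1])
    then have "det (matrix (frechet_derivative (\<beta> \<circ> \<sigma>S) (at (\<eta> r)))) =
       det (matrix (frechet_derivative (\<beta> \<circ> inv_into A \<gamma>) (at (\<gamma> (a r))))) * det (matrix (frechet_derivative ?W (at (\<eta> r))))"
      using det_matrix_compose[OF linear_frechet_derivative[OF d1] linear_frechet_derivative[OF d2]] rU[OF r(1)] by simp
    \<comment> \<open>The power map is conformal off the origin, and the origin is the only
      parameter over \<open>K\<close>.\<close>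
    moreover have "det (matrix (frechet_derivative ?W (at (\<eta> r)))) > 0"
      by (rule det_plane_power[OF \<epsilon> k]) (use nonzero[OF r(1,2)] PI in \<open>simp add: \<eta>_def\<close>)
    ultimately show "det (matrix (frechet_derivative (\<beta> \<circ> \<sigma>S) (at (\<eta> r)))) > 0"
      using det\<gamma>[OF r(3) rA r(4)] by simp
  qed
  have r0U: "r0 \<in> U" unfolding U_def using r0 A U0 by auto
  have uni: "r = r0" if "r \<in> U" "p (b r) \<in> K" for r
  proof -
    have "\<eta> r = \<eta> r0" unfolding \<eta>_def using zero[OF that] zero[OF r0U r0(2)] by simp
    then show ?thesis using inj_onD[OF topological_chart_facts(3)[OF pchartD(1)[OF pU]]] that r0U by metis
  qed
  \<comment> \<open>A sheet transverse to \<open>K\<close> is embedded near \<open>a r0\<close>,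
    being a graph. This is handed on for the lifting of faces.\<close>
  have injA: "inj_on f A"
  proof (rule inj_onI)
    fix s s' assume s: "s \<in> A" "s' \<in> A" "f s = f s'"
    then have "\<gamma> s = \<gamma> s'" using A\<gamma> by metis
    then show "s = s'" using inj_onD[OF tA(3)] s by metis
  qed
  show thesis using that[OF pU r0U uni] injA tA(1) A(1) by blast
qed

end

section \<open>Topology and fibres of the fibre product\<close>

lemma second_countable_prod:
  assumes "second_countable X" "second_countable Y"
  shows "second_countable (prod_topology X Y)"
proof -
  obtain A where A: "countable A" "\<forall>V\<in>A. openin X V" "\<forall>U x. openin X U \<and> x \<in> U \<longrightarrow> (\<exists>V\<in>A. x \<in> V \<and> V \<subseteq> U)"
    using assms(1) unfolding second_countable_def by blast
  obtain B where B: "countable B" "\<forall>V\<in>B. openin Y V" "\<forall>U x. openin Y U \<and> x \<in> U \<longrightarrow> (\<exists>V\<in>B. x \<in> V \<and> V \<subseteq> U)"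
    using assms(2) unfolding second_countable_def by blast
  show ?thesis
    unfolding second_countable_def
  proof (intro exI[of _ "(\<lambda>(V, W). V \<times> W) ` (A \<times> B)"] conjI allI impI)
    show "countable ((\<lambda>(V, W). V \<times> W) ` (A \<times> B))" using A(1) B(1) by simp
    show "\<forall>V\<in>(\<lambda>(V, W). V \<times> W) ` (A \<times> B). openin (prod_topology X Y) V"
      using A(2) B(2) by (auto simp: openin_prod_Times_iff)
    fix U z assume U: "openin (prod_topology X Y) U \<and> z \<in> U"
    obtain x y where z: "z = (x, y)" by (cases z)
    obtain U1 U2 where U12: "openin X U1" "openin Y U2" "x \<in> U1" "y \<in> U2" "U1 \<times> U2 \<subseteq> U"
      using U unfolding z openin_prod_topology_alt by blast
    obtain V1 where V1: "V1 \<in> A" "x \<in> V1" "V1 \<subseteq> U1" using A(3) U12 by blast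
    obtain V2 where V2: "V2 \<in> B" "y \<in> V2" "V2 \<subseteq> U2" using B(3) U12 by blast
    have "V1 \<times> V2 \<in> (\<lambda>(V, W). V \<times> W) ` (A \<times> B)" using V1 V2 by auto
    moreover have "z \<in> V1 \<times> V2 \<and> V1 \<times> V2 \<subseteq> U" unfolding z using V1 V2 U12(5) by auto
    ultimately show "\<exists>V\<in>(\<lambda>(V, W). V \<times> W) ` (A \<times> B). z \<in> V \<and> V \<subseteq> U" by blast
  qed
qed

lemma general_positionD:
  assumes "general_position S M f" "(V, \<psi>) \<in> atlas M" "y \<in> V" "finite F" "F \<subseteq> {s \<in> points S. f s = y}"
  shows "dim (\<Inter>s\<in>F. tangent_image S f \<psi> s) + card F = 3"
proof -
  have "\<forall>y\<in>V. \<forall>F. finite F \<and> F \<subseteq> {s \<in> points S. f s = y} \<longrightarrow> dim (\<Inter>s\<in>F. tangent_image S f \<psi> s) + card F = 3"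
    using bspec[OF assms(1)[unfolded general_position_def] assms(2)] unfolding prod.case .
  from mp[OF spec[OF bspec[OF this assms(3)], of F] conjI[OF assms(4,5)]] show ?thesis .
qed

context surface_pullback
begin

lemma X_Hausdorff: "Hausdorff_space X"
proof -
  have "Hausdorff_space (subtopology (prod_topology (mtop S) (mtop N)) {(s, x). f s = p x})"
    using S N unfolding smooth_manifold_def by (simp add: Hausdorff_space_subtopology Hausdorff_space_prod_topology)
  then show ?thesis using X homeomorphic_Hausdorff_space homeomorphic_space by blast
qed

lemma X_second_countable: "second_countable X"
proof -
  have "second_countable (subtopology (prod_topology (mtop S) (mtop N)) {(s, x). f s = p x})"
    using S N unfolding smooth_manifold_def
    by (intro second_countable_subtopology) (simp add: second_countable_prod)
  then show ?thesis using X homeomorphic_space_second_countability homeomorphic_space by blast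
qed

lemma X_compact:
  assumes "compact_space (mtop S)" "compact_space (mtop N)"
  shows "compact_space X"
proof -
  let ?P = "prod_topology (mtop S) (mtop N)"
  have HM: "Hausdorff_space (mtop M)" using M unfolding smooth_manifold_def by blast
  have cf: "continuous_map ?P (mtop M) (f \<circ> fst)" "continuous_map ?P (mtop M) (p \<circ> snd)"
    using continuous_map_compose[OF continuous_map_fst f_continuous] continuous_map_compose[OF continuous_map_snd p_continuous] by auto
  have "closedin ?P {z \<in> topspace ?P. (f \<circ> fst) z = (p \<circ> snd) z}"
    by (rule closedin_continuous_maps_eq[OF HM cf])
  moreover have "{z \<in> topspace ?P. (f \<circ> fst) z = (p \<circ> snd) z} = topspace ?P \<inter> {(s, x). f s = p x}" by auto
  ultimately have "compactin ?P (topspace ?P \<inter> {(s, x). f s = p x})"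
    using assms by (intro closedin_compact_space) (simp_all add: compact_space_prod_topology)
  then have "compact_space (subtopology ?P {(s, x). f s = p x})"
    by (metis compact_space_subtopology subtopology_restrict)
  then show ?thesis using X homeomorphic_compact_space homeomorphic_space by blast
qed

text \<open>By definition \<open>singular_points\<close> sees only fibres with two or three points.
  General position has to bound the fibre by three first, also to exclude an infinite one, whose
  \<open>card\<close> is \<open>0\<close>; then two distinct points contradict
  \<open>nonsing\<close>.\<close>

lemma fibre_over_K:
  assumes s: "s \<in> points S" "s' \<in> points S" "f s = f s'" "f s \<in> K"
  shows "s = s'"
proof (rule ccontr)
  assume ne: "s \<noteq> s'"
  let ?F = "{t \<in> points S. f t = f s}"
  obtain V \<psi> where V: "(V, \<psi>) \<in> atlas M" "f s \<in> V" by (rule atlas_chart_at[OF M f_points[OF s(1)]])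
  have le: "card F \<le> 3" if "finite F" "F \<subseteq> ?F" for F
    using general_positionD[OF gp V that] by linarith
  have "finite ?F"
  proof (rule ccontr)
    assume "infinite ?F"
    then obtain F where "finite F" "card F = 4" "F \<subseteq> ?F" using infinite_arbitrarily_large by blast
    then show False using le by force
  qed
  moreover have "{s, s'} \<subseteq> ?F" using s by auto
  ultimately have "card {s, s'} \<le> card ?F" by (rule card_mono)
  then have "card ?F \<ge> 2" using ne by simp
  moreover have "card ?F \<le> 3" using le \<open>finite ?F\<close> by blast
  ultimately have "card ?F \<in> {2, 3}" by auto
  then have "f s \<in> singular_points S f" unfolding singular_points_def by simp
  then show False using nonsing s by blast
qed

lemma b_fibre_bij:
  assumes "x \<in> points N"
  shows "bij_betw a {r \<in> topspace X. b r = x} {s \<in> points S. f s = p x}"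
  unfolding bij_betw_def
proof
  show "inj_on a {r \<in> topspace X. b r = x}" by (rule inj_onI) (use X_inj in auto)
  show "a ` {r \<in> topspace X. b r = x} = {s \<in> points S. f s = p x}"
    using X_points X_ex assms by (auto simp: image_iff) metis
qed

text \<open>Transfers the counts that define double and triple points. Outside
  \<open>points N\<close> the value of \<open>p\<close> is arbitrary, hence the case
  \<open>0\<close>.\<close>

lemma b_fibre_card:
  "card {r \<in> topspace X. b r = x} = (if x \<in> points N then card {s \<in> points S. f s = p x} else 0)"
proof (cases "x \<in> points N")
  case True then show ?thesis using bij_betw_same_card[OF b_fibre_bij] by simp
next
  case False then have "{r \<in> topspace X. b r = x} = {}" using X_points by auto
  then have "card {r \<in> topspace X. b r = x} = 0" by (simp only: card.empty)
  then show ?thesis using False by simp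
qed

lemma image_b: "b ` topspace X = {x \<in> points N. p x \<in> f ` points S}"
proof
  show "b ` topspace X \<subseteq> {x \<in> points N. p x \<in> f ` points S}" using X_points by (metis (mono_tags, lifting) image_eqI image_subsetI mem_Collect_eq)
  show "{x \<in> points N. p x \<in> f ` points S} \<subseteq> b ` topspace X"
  proof
    fix x assume "x \<in> {x \<in> points N. p x \<in> f ` points S}"
    then obtain s where "x \<in> points N" "s \<in> points S" "f s = p x" by auto
    then show "x \<in> b ` topspace X" using X_ex by blast
  qed
qed

text \<open>Keeping a single chart around each branch point reduces the orientation condition to
  unbranched points.\<close>

lemma pchart_atlas:
  obtains At where "\<And>U \<eta>. (U, \<eta>) \<in> At \<Longrightarrow> pchart U \<eta>"
    "\<And>r. r \<in> topspace X \<Longrightarrow> \<exists>U \<eta>. (U, \<eta>) \<in> At \<and> r \<in> U"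
    "\<And>U \<eta> U' \<eta>' r. (U, \<eta>) \<in> At \<Longrightarrow> (U', \<eta>') \<in> At \<Longrightarrow> r \<in> U \<Longrightarrow> r \<in> U' \<Longrightarrow> p (b r) \<in> K \<Longrightarrow> U = U' \<and> \<eta> = \<eta>'"
proof -
  define Br where "Br = {r \<in> topspace X. p (b r) \<in> K}"
  have "\<exists>U \<eta>. pchart U \<eta> \<and> r0 \<in> U \<and> (\<forall>r\<in>U. p (b r) \<in> K \<longrightarrow> r = r0)" if "r0 \<in> Br" for r0
  proof -
    have r0: "r0 \<in> topspace X" "p (b r0) \<in> K" using that unfolding Br_def by auto
    show ?thesis by (rule pchart_branched[OF r0]) blast
  qed
  then obtain cU c\<eta> where c: "\<And>r0. r0 \<in> Br \<Longrightarrow> pchart (cU r0) (c\<eta> r0) \<and> r0 \<in> cU r0 \<and> (\<forall>r\<in>cU r0. p (b r) \<in> K \<longrightarrow> r = r0)"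
    by metis
  define At where "At = {(U, \<eta>). pchart U \<eta> \<and> (\<forall>r\<in>U. p (b r) \<notin> K)} \<union> (\<lambda>r. (cU r, c\<eta> r)) ` Br"
  show thesis
  proof (rule that[of At])
    show "pchart U \<eta>" if "(U, \<eta>) \<in> At" for U \<eta> using that c unfolding At_def by auto
    show "\<exists>U \<eta>. (U, \<eta>) \<in> At \<and> r \<in> U" if r: "r \<in> topspace X" for r
    proof (cases "p (b r) \<in> K")
      case True
      then have "r \<in> Br" using r unfolding Br_def by simp
      then have "(cU r, c\<eta> r) \<in> At" "r \<in> cU r" using c unfolding At_def by auto
      then show ?thesis by blast
    next
      case False
      obtain U \<eta> where "pchart U \<eta>" "r \<in> U" "\<And>r. r \<in> U \<Longrightarrow> p (b r) \<notin> K" by (rule pchart_unbranched[OF r False]) blast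
      then show ?thesis unfolding At_def by blast
    qed
    show "U = U' \<and> \<eta> = \<eta>'"
      if *: "(U, \<eta>) \<in> At" "(U', \<eta>') \<in> At" "r \<in> U" "r \<in> U'" "p (b r) \<in> K" for U \<eta> U' \<eta>' r
    proof -
      have "U = cU r \<and> \<eta> = c\<eta> r" using *(1,3,5) c unfolding At_def by auto
      moreover have "U' = cU r \<and> \<eta>' = c\<eta> r" using *(2,4,5) c unfolding At_def by auto
      ultimately show ?thesis by blast
    qed
  qed
qed

lemma p_derivative_bij:
  assumes V: "smooth_chart N V (\<psi> :: 'b \<Rightarrow> real ^ 3)" "y \<in> V" and C: "smooth_chart M C (\<gamma> :: 'a \<Rightarrow> real ^ 3)" "p y \<in> C"
    and y: "p y \<notin> K"
  shows "bij (frechet_derivative (\<gamma> \<circ> p \<circ> inv_into V \<psi>) (at (\<psi> y)))"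
    "linear (frechet_derivative (\<gamma> \<circ> p \<circ> inv_into V \<psi>) (at (\<psi> y)))"
proof -
  note tV = topological_chart_facts[OF smooth_chart_topological[OF V(1)]]
  have yN: "y \<in> points N" using V tV(2) by blast
  obtain V' W where V': "y \<in> V'" "openin (mtop N) V'" "openin (mtop M) W" "W \<inter> K = {}" "diffeomorphism_on N V' M W p"
    by (rule local_diffeomorphism[OF yN y])
  have bij: "bij_betw p V' W" and sq: "smooth_map_on M W N (inv_into V' p)"
    using V'(5) unfolding diffeomorphism_on_def by auto
  define q where "q = inv_into V' p"
  define D where "D = \<psi> ` (V \<inter> V')"
  have oD: "open D" unfolding D_def by (rule tV(7)) (use tV(1) V'(2) in auto)
  have yD: "\<psi> y \<in> D" unfolding D_def using V V' by blast
  have i: "inv_into V \<psi> (\<psi> y) = y" using tV(3) V(2) by simp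
  have sV: "smooth_into N D (inv_into V \<psi>)"
    unfolding D_def by (rule smooth_into_subset[OF smooth_into_chart_inverse[OF V(1)]]) auto
  have iD: "inv_into V \<psi> w \<in> V \<inter> V'" if "w \<in> D" for w using that tV(3) unfolding D_def by auto
  have sp: "smooth_into M D (p \<circ> inv_into V \<psi>)"
    by (rule smooth_into_smooth_map[OF N M pm oD sV]) (use iD tV(2) in auto)
  have qp: "q (p x) = x" if "x \<in> V'" for x unfolding q_def using bij that by (simp add: bij_betw_def)
  have pW: "p x \<in> W" if "x \<in> V'" for x using bij_betw_apply[OF bij that] .
  have dp: "(\<gamma> \<circ> p \<circ> inv_into V \<psi>) differentiable (at (\<psi> y))"
    by (rule smooth_map_on_chart_differentiable[OF N M pm V(1) C(1) V(2) yN C(2)])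
  then show lin: "linear (frechet_derivative (\<gamma> \<circ> p \<circ> inv_into V \<psi>) (at (\<psi> y)))"
    by (rule linear_frechet_derivative)
  have "frechet_derivative (\<psi> \<circ> q \<circ> (p \<circ> inv_into V \<psi>)) (at (\<psi> y)) =
     frechet_derivative (\<psi> \<circ> q \<circ> inv_into C \<gamma>) (at (\<gamma> ((p \<circ> inv_into V \<psi>) (\<psi> y)))) \<circ>
       frechet_derivative (\<gamma> \<circ> (p \<circ> inv_into V \<psi>)) (at (\<psi> y))"
    by (rule frechet_derivative_smooth_map[OF M N sq[folded q_def] C(1) V(1) oD sp yD])
      (use i C V V' pW qp in auto)
  moreover have "frechet_derivative (\<psi> \<circ> q \<circ> (p \<circ> inv_into V \<psi>)) (at (\<psi> y)) = frechet_derivative (\<psi> \<circ> inv_into V \<psi>) (at (\<psi> y))"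
    by (rule frechet_derivative_cong_open(1)[OF oD yD]) (use iD qp in auto)
  moreover have "frechet_derivative (\<psi> \<circ> inv_into V \<psi>) (at (\<psi> y)) = id"
    by (rule frechet_derivative_chart_self[OF smooth_chart_topological[OF V(1)] V(2)])
  ultimately have "frechet_derivative (\<psi> \<circ> q \<circ> inv_into C \<gamma>) (at (\<gamma> ((p \<circ> inv_into V \<psi>) (\<psi> y)))) \<circ>
       frechet_derivative (\<gamma> \<circ> p \<circ> inv_into V \<psi>) (at (\<psi> y)) = id"
    by (simp add: o_assoc)
  then have "inj (frechet_derivative (\<gamma> \<circ> p \<circ> inv_into V \<psi>) (at (\<psi> y)))" by (metis inj_on_id inj_on_imageI2)
  then show "bij (frechet_derivative (\<gamma> \<circ> p \<circ> inv_into V \<psi>) (at (\<psi> y)))"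
    using lin linear_injective_imp_surjective by (metis bij_def)
qed

text \<open>General position is checked in two ways. Over \<open>K\<close> only one sheet passes, so
  immersivity suffices. Off \<open>K\<close> the derivative \<open>L\<close> of \<open>p\<close> is
  an isomorphism that carries the tangent planes of the lifted sheets to those of the sheets of
  \<open>f\<close>.\<close>

lemma lifted_surface:
  assumes "compact_space (mtop S)" "compact_space (mtop N)"
  obtains Sh :: "('c, real ^ 2) mfd" where "mtop Sh = X" "Dehn_immersion Sh N b"
proof -
  obtain At where At: "\<And>U \<eta>. (U, \<eta>) \<in> At \<Longrightarrow> pchart U \<eta>"
    "\<And>r. r \<in> topspace X \<Longrightarrow> \<exists>U \<eta>. (U, \<eta>) \<in> At \<and> r \<in> U"
    "\<And>U \<eta> U' \<eta>' r. (U, \<eta>) \<in> At \<Longrightarrow> (U', \<eta>') \<in> At \<Longrightarrow> r \<in> U \<Longrightarrow> r \<in> U' \<Longrightarrow> p (b r) \<in> K \<Longrightarrow> U = U' \<and> \<eta> = \<eta>'"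
    by (rule pchart_atlas) blast
  define Sh where "Sh = \<lparr>mtop = X, atlas = At\<rparr>"
  have Sh [simp]: "mtop Sh = X" "atlas Sh = At" unfolding Sh_def by auto
  have AtX: "U \<subseteq> topspace X" if "(U, \<eta>) \<in> At" for U \<eta>
    using topological_chart_facts(2)[OF pchartD(1)[OF At(1)[OF that]]] .
  have mSh: "smooth_manifold Sh"
    unfolding smooth_manifold_def
  proof (intro conjI)
    show "Hausdorff_space (mtop Sh)" "second_countable (mtop Sh)" using X_Hausdorff X_second_countable by auto
    show "\<forall>(U, \<phi>)\<in>atlas Sh. topological_chart (mtop Sh) U \<phi>" using At(1) pchartD(1) by auto
    show "(\<Union>(U, \<phi>)\<in>atlas Sh. U) = points Sh"
    proof
      show "(\<Union>(U, \<phi>)\<in>atlas Sh. U) \<subseteq> points Sh" using AtX by auto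
      show "points Sh \<subseteq> (\<Union>(U, \<phi>)\<in>atlas Sh. U)" using At(2) by fastforce
    qed
    show "\<forall>(U, \<phi>)\<in>atlas Sh. \<forall>(V, \<psi>)\<in>atlas Sh. smooth_on (\<psi> \<circ> inv_into U \<phi>) (\<phi> ` (U \<inter> V))"
      using pchart_transition_smooth[OF At(1) At(1)] by auto
  qed
  have ori: "orientable Sh"
    unfolding orientable_def
  proof (intro exI[of _ At] conjI)
    show "\<forall>(U, \<phi>)\<in>At. smooth_chart Sh U \<phi>" using atlas_smooth_chart[OF mSh] by auto
    show "(\<Union>(U, \<phi>)\<in>At. U) = points Sh" using mSh unfolding smooth_manifold_def by simp
    have "det (matrix (frechet_derivative (\<eta>' \<circ> inv_into U \<eta>) (at (\<eta> r)))) > 0"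
      if c: "(U, \<eta>) \<in> At" "(U', \<eta>') \<in> At" "r \<in> U" "r \<in> U'" for U \<eta> U' \<eta>' r
    proof (cases "p (b r) \<in> K")
      case False then show ?thesis using pchart_transition_det[OF At(1) At(1)] c by blast
    next
      case True
      then have "U' = U" "\<eta>' = \<eta>" using At(3)[OF c] by auto
      then have "frechet_derivative (\<eta>' \<circ> inv_into U \<eta>) (at (\<eta> r)) = id"
        using frechet_derivative_chart_self[OF pchartD(1)[OF At(1)[OF c(1)]] c(3)] by simp
      then show ?thesis by (simp only: matrix_id_mat_1 det_I zero_less_one)
    qed
    then show "\<forall>(U, \<phi>)\<in>At. \<forall>(V, \<psi>)\<in>At. \<forall>x\<in>U \<inter> V. 0 < det (matrix (frechet_derivative (\<psi> \<circ> inv_into U \<phi>) (at (\<phi> x))))"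
      by auto
  qed
  have sb: "smooth_map_on Sh (points Sh) N b"
    unfolding smooth_map_on_def
  proof (intro conjI)
    show "openin (mtop Sh) (points Sh)" by simp
    show "continuous_map (subtopology (mtop Sh) (points Sh)) (mtop N) b" using b_continuous by simp
    have "smooth_on (\<psi> \<circ> b \<circ> inv_into U \<phi>) (\<phi> ` {x \<in> U \<inter> points Sh. b x \<in> V})"
      if U: "(U, \<phi>) \<in> At" and V: "(V, \<psi>) \<in> atlas N" for U \<phi> V \<psi>
    proof -
      note t = topological_chart_facts[OF pchartD(1)[OF At(1)[OF U]]]
      have "{w \<in> \<phi> ` U. (b \<circ> inv_into U \<phi>) w \<in> V} = \<phi> ` {x \<in> U \<inter> points Sh. b x \<in> V}"
        using t(2,3) by auto
      then show ?thesis using smooth_into_atlas[OF pchartD(3)[OF At(1)[OF U]] V] by (simp add: o_assoc)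
    qed
    then show "\<forall>(U, \<phi>)\<in>atlas Sh. \<forall>(V, \<psi>)\<in>atlas N. smooth_on (\<psi> \<circ> b \<circ> inv_into U \<phi>) (\<phi> ` {x \<in> U \<inter> points Sh. b x \<in> V})"
      by auto
  qed
  have inj: "inj (frechet_derivative (\<psi> \<circ> b \<circ> inv_into U \<phi>) (at (\<phi> r)))"
    if "(U, \<phi>) \<in> At" "smooth_chart N V (\<psi> :: 'b \<Rightarrow> real ^ 3)" "r \<in> U" "b r \<in> V" for U \<phi> V \<psi> r
    using pchart_immersive[OF At(1)[OF that(1)] that(3,2,4)] by (simp add: o_assoc)
  have immb: "immersion Sh N b"
    unfolding immersion_def
  proof (intro conjI ballI sb, clarify)
    fix U \<phi> V s and \<psi> :: "'b \<Rightarrow> real ^ 3"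
    assume "(U, \<phi>) \<in> atlas Sh" "(V, \<psi>) \<in> atlas N" "s \<in> U" "b s \<in> V"
    then show "inj (frechet_derivative (\<psi> \<circ> b \<circ> inv_into U \<phi>) (at (\<phi> s)))"
      using inj[of U \<phi> V \<psi> s] atlas_smooth_chart[OF N, of V \<psi>] by simp
  qed
  have gpb: "general_position Sh N b"
    unfolding general_position_def
  proof (intro ballI allI impI, clarify)
    fix V and \<psi> :: "'b \<Rightarrow> real ^ 3" and y F
    assume V: "(V, \<psi>) \<in> atlas N" and y: "y \<in> V" and F: "finite F" "F \<subseteq> {r \<in> points Sh. b r = y}"
    have cV: "smooth_chart N V \<psi>" by (rule atlas_smooth_chart[OF N V])
    have rF: "r \<in> topspace X" "b r = y" if "r \<in> F" for r using F that by auto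
    have yN: "y \<in> points N" using topological_chart_facts(2)[OF smooth_chart_topological[OF cV]] y by blast
    have ti: "tangent_image Sh b \<psi> r = range (frechet_derivative (\<psi> \<circ> b \<circ> inv_into U \<eta>) (at (\<eta> r)))"
      "linear (frechet_derivative (\<psi> \<circ> b \<circ> inv_into U \<eta>) (at (\<eta> r)))"
      if r: "r \<in> F" "(U, \<eta>) \<in> At" "r \<in> U" for r U \<eta>
    proof -
      have cU: "smooth_chart Sh U \<eta>" using atlas_smooth_chart[OF mSh] r by simp
      have d: "(\<psi> \<circ> b \<circ> inv_into U \<eta>) differentiable (at (\<eta> r))"
        by (rule smooth_map_on_chart_differentiable[OF mSh N sb cU cV r(3)]) (use rF[OF r(1)] y in auto)
      show "tangent_image Sh b \<psi> r = range (frechet_derivative (\<psi> \<circ> b \<circ> inv_into U \<eta>) (at (\<eta> r)))"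
        by (rule tangent_image_eq[OF mSh cU r(3) d])
      show "linear (frechet_derivative (\<psi> \<circ> b \<circ> inv_into U \<eta>) (at (\<eta> r)))" by (rule linear_frechet_derivative[OF d])
    qed
    show "dim (\<Inter>r\<in>F. tangent_image Sh b \<psi> r) + card F = 3"
    proof (cases "F = {}")
      \<comment> \<open>The intersection over the empty family is the whole tangent space, of
        dimension \<open>3\<close>.\<close>
      case True then show ?thesis by simp
    next
      case F0: False
      show ?thesis
      proof (cases "p y \<in> K")
        case True
        obtain r where r: "r \<in> F" using F0 by blast
        have "r' = r" if "r' \<in> F" for r'
        proof (rule X_inj)
          show "a r' = a r"
            by (rule fibre_over_K) (use X_points[OF rF(1)[OF r]] X_points[OF rF(1)[OF that]] rF(2)[OF r] rF(2)[OF that] True in auto)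
        qed (use rF r that in auto)
        then have Fr: "F = {r}" using r by blast
        obtain U \<eta> where U: "(U, \<eta>) \<in> At" "r \<in> U" using At(2)[OF rF(1)[OF r]] by blast
        have "dim (range (frechet_derivative (\<psi> \<circ> b \<circ> inv_into U \<eta>) (at (\<eta> r)))) = dim (UNIV :: (real ^ 2) set)"
          by (rule dim_image_eq[OF ti(2)[OF r U]])
            (use inj[OF U(1) cV U(2)] rF(2)[OF r] y in \<open>auto intro: inj_on_subset\<close>)
        then show ?thesis unfolding Fr by (simp add: ti(1)[OF r U])
      next
        case False
        obtain C \<gamma> where C: "(C, \<gamma>) \<in> atlas M" "p y \<in> C" by (rule atlas_chart_at[OF M p_points[OF yN]])
        have cC: "smooth_chart M C \<gamma>" by (rule atlas_smooth_chart[OF M C(1)])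
        define L where "L = frechet_derivative (\<gamma> \<circ> p \<circ> inv_into V \<psi>) (at (\<psi> y))"
        have L: "bij L" "linear L" unfolding L_def using p_derivative_bij[OF cV y cC C(2) False] by auto
        have LT: "L ` tangent_image Sh b \<psi> r = tangent_image S f \<gamma> (a r)" if r: "r \<in> F" for r
        proof -
          note rX = rF(1)[OF r] and br = rF(2)[OF r]
          obtain U \<eta> where U: "(U, \<eta>) \<in> At" "r \<in> U" using At(2)[OF rX] by blast
          note pU = At(1)[OF U(1)]
          note t = topological_chart_facts[OF pchartD(1)[OF pU]]
          obtain A \<beta> where A: "(A, \<beta>) \<in> B" "a r \<in> A" using oriented_atlasD(3)[OF B] X_points[OF rX] by blast
          have cA: "smooth_chart S A \<beta>" by (rule oriented_atlasD(1)[OF B A(1)])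
          have rD: "\<eta> r \<in> \<eta> ` U" using U by blast
          have i: "inv_into U \<eta> (\<eta> r) = r" using t(3) U by simp
          have fa: "f (a r) = p y" "a r \<in> points S" using X_points[OF rX] br by auto
          let ?T = "frechet_derivative (\<beta> \<circ> (a \<circ> inv_into U \<eta>)) (at (\<eta> r))"
          have dT: "(\<beta> \<circ> (a \<circ> inv_into U \<eta>)) differentiable (at (\<eta> r))"
            by (rule smooth_into_chart_differentiable[OF S t(4) pchartD(2)[OF pU] cA rD]) (use i A in auto)
          have linT: "linear ?T" by (rule linear_frechet_derivative[OF dT])
          have "det (matrix ?T) > 0" by (rule pchartD(5)[OF pU U(2) _ A]) (use False br in auto)
          then have "inj ?T" using det_nz_iff_inj[OF linT] by auto
          then have surjT: "surj ?T" using linear_injective_imp_surjective[OF linT] by blast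
          have 1: "frechet_derivative (\<gamma> \<circ> f \<circ> (a \<circ> inv_into U \<eta>)) (at (\<eta> r)) =
              frechet_derivative (\<gamma> \<circ> f \<circ> inv_into A \<beta>) (at (\<beta> (a r))) \<circ> ?T"
            using frechet_derivative_smooth_map[OF S M f_smooth cA cC t(4) pchartD(2)[OF pU] rD] A(2) fa C(2) i by simp
          have 2: "frechet_derivative (\<gamma> \<circ> p \<circ> (b \<circ> inv_into U \<eta>)) (at (\<eta> r)) =
              L \<circ> frechet_derivative (\<psi> \<circ> (b \<circ> inv_into U \<eta>)) (at (\<eta> r))"
            using frechet_derivative_smooth_map[OF N M pm cV cC t(4) pchartD(3)[OF pU] rD] y yN br C(2) i
            unfolding L_def by simp
          have 3: "frechet_derivative (\<gamma> \<circ> f \<circ> (a \<circ> inv_into U \<eta>)) (at (\<eta> r)) = frechet_derivative (\<gamma> \<circ> p \<circ> (b \<circ> inv_into U \<eta>)) (at (\<eta> r))"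
            by (rule frechet_derivative_cong_open(1)[OF t(4) rD]) (use t(2,3) X_points in \<open>auto simp: subset_iff\<close>)
          have dS: "(\<gamma> \<circ> f \<circ> inv_into A \<beta>) differentiable (at (\<beta> (a r)))"
            by (rule smooth_map_on_chart_differentiable[OF S M f_smooth cA cC A(2) fa(2)]) (use fa C in auto)
          have "tangent_image S f \<gamma> (a r) = range (frechet_derivative (\<gamma> \<circ> f \<circ> inv_into A \<beta>) (at (\<beta> (a r))))"
            by (rule tangent_image_eq[OF S cA A(2) dS])
          also have "\<dots> = frechet_derivative (\<gamma> \<circ> f \<circ> inv_into A \<beta>) (at (\<beta> (a r))) ` range ?T" using surjT by simp
          also have "\<dots> = range (L \<circ> frechet_derivative (\<psi> \<circ> (b \<circ> inv_into U \<eta>)) (at (\<eta> r)))"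
            using 1 2 3 by (simp only: image_comp)
          also have "\<dots> = L ` tangent_image Sh b \<psi> r"
            unfolding ti(1)[OF r U] by (simp only: image_comp o_assoc)
          finally show ?thesis by simp
        qed
        have inja: "inj_on a F" by (rule inj_onI) (use X_inj rF in metis)
        have aF: "a ` F \<subseteq> {s \<in> points S. f s = p y}" using rF X_points by auto
        have "dim (\<Inter>s\<in>a ` F. tangent_image S f \<gamma> s) + card (a ` F) = 3"
          by (rule general_positionD[OF gp C finite_imageI[OF F(1)] aF])
        moreover have "(\<Inter>s\<in>a ` F. tangent_image S f \<gamma> s) = L ` (\<Inter>r\<in>F. tangent_image Sh b \<psi> r)"
        proof -
          obtain r0 where "r0 \<in> F" using F0 by blast
          then have "L ` (\<Inter>r\<in>F. tangent_image Sh b \<psi> r) = (\<Inter>r\<in>F. L ` tangent_image Sh b \<psi> r)"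
            using image_INT[of L UNIV F "tangent_image Sh b \<psi>" r0] bij_is_inj[OF L(1)] by simp
          then show ?thesis using LT by simp
        qed
        moreover have "dim (L ` (\<Inter>r\<in>F. tangent_image Sh b \<psi> r)) = dim (\<Inter>r\<in>F. tangent_image Sh b \<psi> r)"
          by (rule dim_image_eq[OF L(2)]) (use bij_is_inj[OF L(1)] inj_on_subset in blast)
        moreover have "card (a ` F) = card F" by (rule card_image[OF inja])
        ultimately show ?thesis by simp
      qed
    qed
  qed
  have "Dehn_immersion Sh N b"
    unfolding Dehn_immersion_def closed_orientable_surface_def
    using mSh ori immb gpb X_compact[OF assms] by simp
  then show thesis using that Sh(1) by blast
qed

end

section \<open>Lifting edges, faces and regions\<close>

text \<open>Produces the condition \<open>loc\<close> of \<open>branched_covering_component\<close>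
  from a punctured model \<open>Z\<close> of a neighbourhood \<open>G\<close>.\<close>

lemma dense_image_continuous:
  assumes g: "continuous_map (top_of_set G) N g" and Z: "connected Z" "Z \<subseteq> G" "G \<subseteq> closure Z"
  shows "connectedin N (g ` Z)" "g ` G \<subseteq> N closure_of (g ` Z)" "connectedin N (g ` G)"
proof -
  have "connectedin (top_of_set G) Z" using Z by (simp add: connectedin_subtopology)
  then show c: "connectedin N (g ` Z)" using connectedin_continuous_map_image[OF g] by blast
  have "G \<inter> Z = Z" "G \<inter> closure Z = G" using Z by blast+
  then have "top_of_set G closure_of Z = G" by (simp add: closure_of_subtopology)
  then show s: "g ` G \<subseteq> N closure_of (g ` Z)" using continuous_map_image_closure_subset[OF g, of Z] by simp
  show "connectedin N (g ` G)"
    by (rule connectedin_intermediate_closure_of[OF c _ s]) (use Z in auto)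
qed

lemma ball_subset_closure_punctured:
  fixes c :: "'e::euclidean_space"
  shows "ball c e \<subseteq> closure (ball c e - {c})"
proof -
  have "ball c e \<inter> closure (-{c}) \<subseteq> closure (ball c e \<inter> -{c})" by (rule open_Int_closure_subset) simp
  then show ?thesis by (simp add: closure_complement Diff_eq)
qed

lemma smooth_manifold_Hausdorff: "smooth_manifold M \<Longrightarrow> Hausdorff_space (mtop M)"
  unfolding smooth_manifold_def by (rule conjunct1)

context surface_pullback
begin

lemma finite_covering_off_K:
  "finite_covering (subtopology (mtop N) {x \<in> points N. p x \<in> points M - K}) (subtopology (mtop M) (points M - K)) p"
  unfolding finite_covering_def
proof (intro conjI ballI)
  let ?L = "points M - K" and ?P = "{x \<in> points N. p x \<in> points M - K}"
  show "continuous_map (subtopology (mtop N) ?P) (subtopology (mtop M) ?L) p"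
    using p_continuous by (auto simp: continuous_map_in_subtopology continuous_map_from_subtopology)
  fix y assume "y \<in> topspace (subtopology (mtop M) ?L)"
  then have "y \<in> ?L" by simp
  then obtain W where W: "openin (mtop M) W" "y \<in> W" "W \<inter> K = {}" "evenly_covered N M p n W" using cov by blast
  from W(4) obtain \<V> where V: "finite \<V>" "pairwise disjnt \<V>" "\<Union>\<V> = {x \<in> points N. p x \<in> W}"
    "\<forall>V\<in>\<V>. diffeomorphism_on N V M W p"
    unfolding evenly_covered_def by (elim exE conjE) (rule that)
  have WL: "W \<subseteq> ?L" using W(3) openin_subset[OF W(1)] by blast
  have VP: "V \<subseteq> ?P" if "V \<in> \<V>" for V
  proof -
    have "V \<subseteq> \<Union>\<V>" using that by blast
    then show ?thesis unfolding V(3) using WL by blast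
  qed
  have h: "openin (subtopology (mtop N) ?P) V \<and>
      homeomorphic_map (subtopology (subtopology (mtop N) ?P) V) (subtopology (subtopology (mtop M) ?L) W) p"
    if VV: "V \<in> \<V>" for V
  proof -
    have d: "diffeomorphism_on N V M W p" using V(4) VV by blast
    have bij: "bij_betw p V W" and oV: "openin (mtop N) V"
      and c1: "continuous_map (subtopology (mtop N) V) (mtop M) p"
      and c2: "continuous_map (subtopology (mtop M) W) (mtop N) (inv_into V p)"
      using d unfolding diffeomorphism_on_def smooth_map_on_def by auto
    have "homeomorphic_maps (subtopology (mtop N) V) (subtopology (mtop M) W) p (inv_into V p)"
      unfolding homeomorphic_maps_def
    proof (intro conjI ballI)
      show "continuous_map (subtopology (mtop N) V) (subtopology (mtop M) W) p"
        using c1 bij by (auto simp: continuous_map_in_subtopology bij_betw_def)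
      show "continuous_map (subtopology (mtop M) W) (subtopology (mtop N) V) (inv_into V p)"
        using c2 bij by (auto simp: continuous_map_in_subtopology bij_betw_def intro: inv_into_into)
      show "inv_into V p (p x) = x" if "x \<in> topspace (subtopology (mtop N) V)" for x
        using that bij by (simp add: bij_betw_def)
      show "p (inv_into V p x) = x" if "x \<in> topspace (subtopology (mtop M) W)" for x
        using that bij by (auto simp: bij_betw_def f_inv_into_f)
    qed
    then have "homeomorphic_map (subtopology (mtop N) V) (subtopology (mtop M) W) p"
      using homeomorphic_maps_map by blast
    moreover have "?P \<inter> V = V" "?L \<inter> W = W" using VP[OF VV] WL by blast+
    moreover have "openin (subtopology (mtop N) ?P) (?P \<inter> V)" by (rule openin_subtopology_Int2[OF oV])
    ultimately show ?thesis by (simp add: subtopology_subtopology)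
  qed
  show "\<exists>W \<V>. openin (subtopology (mtop M) ?L) W \<and> y \<in> W \<and> finite \<V> \<and> pairwise disjnt \<V> \<and>
      \<Union>\<V> = {x \<in> topspace (subtopology (mtop N) ?P). p x \<in> W} \<and>
      (\<forall>V\<in>\<V>. openin (subtopology (mtop N) ?P) V \<and>
        homeomorphic_map (subtopology (subtopology (mtop N) ?P) V) (subtopology (subtopology (mtop M) ?L) W) p)"
  proof (intro exI conjI)
    have "?L \<inter> W = W" using WL by blast
    then show "openin (subtopology (mtop M) ?L) W" using openin_subtopology_Int2[OF W(1), of ?L] by simp
    show "y \<in> W" "finite \<V>" "pairwise disjnt \<V>" using W(2) V(1,2) by auto
    show "\<Union>\<V> = {x \<in> topspace (subtopology (mtop N) ?P). p x \<in> W}" unfolding V(3) using WL by auto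
    show "\<forall>V\<in>\<V>. openin (subtopology (mtop N) ?P) V \<and>
        homeomorphic_map (subtopology (subtopology (mtop N) ?P) V) (subtopology (subtopology (mtop M) ?L) W) p"
      using h by blast
  qed
qed

text \<open>In a branched chart all points over \<open>y\<close> have complex coordinate
  \<open>0\<close> and equal height, so the chart contains just one of them. The fibre is therefore
  discrete, and closed in a compact space.\<close>

lemma finite_fibre_over_K:
  assumes cN: "compact_space (mtop N)" and y: "y \<in> K"
  shows "finite {x \<in> points N. p x = y}"
proof (cases "y \<in> points M")
  case False
  then have "{x \<in> points N. p x = y} = {}" using p_points by blast
  then show ?thesis by (simp only: finite.emptyI)
next
  case True
  let ?F = "{x \<in> points N. p x = y}"
  have "\<exists>U. openin (mtop N) U \<and> x \<in> U \<and> U \<inter> ?F \<subseteq> {x}" if x: "x \<in> ?F" for x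
  proof -
    have "x \<in> points N" "p x \<in> K" using x y by auto
    from branch[OF this] obtain k U V and \<phi> :: "'b \<Rightarrow> complex \<times> real" and \<psi> where k: "k \<ge> (1::nat)" and U: "x \<in> U" "smooth_chart N U \<phi>"
      and V: "slice_chart M K V \<psi>" "p ` U \<subseteq> V" and p\<phi>: "\<forall>u\<in>U. \<psi> (p u) = (fst (\<phi> u) ^ k, snd (\<phi> u))"
      by blast
    note tU = topological_chart_facts[OF smooth_chart_topological[OF U(2)]]
    have "u = x" if u: "u \<in> U" "p u = y" for u
    proof -
      have z: "fst (\<phi> v) = 0" if "v \<in> U" "p v = y" for v
        using branch_zero_iff[OF k V, of \<phi> v] p\<phi> that y by auto
      have "snd (\<phi> u) = snd (\<phi> x)" using p\<phi> u U(1) x by (metis (mono_tags, lifting) mem_Collect_eq snd_conv)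
      then have "\<phi> u = \<phi> x" using z[OF u] z[OF U(1)] x by (simp add: prod_eq_iff)
      then show ?thesis using inj_onD[OF tU(3)] u(1) U(1) by metis
    qed
    then have "U \<inter> ?F \<subseteq> {x}" by blast
    then show ?thesis using tU(1) U(1) by blast
  qed
  then have "\<forall>x\<in>?F. \<exists>U. openin (mtop N) U \<and> x \<in> U \<and> U \<inter> ?F \<subseteq> {x}" by (rule ballI)
  from bchoice[OF this] obtain U where "\<forall>x\<in>?F. openin (mtop N) (U x) \<and> x \<in> U x \<and> U x \<inter> ?F \<subseteq> {x}" ..
  then have U: "openin (mtop N) (U x) \<and> x \<in> U x \<and> U x \<inter> ?F \<subseteq> {x}" if "x \<in> ?F" for x
    by (rule bspec) (rule that)
  have "Hausdorff_space (mtop M)" by (rule smooth_manifold_Hausdorff[OF M])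
  then have "closedin (mtop M) {y}" using True by (simp add: closedin_Hausdorff_sing_eq)
  then have "closedin (mtop N) {x \<in> points N. p x \<in> {y}}" by (rule closedin_continuous_map_preimage[OF p_continuous])
  then have "compactin (mtop N) ?F" using closedin_compact_space[OF cN] by simp
  moreover have "?F \<subseteq> \<Union>(U ` ?F)" using U by blast
  moreover have "\<And>V. V \<in> U ` ?F \<Longrightarrow> openin (mtop N) V" using U by blast
  ultimately have "\<exists>\<F>. finite \<F> \<and> \<F> \<subseteq> U ` ?F \<and> ?F \<subseteq> \<Union>\<F>"
    by (intro compactinD) auto
  then obtain \<F> where \<F>: "finite \<F>" "\<F> \<subseteq> U ` ?F" "?F \<subseteq> \<Union>\<F>" by (elim exE conjE) (rule that)
  from finite_subset_image[OF \<F>(1,2)] obtain G where G: "finite G" "G \<subseteq> ?F" "\<F> = U ` G"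
    by (elim exE conjE) (rule that)
  have "?F \<subseteq> G"
  proof
    fix x assume x: "x \<in> ?F"
    then obtain z where z: "z \<in> G" "x \<in> U z" using \<F>(3) G(3) by blast
    then have "x = z" using U[of z] G(2) x by blast
    then show "x \<in> G" using z by simp
  qed
  then show ?thesis using G(1) finite_subset by blast
qed

text \<open>A disk times an interval in the branched chart stays connected and dense when the axis
  is removed, as a punctured disk is connected. Openness of \<open>Q\<close> lets the whole product
  be mapped into \<open>Q\<close>, and connectedness then keeps its image in
  \<open>A\<close>.\<close>

lemma region_local:
  assumes x: "x \<in> points N" "p x \<in> K" "p x \<in> A"
    and A: "A \<in> connected_components_of (subtopology (mtop M) Q)" and Q: "openin (mtop M) Q"
  shows "\<exists>U. openin (subtopology (mtop N) {x \<in> points N. p x \<in> A}) U \<and> x \<in> U \<and>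
     connectedin (mtop N) (U \<inter> {x. p x \<in> points M - K}) \<and> U \<subseteq> mtop N closure_of (U \<inter> {x. p x \<in> points M - K})"
proof -
  obtain k U0 V and \<phi> :: "'b \<Rightarrow> complex \<times> real" and \<psi> where k: "k \<ge> (1::nat)" and U0: "x \<in> U0" "smooth_chart N U0 \<phi>"
    and V: "slice_chart M K V \<psi>" "p ` U0 \<subseteq> V" and p\<phi>: "\<forall>u\<in>U0. \<psi> (p u) = (fst (\<phi> u) ^ k, snd (\<phi> u))"
    using branch[OF x(1,2)] by blast
  note tU = topological_chart_facts[OF smooth_chart_topological[OF U0(2)]]
  have zero: "p u \<in> K \<longleftrightarrow> fst (\<phi> u) = 0" if "u \<in> U0" for u
    using branch_zero_iff[OF k V, of \<phi> u] p\<phi> that by blast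
  have AQ: "A \<subseteq> Q" using connected_components_of_subset[OF A] by auto
  define U1 where "U1 = U0 \<inter> {u \<in> points N. p u \<in> Q}"
  have oU1: "openin (mtop N) U1"
    unfolding U1_def by (intro openin_Int tU(1) openin_continuous_map_preimage[OF p_continuous Q])
  have oP: "open (\<phi> ` U1)" by (rule tU(7)[OF oU1]) (auto simp: U1_def)
  obtain t0 where t0: "\<phi> x = (0, t0)" using zero[OF U0(1)] x(2) by (metis prod.collapse)
  have "(0, t0) \<in> \<phi> ` U1" using x U0 AQ unfolding U1_def t0[symmetric] by blast
  then obtain A1 B1 where AB: "open A1" "open B1" "0 \<in> A1" "t0 \<in> B1" "A1 \<times> B1 \<subseteq> \<phi> ` U1"
    using oP by (metis open_prod_elim mem_Sigma_iff)
  obtain e1 where e1: "e1 > 0" "ball 0 e1 \<subseteq> A1" using AB open_contains_ball by blast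
  obtain e2 where e2: "e2 > 0" "ball t0 e2 \<subseteq> B1" using AB open_contains_ball by blast
  define G where "G = ball (0::complex) e1 \<times> ball t0 e2"
  define Z where "Z = (ball (0::complex) e1 - {0}) \<times> ball t0 e2"
  define g where "g = inv_into U0 \<phi>"
  have GU: "G \<subseteq> \<phi> ` U1" unfolding G_def using e1 e2 AB(5) by blast
  have U10: "U1 \<subseteq> U0" unfolding U1_def by blast
  have gG: "g w \<in> U1" "\<phi> (g w) = w" if "w \<in> G" for w
  proof -
    obtain u where "u \<in> U1" "w = \<phi> u" using GU \<open>w \<in> G\<close> by blast
    then show "g w \<in> U1" "\<phi> (g w) = w" unfolding g_def using U10 tU(3) by auto
  qed
  have cg: "continuous_map (top_of_set G) (mtop N) g"
    unfolding g_def by (rule continuous_map_from_subtopology_mono[OF tU(6)]) (use GU U10 in blast)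
  have conn: "connected (ball (0::complex) e1 - {0})"
    by (rule connected_open_delete) auto
  have Z: "connected Z" "Z \<subseteq> G" "G \<subseteq> closure Z"
  proof -
    show "connected Z" unfolding Z_def by (rule connected_Times[OF conn]) simp
    show "Z \<subseteq> G" unfolding Z_def G_def by auto
    show "G \<subseteq> closure Z" unfolding Z_def G_def closure_Times
      using ball_subset_closure_punctured[of "0::complex" e1] closure_subset[of "ball t0 e2"] by blast
  qed
  note dn = dense_image_continuous[OF cg Z]
  define U where "U = g ` G"
  have U': "U = {u \<in> U1. \<phi> u \<in> G}"
  proof
    show "U \<subseteq> {u \<in> U1. \<phi> u \<in> G}" unfolding U_def using gG by auto
    show "{u \<in> U1. \<phi> u \<in> G} \<subseteq> U"
    proof
      fix u assume u: "u \<in> {u \<in> U1. \<phi> u \<in> G}"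
      then have "g (\<phi> u) = u" unfolding g_def using U10 tU(3) by auto
      then show "u \<in> U" unfolding U_def using u by (metis (mono_tags, lifting) imageI mem_Collect_eq)
    qed
  qed
  have "open G" unfolding G_def by (simp add: open_Times)
  then have oU: "openin (mtop N) U"
  proof -
    have "U = U1 \<inter> {u \<in> U0. \<phi> u \<in> G}" unfolding U' using U10 by blast
    then show ?thesis using openin_Int[OF oU1 tU(8)[OF \<open>open G\<close>]] by simp
  qed
  have xU: "x \<in> U" unfolding U' U1_def G_def using t0 x U0 AQ e1 e2 by auto
  have pU: "p ` U \<subseteq> A"
  proof -
    have "connectedin (mtop M) (p ` U)"
      using connectedin_continuous_map_image[OF p_continuous dn(3)] unfolding U_def .
    moreover have "p ` U \<subseteq> Q" unfolding U' U1_def by auto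
    ultimately have "connectedin (subtopology (mtop M) Q) (p ` U)" by (simp add: connectedin_subtopology)
    moreover have "\<not> disjnt A (p ` U)" using x xU by (auto simp: disjnt_iff)
    ultimately show ?thesis using connected_components_of_maximal[OF A] by blast
  qed
  have UN: "U \<subseteq> {x \<in> points N. p x \<in> A}" using openin_subset[OF oU] pU by blast
  have UZ: "U \<inter> {x. p x \<in> points M - K} = g ` Z"
  proof
    show "U \<inter> {x. p x \<in> points M - K} \<subseteq> g ` Z"
    proof
      fix u assume u: "u \<in> U \<inter> {x. p x \<in> points M - K}"
      then obtain w where w: "w \<in> G" "u = g w" unfolding U_def by blast
      have "fst w \<noteq> 0" using zero[of u] u gG[OF w(1)] w(2) U10 by auto
      then have "w \<in> Z" using w(1) unfolding Z_def G_def by (auto simp: mem_Times_iff)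
      then show "u \<in> g ` Z" using w by blast
    qed
    show "g ` Z \<subseteq> U \<inter> {x. p x \<in> points M - K}"
    proof
      fix u assume "u \<in> g ` Z"
      then obtain w where w: "w \<in> Z" "u = g w" by blast
      then have wG: "w \<in> G" using Z by blast
      have uU: "u \<in> U" unfolding U_def w(2) using wG by blast
      have "fst (\<phi> u) \<noteq> 0" using gG(2)[OF wG] w unfolding Z_def by auto
      then have "p u \<notin> K" using zero gG(1)[OF wG] w(2) U10 by blast
      then show "u \<in> U \<inter> {x. p x \<in> points M - K}" using uU UN p_points by auto
    qed
  qed
  have "{x \<in> points N. p x \<in> A} \<inter> U = U" using UN by blast
  then have "openin (subtopology (mtop N) {x \<in> points N. p x \<in> A}) U"
    using openin_subtopology_Int2[OF oU, of "{x \<in> points N. p x \<in> A}"] by simp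
  moreover have "connectedin (mtop N) (U \<inter> {x. p x \<in> points M - K})" unfolding UZ by (rule dn(1))
  moreover have "U \<subseteq> mtop N closure_of (U \<inter> {x. p x \<in> points M - K})" unfolding UZ unfolding U_def by (rule dn(2))
  ultimately show ?thesis using xU by (intro exI[of _ U] conjI)
qed

text \<open>The neighbourhood of \<open>x\<close> in the preimage of the face is the image of a
  small disk \<open>D\<close> in a chart of the fibre product. Removing the centre of the disk, its
  only point over \<open>K\<close>, leaves a connected dense part.\<close>

lemma face_local:
  assumes cS: "compact_space (mtop S)" and cN: "compact_space (mtop N)"
    and x: "x \<in> points N" "p x \<in> K" "p x \<in> A"
    and A: "A \<in> connected_components_of (subtopology (mtop M) (f ` points S - singular_points S f))"
  shows "\<exists>U. openin (subtopology (mtop N) {x \<in> points N. p x \<in> A}) U \<and> x \<in> U \<and>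
     connectedin (mtop N) (U \<inter> {x. p x \<in> points M - K}) \<and> U \<subseteq> mtop N closure_of (U \<inter> {x. p x \<in> points M - K})"
proof -
  define Q where "Q = f ` points S - singular_points S f"
  note A = A[folded Q_def]
  have HM: "Hausdorff_space (mtop M)" and HN: "Hausdorff_space (mtop N)"
    by (rule smooth_manifold_Hausdorff[OF M], rule smooth_manifold_Hausdorff[OF N])
  have AQ: "A \<subseteq> Q" using connected_components_of_subset[OF A] by auto
  then have "p x \<in> f ` points S" using x unfolding Q_def by blast
  then obtain s where s: "s \<in> points S" "f s = p x" by auto
  obtain r0 where r0: "r0 \<in> topspace X" "a r0 = s" "b r0 = x" using X_ex[OF s(1) x(1) s(2)] by blast
  have pr0: "p (b r0) \<in> K" using r0 x by simp
  obtain U \<eta> where U: "pchart U \<eta>" "r0 \<in> U" "\<And>r. r \<in> U \<Longrightarrow> p (b r) \<in> K \<Longrightarrow> r = r0"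
    and exA: "\<exists>A. openin (mtop S) A \<and> a r0 \<in> A \<and> inj_on f A"
    by (rule pchart_branched[OF r0(1) pr0]) blast
  obtain A1 where A1: "openin (mtop S) A1" "a r0 \<in> A1" "inj_on f A1" using exA by blast
  note t = topological_chart_facts[OF pchartD(1)[OF U(1)]]
  \<comment> \<open>Taking away the closed image of the part of \<open>S\<close> outside
    \<open>A1\<close> leaves a neighbourhood of \<open>p x\<close> over which \<open>f\<close> is
    injective.\<close>
  define W where "W = points M - f ` (points S - A1)"
  have "closed_map (mtop S) (mtop M) f" by (rule continuous_imp_closed_map[OF f_continuous cS HM])
  then have "closedin (mtop M) (f ` (points S - A1))"
    using A1(1) unfolding closed_map_def by blast
  then have oW: "openin (mtop M) W" unfolding W_def by blast
  have WA: "t \<in> A1" if "t \<in> points S" "f t \<in> W" for t using that unfolding W_def by blast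
  have Winj: "t = t'" if "t \<in> points S" "t' \<in> points S" "f t = f t'" "f t \<in> W" for t t'
    using inj_onD[OF A1(3) that(3)] WA that by metis
  have pxW: "p x \<in> W"
  proof -
    have "p x \<notin> f ` (points S - A1)"
    proof
      assume "p x \<in> f ` (points S - A1)"
      then obtain t where t: "t \<in> points S" "t \<notin> A1" "f t = p x" by auto
      have "t = s" by (rule fibre_over_K) (use t s x in auto)
      then show False using t A1 r0 by simp
    qed
    then show ?thesis unfolding W_def using p_points[OF x(1)] by blast
  qed
  define U1 where "U1 = U \<inter> {r \<in> topspace X. (f \<circ> a) r \<in> W}"
  have cfa: "continuous_map X (mtop M) (f \<circ> a)" by (rule continuous_map_compose[OF a_continuous f_continuous])
  have oU1: "openin X U1"
    unfolding U1_def by (intro openin_Int t(1) openin_continuous_map_preimage[OF cfa oW])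
  have U1U: "U1 \<subseteq> U" unfolding U1_def by blast
  have r0U1: "r0 \<in> U1" unfolding U1_def using U(2) r0 s pxW by simp
  have "open (\<eta> ` U1)" by (rule t(7)[OF oU1 U1U])
  then obtain e where e: "e > 0" "ball (\<eta> r0) e \<subseteq> \<eta> ` U1" using r0U1 open_contains_ball by blast
  define G where "G = ball (\<eta> r0) e"
  define g where "g = inv_into U \<eta>"
  have gG: "g w \<in> U1" "\<eta> (g w) = w" if "w \<in> G" for w
  proof -
    obtain u where "u \<in> U1" "w = \<eta> u" using e(2) \<open>w \<in> G\<close> unfolding G_def by blast
    then show "g w \<in> U1" "\<eta> (g w) = w" unfolding g_def using U1U t(3) by auto
  qed
  define D where "D = g ` G"
  have D': "D = {r \<in> U1. \<eta> r \<in> G}"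
  proof
    show "D \<subseteq> {r \<in> U1. \<eta> r \<in> G}" unfolding D_def using gG by auto
    show "{r \<in> U1. \<eta> r \<in> G} \<subseteq> D"
    proof
      fix u assume u: "u \<in> {r \<in> U1. \<eta> r \<in> G}"
      then have "g (\<eta> u) = u" unfolding g_def using U1U t(3) by auto
      then show "u \<in> D" unfolding D_def using u by (metis (mono_tags, lifting) imageI mem_Collect_eq)
    qed
  qed
  have "open G" unfolding G_def by simp
  then have oD: "openin X D"
  proof -
    have "D = U1 \<inter> {r \<in> U. \<eta> r \<in> G}" unfolding D' using U1U by blast
    then show ?thesis using openin_Int[OF oU1 t(8)[OF \<open>open G\<close>]] by simp
  qed
  have r0D: "r0 \<in> D" unfolding D' using r0U1 e unfolding G_def by simp
  have DX: "D \<subseteq> topspace X" by (rule openin_subset[OF oD])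
  have fD: "f (a r) \<in> W" "p (b r) = f (a r)" if "r \<in> D" for r
    using that X_points[of r] DX unfolding D' U1_def by auto
  have cg: "continuous_map (top_of_set G) X g"
    unfolding g_def by (rule continuous_map_from_subtopology_mono[OF t(6)]) (use e(2) U1U in \<open>auto simp: G_def\<close>)
  have cbg: "continuous_map (top_of_set G) (mtop N) (b \<circ> g)" by (rule continuous_map_compose[OF cg b_continuous])
  let ?Z = "G - {\<eta> r0}"
  have Z: "connected ?Z" "?Z \<subseteq> G" "G \<subseteq> closure ?Z"
  proof -
    show "connected ?Z" unfolding G_def by (rule connected_open_delete) auto
    show "G \<subseteq> closure ?Z" unfolding G_def by (rule ball_subset_closure_punctured)
  qed auto
  note dn = dense_image_continuous[OF cbg Z]
  have bD: "b ` D = (b \<circ> g) ` G" unfolding D_def by (simp add: image_comp)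
  have inQ: "f (a r) \<in> Q" if r: "r \<in> D" for r
  proof -
    have ar: "a r \<in> points S" using X_points DX r by blast
    have "{t \<in> points S. f t = f (a r)} = {a r}" using Winj[OF _ ar _] fD(1)[OF r] ar by force
    then have "card {t \<in> points S. f t = f (a r)} = card {a r}" by (rule arg_cong)
    then have "card {t \<in> points S. f t = f (a r)} = 1" by simp
    then have "f (a r) \<notin> singular_points S f" unfolding singular_points_def by simp
    then show ?thesis unfolding Q_def using ar by blast
  qed
  have pbD: "p ` b ` D \<subseteq> A"
  proof -
    have "connectedin (mtop M) (p ` b ` D)"
      using connectedin_continuous_map_image[OF p_continuous dn(3)] unfolding bD .
    moreover have "p ` b ` D \<subseteq> Q" using fD inQ by auto
    ultimately have "connectedin (subtopology (mtop M) Q) (p ` b ` D)" by (simp add: connectedin_subtopology)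
    moreover have "p x \<in> p ` b ` D" using r0D r0 by blast
    then have "\<not> disjnt A (p ` b ` D)" using x(3) by (auto simp: disjnt_iff)
    ultimately show ?thesis using connected_components_of_maximal[OF A] by blast
  qed
  let ?P = "{x \<in> points N. p x \<in> A}"
  \<comment> \<open>The image of \<open>D\<close> is open in the preimage of \<open>A\<close>
    because \<open>b\<close> is closed and no point outside \<open>D\<close> shares its image with a
    point of \<open>D\<close>.\<close>
  have "closed_map X (mtop N) b"
    by (rule continuous_imp_closed_map[OF b_continuous X_compact[OF cS cN] HN])
  then have "closedin (mtop N) (b ` (topspace X - D))"
    using oD unfolding closed_map_def by blast
  then have "openin (mtop N) (points N - b ` (topspace X - D))" by blast
  then have "openin (subtopology (mtop N) ?P) (?P \<inter> (points N - b ` (topspace X - D)))"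
    by (rule openin_subtopology_Int2)
  moreover have "?P \<inter> (points N - b ` (topspace X - D)) = b ` D"
  proof
    show "?P \<inter> (points N - b ` (topspace X - D)) \<subseteq> b ` D"
    proof
      fix z assume z: "z \<in> ?P \<inter> (points N - b ` (topspace X - D))"
      then have "p z \<in> f ` points S" using AQ unfolding Q_def by blast
      then have "z \<in> b ` topspace X" using z unfolding image_b by blast
      then show "z \<in> b ` D" using z by blast
    qed
    show "b ` D \<subseteq> ?P \<inter> (points N - b ` (topspace X - D))"
    proof
      fix z assume "z \<in> b ` D"
      then obtain r where r: "r \<in> D" "z = b r" by blast
      have rX: "r \<in> topspace X" using r DX by blast
      have "b r \<notin> b ` (topspace X - D)"
      proof
        assume "b r \<in> b ` (topspace X - D)"
        then obtain r' where r': "r' \<in> topspace X" "r' \<notin> D" "b r = b r'" by auto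
        have "a r = a r'"
          by (rule Winj) (use X_points[OF rX] X_points[OF r'(1)] r'(3) fD(1)[OF r(1)] in auto)
        then show False using X_inj[OF rX r'(1)] r' r by blast
      qed
      then show "z \<in> ?P \<inter> (points N - b ` (topspace X - D))"
        using X_points[OF rX] pbD r by auto
    qed
  qed
  ultimately have op: "openin (subtopology (mtop N) ?P) (b ` D)" by simp
  have "b ` D \<inter> {x. p x \<in> points M - K} = (b \<circ> g) ` ?Z"
  proof
    show "b ` D \<inter> {x. p x \<in> points M - K} \<subseteq> (b \<circ> g) ` ?Z"
    proof
      fix z assume z: "z \<in> b ` D \<inter> {x. p x \<in> points M - K}"
      then obtain w where w: "w \<in> G" "z = b (g w)" unfolding bD by auto
      have "w \<noteq> \<eta> r0"
      proof
        assume "w = \<eta> r0"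
        then have "g w = r0" unfolding g_def using t(3) U(2) by simp
        then show False using z w pr0 by simp
      qed
      then show "z \<in> (b \<circ> g) ` ?Z" using w by auto
    qed
    show "(b \<circ> g) ` ?Z \<subseteq> b ` D \<inter> {x. p x \<in> points M - K}"
    proof
      fix z assume "z \<in> (b \<circ> g) ` ?Z"
      then obtain w where w: "w \<in> G" "w \<noteq> \<eta> r0" "z = b (g w)" by auto
      have gD: "g w \<in> D" unfolding D_def using w by blast
      have "g w \<noteq> r0" using gG(2)[OF w(1)] w(2) by auto
      then have "p z \<notin> K" using U(3)[of "g w"] gG(1)[OF w(1)] U1U w(3) by blast
      moreover have "p z \<in> points M" using p_points X_points DX gD w(3) by blast
      ultimately show "z \<in> b ` D \<inter> {x. p x \<in> points M - K}" using gD w(3) by blast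
    qed
  qed
  note bZ = this
  have "connectedin (mtop N) (b ` D \<inter> {x. p x \<in> points M - K})" unfolding bZ by (rule dn(1))
  moreover have "b ` D \<subseteq> mtop N closure_of (b ` D \<inter> {x. p x \<in> points M - K})" unfolding bZ unfolding bD by (rule dn(2))
  moreover have "x \<in> b ` D" using r0D r0 by blast
  ultimately show ?thesis using op by (intro exI[of _ "b ` D"] conjI)
qed

end

section \<open>Lifting the cells of the decomposition\<close>

lemma open_disk_euclidean:
  assumes "open_disk k M A" "DIM('e::euclidean_space) = k"
  shows "subtopology (mtop M) A homeomorphic_space (euclidean :: 'e topology)"
  using assms euclidean_homeomorphic_Euclidean_space[where 'e = 'e]
  unfolding open_disk_def by (metis homeomorphic_space_sym homeomorphic_space_trans)

lemma open_disk_transfer: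
  "subtopology (mtop N) C homeomorphic_space subtopology (mtop M) A \<Longrightarrow> open_disk k M A \<Longrightarrow> open_disk k N C"
  unfolding open_disk_def using homeomorphic_space_trans by blast

context surface_pullback
begin

text \<open>The type \<open>'e\<close> merely names the Euclidean space of dimension
  \<open>k\<close> in which the lifting takes place.\<close>

lemma unbranched_cell_lift:
  assumes A: "A \<in> components_of_set M Q" "A \<inter> K = {}"
    and C: "C \<in> connected_components_of (subtopology (mtop N) {x \<in> points N. p x \<in> A})"
    and d: "open_disk k M A" "DIM('e::euclidean_space) = k"
  shows "open_disk k N C"
proof -
  have AM: "A \<subseteq> points M"
    using connected_components_of_subset[OF A(1)[unfolded components_of_set_def]] by auto
  have "A \<subseteq> points M - K" using AM A(2) by blast
  from covering_cell_component[OF finite_covering_off_K this AM open_disk_euclidean[where 'e = 'e, OF d] C]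
  show ?thesis by (rule open_disk_transfer) (rule d(1))
qed

lemma branched_cell_lift:
  fixes h :: "'a \<Rightarrow> complex \<times> real" and T :: "real set"
  assumes cN: "compact_space (mtop N)"
    and A: "A \<in> components_of_set M Q"
    and C: "C \<in> connected_components_of (subtopology (mtop N) {x \<in> points N. p x \<in> A})"
    and h: "homeomorphic_map (subtopology (mtop M) A) (top_of_set (UNIV \<times> T)) h"
    and hK: "\<And>y. y \<in> A \<Longrightarrow> y \<in> K \<longleftrightarrow> fst (h y) = 0"
    and T: "convex T" "closed T"
    and loc: "\<And>x. x \<in> points N \<Longrightarrow> p x \<in> K \<Longrightarrow> p x \<in> A \<Longrightarrow>
       \<exists>U. openin (subtopology (mtop N) {x \<in> points N. p x \<in> A}) U \<and> x \<in> U \<and>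
         connectedin (mtop N) (U \<inter> {x. p x \<in> points M - K}) \<and> U \<subseteq> mtop N closure_of (U \<inter> {x. p x \<in> points M - K})"
    and d: "open_disk k M A"
  shows "open_disk k N C"
proof -
  have AM: "A \<subseteq> points M"
    using connected_components_of_subset[OF A(1)[unfolded components_of_set_def]] by auto
  have "subtopology (mtop N) C homeomorphic_space subtopology (mtop M) A"
  proof (rule branched_covering_cell_component[OF cN smooth_manifold_Hausdorff[OF N] smooth_manifold_Hausdorff[OF M]
        p_continuous finite_covering_off_K AM h _ T _ _ C])
    show "(y \<in> points M - K) = (fst (h y) \<noteq> 0)" if "y \<in> A" for y using hK[OF that] AM that by blast
    show "finite {x \<in> points N. p x = y}" if "y \<in> A - (points M - K)" for y
      by (rule finite_fibre_over_K[OF cN]) (use that AM in blast)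
    fix x assume x: "x \<in> points N" "p x \<in> A - (points M - K)"
    have "p x \<in> K" "p x \<in> A" using x AM by blast+
    then show "\<exists>U. openin (subtopology (mtop N) {x \<in> points N. p x \<in> A}) U \<and> x \<in> U \<and>
         connectedin (mtop N) (U \<inter> {x. p x \<in> points M - K}) \<and> U \<subseteq> mtop N closure_of (U \<inter> {x. p x \<in> points M - K})"
      by (rule loc[OF x(1)])
  qed
  then show ?thesis by (rule open_disk_transfer) (rule d)
qed

lemma component_lift:
  assumes "C \<in> components_of_set N {x \<in> points N. p x \<in> Q}"
  obtains A where "A \<in> components_of_set M Q" "C \<in> connected_components_of (subtopology (mtop N) {x \<in> points N. p x \<in> A})"
  using connected_component_preimage[OF p_continuous assms[unfolded components_of_set_def]]
  unfolding components_of_set_def by blast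

text \<open>The splitting conditions enter as normal forms of pairs: a face with its point of
  \<open>K\<close> is a plane with its origin, a region with its arc is
  \<open>complex \<times> real\<close> with \<open>axis\<close>. The singular sets upstairs are full
  preimages, so the cells upstairs are components of preimages of cells.\<close>

lemma fills_lift:
  assumes cS: "compact_space (mtop S)" and cN: "compact_space (mtop N)" and fl: "fills S M f"
    and reg: "\<And>R. R \<in> regions S M f \<Longrightarrow> R \<inter> K \<noteq> {} \<Longrightarrow> unknotted_in M R (R \<inter> K)"
    and fac: "\<And>F x y. F \<in> faces S M f \<Longrightarrow> x \<in> F \<inter> K \<Longrightarrow> y \<in> F \<inter> K \<Longrightarrow> x = y"
    and Sh: "mtop Sh = X" "Dehn_immersion Sh N b"
  shows "fills Sh N b"
proof -
  have sing: "singular_points Sh b = {x \<in> points N. p x \<in> singular_points S f}"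
    unfolding singular_points_def Sh(1) b_fibre_card by auto
  have trip: "triple_points Sh b = {x \<in> points N. p x \<in> triple_points S f}"
    unfolding triple_points_def Sh(1) b_fibre_card by auto
  have fle: "\<And>e. e \<in> edges S M f \<Longrightarrow> open_disk 1 M e" and flf: "\<And>F. F \<in> faces S M f \<Longrightarrow> open_disk 2 M F"
    and flr: "\<And>R. R \<in> regions S M f \<Longrightarrow> open_disk 3 M R"
    using fl unfolding fills_def by auto
  have edg: "open_disk 1 N C" if C: "C \<in> edges Sh N b" for C
  proof -
    let ?Q = "singular_points S f - triple_points S f"
    have e: "singular_points Sh b - triple_points Sh b = {x \<in> points N. p x \<in> ?Q}" unfolding sing trip by blast
    obtain A where A: "A \<in> components_of_set M ?Q" "C \<in> connected_components_of (subtopology (mtop N) {x \<in> points N. p x \<in> A})"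
      using component_lift[OF C[unfolded edges_def e]] .
    have "A \<subseteq> ?Q" using connected_components_of_subset[OF A(1)[unfolded components_of_set_def]] by auto
    then have "A \<inter> K = {}" using nonsing by blast
    moreover have "open_disk 1 M A" using fle A(1) unfolding edges_def by blast
    ultimately show ?thesis using unbranched_cell_lift[where 'e = real, OF A(1) _ A(2)] by simp
  qed
  have fcs: "open_disk 2 N C" if C: "C \<in> faces Sh N b" for C
  proof -
    let ?Q = "f ` points S - singular_points S f"
    have e: "b ` points Sh - singular_points Sh b = {x \<in> points N. p x \<in> ?Q}" unfolding sing Sh(1) image_b by blast
    obtain A where A: "A \<in> components_of_set M ?Q" "C \<in> connected_components_of (subtopology (mtop N) {x \<in> points N. p x \<in> A})"
      using component_lift[OF C[unfolded faces_def e]] .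
    have Af: "A \<in> faces S M f" using A(1) unfolding faces_def .
    note dA = flf[OF Af]
    have AM: "A \<subseteq> points M" using connected_components_of_subset[OF A(1)[unfolded components_of_set_def]] by auto
    show ?thesis
    proof (cases "A \<inter> K = {}")
      case True
      then show ?thesis using unbranched_cell_lift[where 'e = complex, OF A(1) True A(2) dA] by simp
    next
      case False
      then obtain y where y: "y \<in> A" "y \<in> K" by blast
      have yK: "z \<in> K \<longleftrightarrow> z = y" if "z \<in> A" for z using fac[OF Af, of z y] that y by blast
      have "subtopology (mtop M) A homeomorphic_space (euclidean :: complex topology)"
        by (rule open_disk_euclidean[OF dA]) simp
      then obtain h0 g0 where hg: "homeomorphic_maps (subtopology (mtop M) A) (euclidean :: complex topology) h0 g0"
        unfolding homeomorphic_space_def by blast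
      have tA: "topspace (subtopology (mtop M) A) = A" using AM by auto
      have c0: "continuous_map (subtopology (mtop M) A) euclidean h0" "continuous_map euclidean (subtopology (mtop M) A) g0"
        and i0: "\<And>z. z \<in> A \<Longrightarrow> g0 (h0 z) = z" "\<And>w. h0 (g0 w) = w"
        using hg tA unfolding homeomorphic_maps_def by auto
      \<comment> \<open>A translation moves the point of \<open>K\<close> to the origin; the second
        coordinate is a dummy that fits the plane into the product with
        \<open>T = {0}\<close>.\<close>
      define h where "h = (\<lambda>z. (h0 z - h0 y, 0::real))"
      define g where "g = (\<lambda>w::complex \<times> real. g0 (fst w + h0 y))"
      have "homeomorphic_maps (subtopology (mtop M) A) (top_of_set (UNIV \<times> {0})) h g"
        unfolding homeomorphic_maps_def
      proof (intro conjI ballI)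
        have "continuous_map (subtopology (mtop M) A) euclidean ((\<lambda>w. (w - h0 y, 0::real)) \<circ> h0)"
          by (rule continuous_map_compose[OF c0(1)]) (auto intro!: continuous_intros)
        then show "continuous_map (subtopology (mtop M) A) (top_of_set (UNIV \<times> {0})) h"
          unfolding h_def by (auto simp: continuous_map_in_subtopology o_def)
        have "continuous_map (top_of_set (UNIV \<times> {0})) (subtopology (mtop M) A) (g0 \<circ> (\<lambda>w::complex \<times> real. fst w + h0 y))"
          by (rule continuous_map_compose[OF _ c0(2)]) (auto intro!: continuous_intros)
        then show "continuous_map (top_of_set (UNIV \<times> {0})) (subtopology (mtop M) A) g"
          unfolding g_def by (simp add: o_def)
        show "g (h z) = z" if "z \<in> topspace (subtopology (mtop M) A)" for z
          using that i0(1) unfolding tA h_def g_def by simp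
        show "h (g w) = w" if "w \<in> topspace (top_of_set (UNIV \<times> {0}))" for w
          using that i0(2) unfolding h_def g_def by (auto simp: prod_eq_iff)
      qed
      then have h: "homeomorphic_map (subtopology (mtop M) A) (top_of_set (UNIV \<times> {0})) h"
        using homeomorphic_maps_map by blast
      show ?thesis
      proof (rule branched_cell_lift[OF cN A h])
        show "z \<in> K \<longleftrightarrow> fst (h z) = 0" if "z \<in> A" for z
        proof -
          have "h0 z = h0 y \<longleftrightarrow> z = y" using i0(1)[OF that] i0(1)[OF y(1)] by metis
          then show ?thesis unfolding yK[OF that] h_def by simp
        qed
        show "convex {0::real}" "closed {0::real}" "open_disk 2 M A" using dA by auto
      qed (rule face_local[OF cS cN _ _ _ A(1)[unfolded components_of_set_def]])
    qed
  qed
  have rgs: "open_disk 3 N C" if C: "C \<in> regions Sh N b" for C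
  proof -
    let ?Q = "points M - f ` points S"
    have e: "points N - b ` points Sh = {x \<in> points N. p x \<in> ?Q}" unfolding Sh(1) image_b using p_points by blast
    obtain A where A: "A \<in> components_of_set M ?Q" "C \<in> connected_components_of (subtopology (mtop N) {x \<in> points N. p x \<in> A})"
      using component_lift[OF C[unfolded regions_def e]] .
    have Ar: "A \<in> regions S M f" using A(1) unfolding regions_def .
    note dA = flr[OF Ar]
    show ?thesis
    proof (cases "A \<inter> K = {}")
      case True
      then show ?thesis using unbranched_cell_lift[where 'e = "complex \<times> real", OF A(1) True A(2) dA] by simp
    next
      case False
      obtain h :: "'a \<Rightarrow> complex \<times> real" where h: "homeomorphic_map (subtopology (mtop M) A) euclidean h" "h ` (A \<inter> K) = axis"
        using reg[OF Ar False] unfolding unknotted_in_def by blast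
      have AM: "A \<subseteq> points M" using connected_components_of_subset[OF A(1)[unfolded components_of_set_def]] by auto
      then have inj: "inj_on h A" using homeomorphic_imp_injective_map[OF h(1)] by (simp add: Int_absorb1)
      have h': "homeomorphic_map (subtopology (mtop M) A) (top_of_set (UNIV \<times> UNIV)) h" using h(1) by simp
      \<comment> \<open>Compactness of \<open>S\<close> makes the surface closed, so its complement
        is open, as \<open>region_local\<close> requires.\<close>
      have "closed_map (mtop S) (mtop M) f"
        by (rule continuous_imp_closed_map[OF f_continuous cS smooth_manifold_Hausdorff[OF M]])
      then have "closedin (mtop M) (f ` points S)" unfolding closed_map_def by blast
      then have oQ: "openin (mtop M) ?Q" by blast
      show ?thesis
      proof (rule branched_cell_lift[OF cN A h'])
        show "z \<in> K \<longleftrightarrow> fst (h z) = 0" if z: "z \<in> A" for z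
        proof -
          have "z \<in> K \<longleftrightarrow> h z \<in> h ` (A \<inter> K)" using inj_on_image_mem_iff[OF inj z, of "A \<inter> K"] z by blast
          then show ?thesis unfolding h(2) axis_def by (simp add: mem_Times_iff)
        qed
        show "convex (UNIV :: real set)" "closed (UNIV :: real set)" "open_disk 3 M A" using dA by auto
      qed (rule region_local[OF _ _ _ A(1)[unfolded components_of_set_def] oQ])
    qed
  qed
  show ?thesis unfolding fills_def by (intro conjI ballI Sh(2) edg fcs rgs)
qed

end

section \<open>A copy of the fibre product inside the reals\<close>

lemma second_countable_Hausdorff_inj_real:
  assumes "second_countable X" "Hausdorff_space X"
  obtains g :: "'a \<Rightarrow> real" where "inj_on g (topspace (X :: 'a topology))"
proof -
  obtain A where A: "countable A" "\<forall>V\<in>A. openin X V" "\<forall>U x. openin X U \<and> x \<in> U \<longrightarrow> (\<exists>V\<in>A. x \<in> V \<and> V \<subseteq> U)"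
    using assms(1) unfolding second_countable_def by blast
  obtain e :: "'a set \<Rightarrow> nat" where e: "inj_on e A" using A(1) unfolding countable_def by blast
  \<comment> \<open>A point is coded by the basic open sets around it. The Hausdorff property makes
    the code injective, and sets of naturals are equinumerous with the reals.\<close>
  define c where "c = (\<lambda>x. e ` {V \<in> A. x \<in> V})"
  have "inj_on c (topspace X)"
  proof (rule inj_onI, rule ccontr)
    fix x y assume xy: "x \<in> topspace X" "y \<in> topspace X" "c x = c y" "x \<noteq> y"
    obtain U V where UV: "openin X U" "openin X V" "x \<in> U" "y \<in> V" "disjnt U V"
      using assms(2)[unfolded Hausdorff_space_def, rule_format, of x y] xy(1,2,4) by blast
    obtain W where W: "W \<in> A" "x \<in> W" "W \<subseteq> U" using A(3) UV by blast
    have "{V \<in> A. x \<in> V} = {V \<in> A. y \<in> V}"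
      using xy(3) inj_on_image_eq_iff[OF e, of "{V \<in> A. x \<in> V}" "{V \<in> A. y \<in> V}"] unfolding c_def by simp
    then have "y \<in> W" using W by blast
    then show False using UV W by (auto simp: disjnt_iff)
  qed
  moreover obtain k :: "nat set \<Rightarrow> real" where "bij k"
    using nat_sets_eqpoll_reals unfolding eqpoll_def by blast
  ultimately have "inj_on (k \<circ> c) (topspace X)" by (metis bij_is_inj comp_inj_on inj_on_subset subset_UNIV)
  then show thesis by (rule that)
qed

text \<open>Moves the topology of \<open>Y\<close> to its image under an injection, here into
  \<open>real\<close>; the topology carried there has nothing to do with the usual one.\<close>

lemma homeomorphic_map_pullback_inverse:
  assumes g: "inj_on g (topspace Y)"
  shows "homeomorphic_map (pullback_topology (g ` topspace Y) (inv_into (topspace Y) g) Y) Y (inv_into (topspace Y) g)"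
proof -
  let ?A = "g ` topspace Y" and ?i = "inv_into (topspace Y) g"
  let ?X = "pullback_topology ?A ?i Y"
  have iA: "?i r \<in> topspace Y" "g (?i r) = r" if "r \<in> ?A" for r
    using that by (auto simp: inv_into_into f_inv_into_f)
  have tX: "topspace ?X = ?A" unfolding topspace_pullback_topology using iA by auto
  have im: "?i ` ?A = topspace Y" using g by (auto simp: image_image inv_into_f_f)
  have "continuous_map ?X Y ?i"
    unfolding continuous_map_def tX
  proof (intro conjI allI impI)
    show "?i \<in> ?A \<rightarrow> topspace Y" using iA by auto
    fix U assume "openin Y U"
    moreover have "{x \<in> ?A. ?i x \<in> U} = ?i -` U \<inter> ?A" by auto
    ultimately show "openin ?X {x \<in> ?A. ?i x \<in> U}" unfolding openin_pullback_topology by blast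
  qed
  moreover have "open_map ?X Y ?i"
    unfolding open_map_def
  proof (intro allI impI)
    fix U assume "openin ?X U"
    then obtain V where V: "openin Y V" "U = ?i -` V \<inter> ?A" unfolding openin_pullback_topology by blast
    have "?i ` U = V"
    proof
      show "?i ` U \<subseteq> V" unfolding V(2) by auto
      show "V \<subseteq> ?i ` U"
      proof
        fix v assume v: "v \<in> V"
        then have "v \<in> topspace Y" using openin_subset[OF V(1)] by blast
        then show "v \<in> ?i ` U" unfolding V(2) using v g by (intro image_eqI[of _ _ "g v"]) auto
      qed
    qed
    then show "openin Y (?i ` U)" using V(1) by simp
  qed
  moreover have "inj_on ?i (topspace ?X)" unfolding tX by (rule inj_on_inverseI[of _ g]) (rule iA(2))
  ultimately show ?thesis
    by (intro bijective_open_imp_homeomorphic_map) (simp_all add: tX im)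
qed

theorem theorem3p2:
  fixes M :: "('a, real ^ 3) mfd" and Mhat :: "('b, real ^ 3) mfd"
    and K :: "'a set" and \<Sigma> :: "'a set" and p :: "'b \<Rightarrow> 'a"
  assumes "closed_orientable_3manifold M"
    and "tame_link M K"
    and "filling_Dehn_surface M \<Sigma>"
    and "splits M \<Sigma> K"
    and "closed_orientable_3manifold Mhat"
    and "branched_covering Mhat M K p"
  shows "filling_Dehn_surface Mhat {x \<in> points Mhat. p x \<in> \<Sigma>}"
proof -
  have M: "smooth_manifold M" using assms(1) unfolding closed_orientable_3manifold_def by (rule conjunct1)
  have N: "smooth_manifold Mhat" and cN: "compact_space (mtop Mhat)"
    using assms(5) unfolding closed_orientable_3manifold_def by simp_all
  have pm: "smooth_map_on Mhat (points Mhat) M p"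
    and cov: "\<exists>n\<ge>1. \<forall>y\<in>points M - K. \<exists>W. openin (mtop M) W \<and> y \<in> W \<and> W \<inter> K = {} \<and> evenly_covered Mhat M p n W"
    and br: "\<forall>x\<in>points Mhat. p x \<in> K \<longrightarrow>
        (\<exists>k\<ge>1. \<exists>U V (\<phi> :: 'b \<Rightarrow> complex \<times> real) \<psi>. x \<in> U \<and> smooth_chart Mhat U \<phi> \<and>
           slice_chart M K V \<psi> \<and> p ` U \<subseteq> V \<and> (\<forall>u\<in>U. \<psi> (p u) = (fst (\<phi> u) ^ k, snd (\<phi> u))))"
    using assms(6) unfolding branched_covering_def by simp_all
  from cov obtain n where n: "\<forall>y\<in>points M - K. \<exists>W. openin (mtop M) W \<and> y \<in> W \<and> W \<inter> K = {} \<and> evenly_covered Mhat M p n W"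
    by (elim exE conjE) (rule that)
  \<comment> \<open>One pair \<open>S\<close>, \<open>f\<close> is needed that both fills
    \<open>M\<close> and meets \<open>K\<close> as required; \<open>splits\<close> provides
    it.\<close>
  from assms(4)[unfolded splits_def] obtain S :: "(real, real ^ 2) mfd" and f
    where fl: "fills S M f" and im: "f ` points S = \<Sigma>" and ns: "K \<inter> singular_points S f = {}" and tr: "transverse S M f K"
      and reg: "\<forall>R\<in>regions S M f. R \<inter> K \<noteq> {} \<longrightarrow>
        R \<inter> K \<in> components_of_set M (K - \<Sigma>) \<and> unknotted_in M R (R \<inter> K)"
      and fac: "\<forall>F\<in>faces S M f. \<forall>x\<in>F \<inter> K. \<forall>y\<in>F \<inter> K. x = y"
    by (elim exE conjE) (rule that)
  have Di: "Dehn_immersion S M f" using fl unfolding fills_def by (rule conjunct1)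
  have S: "smooth_manifold S" and oS: "orientable S" and cS: "compact_space (mtop S)"
    and imm: "immersion S M f" and gp: "general_position S M f"
    using Di unfolding Dehn_immersion_def closed_orientable_surface_def by simp_all
  from oS[unfolded orientable_def] obtain B where B: "oriented_atlas S B"
    unfolding oriented_atlas_def ..
  define Y where "Y = subtopology (prod_topology (mtop S) (mtop Mhat)) {(s, x). f s = p x}"
  have "second_countable Y" "Hausdorff_space Y"
    unfolding Y_def using S N unfolding smooth_manifold_def
    by (simp_all add: second_countable_subtopology second_countable_prod Hausdorff_space_subtopology Hausdorff_space_prod_topology)
  then obtain g :: "real \<times> 'b \<Rightarrow> real" where g: "inj_on g (topspace Y)" by (rule second_countable_Hausdorff_inj_real)
  define X where "X = pullback_topology (g ` topspace Y) (inv_into (topspace Y) g) Y"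
  define a where "a = (\<lambda>r. fst (inv_into (topspace Y) g r))"
  define b where "b = (\<lambda>r. snd (inv_into (topspace Y) g r))"
  have X: "homeomorphic_map X Y (\<lambda>r. (a r, b r))"
    using homeomorphic_map_pullback_inverse[OF g] unfolding X_def a_def b_def by simp
  interpret surface_pullback S M Mhat f p K n B X a b
    by unfold_locales (use S M N B imm gp pm n br tr ns X[unfolded Y_def] in blast)+
  obtain Sh :: "(real, real ^ 2) mfd" where Sh: "mtop Sh = X" "Dehn_immersion Sh Mhat b"
    by (rule lifted_surface[OF cS cN])
  have "fills Sh Mhat b"
    by (rule fills_lift[OF cS cN fl _ _ Sh]) (use reg fac in blast)+
  moreover have "b ` points Sh = {x \<in> points Mhat. p x \<in> \<Sigma>}" unfolding Sh(1) image_b im ..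
  ultimately show ?thesis unfolding filling_Dehn_surface_def by blast
qed

end
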